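(* Let $n\ge2$ and $s\in(1/2,1)$. Assume that $u_0\in C^\infty_{\mathrm b}(\mathbb{R}^n)$ is radial and radially nonincreasing. Then there exists a classical and radial solution $u\in C^\infty_{\mathrm b}(\mathbb{R}^n\times[0,\infty))$ of $$\partial_tu=\Delta_\infty^su\ \text{ in }\mathbb{R}^n\times(0,\infty),\qquad u(\cdot,0)=u_0 .$$ Moreover, if $U_0:\mathbb{R}\to\mathbb{R}$ is defined by $U_0(r):=u_0(x)$ for $r=|x|\ge0$ and $U_0(-r):=U_0(r)$, then for all $t>0$ and all $x$ with $|x|=r$, $$u(x,t)=(P_s(\cdot,t)*U_0)(r)=\int_{-\infty}^\infty P_s(r-\sigma,t)\,U_0(\sigma)\,d\sigma .$$
   Context: $C^\infty_{\mathrm b}(U)$: functions on $U$ with bounded continuous derivatives of all orders. $C_s=\frac{4^s s\,\Gamma(\frac12+s)}{\pi^{1/2}\Gamma(1-s)}$. For $\phi$ bounded on $\mathbb{R}^n$ and $C^{1,1}$ at $x$ (i.e. $|\phi(x+y)-\phi(x)-\nabla\phi(x)\cdot y|\le C_x|y|^2$ for $|y|<\eta_x$, for some $C_x,\eta_x>0$): if $\nabla\phi(x)\ne0$, with $\zeta=\nabla\phi(x)/|\nabla\phi(x)|$, $$\Delta^s_\infty\phi(x)=C_s\int_0^\infty(\phi(x+\eta\zeta)+\phi(x-\eta\zeta)-2\phi(x))\frac{d\eta}{\eta^{1+2s}};$$ if $\nabla\phi(x)=0$, $$\Delta^s_\infty\phi(x)=C_s\sup_{|y|=1}\int_0^\infty(\phi(x+\eta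 y)-\phi(x))\frac{d\eta}{\eta^{1+2s}}+C_s\inf_{|y|=1}\int_0^\infty(\phi(x-\eta y)-\phi(x))\frac{d\eta}{\eta^{1+2s}}.$$ The operator acts in the space variable; a classical solution satisfies the equation and the initial condition pointwise. $P_s(x,t)=\mathcal{F}^{-1}(e^{-|\xi|^{2s}t})(x)$, $x\in\mathbb{R}$, $t>0$, is the fundamental solution of the one-dimensional fractional heat equation $\partial_tv+(-\partial_{xx}^2)^sv=0$ (heat kernel with total mass $1$), where $(-\partial^2_{xx})^s\Phi(x)=-C_s\int_0^\infty(\Phi(x+\eta)+\Phi(x-\eta)-2\Phi(x))\frac{d\eta}{\eta^{1+2s}}$. *)

theory Defs
  imports "HOL-Analysis.Analysis"
begin

text \<open>
  Bounded continuous derivatives up to order \<open>k\<close> on \<open>U\<close>.  Derivatives are Frechet derivatives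
  relative to \<open>U\<close>, so on \<open>\<real>\<^sup>n \<times> [0,\<infinity>)\<close> the time derivatives at \<open>t = 0\<close> are one-sided.  The definition is
  meant for sets on which these derivatives are unique, such as open sets or convex sets with
  nonempty interior.  Only the values of the function on \<open>U\<close> matter.
\<close>

primrec Cb_upto :: "nat \<Rightarrow> 'a::euclidean_space set \<Rightarrow> ('a \<Rightarrow> real) \<Rightarrow> bool" where
  "Cb_upto 0 U f \<longleftrightarrow> continuous_on U f \<and> bounded (f ` U)"
| "Cb_upto (Suc k) U f \<longleftrightarrow> continuous_on U f \<and> bounded (f ` U) \<and>
     (\<exists>f'. (\<forall>x\<in>U. (f has_derivative f' x) (at x within U)) \<and>
           (\<forall>b\<in>Basis. Cb_upto k U (\<lambda>x. f' x b)))"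

definition Cb_infty :: "'a::euclidean_space set \<Rightarrow> ('a \<Rightarrow> real) set" where
  "Cb_infty U = {f. \<forall>k. Cb_upto k U f}"

definition radial :: "('a::real_normed_vector \<Rightarrow> real) \<Rightarrow> bool" where
  "radial f \<longleftrightarrow> (\<forall>x y. norm x = norm y \<longrightarrow> f x = f y)"

definition radially_nonincreasing :: "('a::real_normed_vector \<Rightarrow> real) \<Rightarrow> bool" where
  "radially_nonincreasing f \<longleftrightarrow> (\<forall>x y. norm x \<le> norm y \<longrightarrow> f y \<le> f x)"

definition gradient :: "('a::real_inner \<Rightarrow> real) \<Rightarrow> 'a \<Rightarrow> 'a" where
  "gradient \<phi> x = (THE D. GDERIV \<phi> x :> D)"

definition C_const :: "real \<Rightarrow> real" where
  "C_const s = 4 powr s * s * Gamma (1/2 + s) / (sqrt pi * Gamma (1 - s))"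

text \<open>
  The infinity fractional Laplacian of \<open>\<phi>\<close> at \<open>x\<close>.  It is meaningful for (measurable) \<open>\<phi>\<close> that is
  bounded and \<open>C\<^sup>1\<^sup>,\<^sup>1\<close> at \<open>x\<close>: the integrals then converge absolutely, and in the second case they
  are bounded uniformly in the direction \<open>y\<close>, so that the supremum and infimum are genuine.
  This covers every \<open>\<phi>\<close> with bounded continuous derivatives of all orders.
\<close>

definition infty_frac_laplacian :: "real \<Rightarrow> ('a::euclidean_space \<Rightarrow> real) \<Rightarrow> 'a \<Rightarrow> real" where
  "infty_frac_laplacian s \<phi> x =
     (if gradient \<phi> x \<noteq> 0 then
        let \<zeta> = gradient \<phi> x /\<^sub>R norm (gradient \<phi> x) in
        C_const s * (LBINT \<eta>:{0<..}.
          (\<phi> (x + \<eta> *\<^sub>R \<zeta>) + \<phi> (x - \<eta> *\<^sub>R \<zeta>) - 2 * \<phi> x) / \<eta> powr (1 + 2 * s))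
      else
        C_const s * (SUP y\<in>sphere 0 1. LBINT \<eta>:{0<..}. (\<phi> (x + \<eta> *\<^sub>R y) - \<phi> x) / \<eta> powr (1 + 2 * s))
      + C_const s * (INF y\<in>sphere 0 1. LBINT \<eta>:{0<..}. (\<phi> (x - \<eta> *\<^sub>R y) - \<phi> x) / \<eta> powr (1 + 2 * s)))"

definition classical_solution ::
    "real \<Rightarrow> ('a::euclidean_space \<Rightarrow> real) \<Rightarrow> ('a \<Rightarrow> real \<Rightarrow> real) \<Rightarrow> bool" where
  "classical_solution s u\<^sub>0 u \<longleftrightarrow>
     (\<forall>x. \<forall>t>0. ((\<lambda>\<tau>. u x \<tau>) has_real_derivative infty_frac_laplacian s (\<lambda>y. u y t) x) (at t)) \<and>
     (\<forall>x. u x 0 = u\<^sub>0 x)"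

text \<open>
  The normalisation of the inverse Fourier transform is the one for which the operator with
  constant \<open>C_const s\<close> in one dimension has symbol \<open>\<bar>\<xi>\<bar>\<close> to the power \<open>2 s\<close>, and for which the
  heat kernel has total mass \<open>1\<close>.
\<close>

definition inverse_fourier :: "(real \<Rightarrow> complex) \<Rightarrow> real \<Rightarrow> complex" where
  "inverse_fourier g x = (1 / (2 * pi)) * (LBINT \<xi>. cis (x * \<xi>) * g \<xi>)"

text \<open>The inverse transform below is real, as its argument is even and real; \<open>Re\<close> only adjusts the type.\<close>

definition frac_heat_kernel :: "real \<Rightarrow> real \<Rightarrow> real \<Rightarrow> real" where
  "frac_heat_kernel s x t =
     Re (inverse_fourier (\<lambda>\<xi>. of_real (exp (- (\<bar>\<xi>\<bar> powr (2 * s)) * t))) x)"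

end

theory Submission
  imports Defs "HOL-Probability.Probability"
begin

text \<open>
  For a radial, radially nonincreasing function the supremum and the infimum in the degenerate case are
  attained in the radial direction, so on such functions the infinity fractional Laplacian is the
  one-dimensional fractional Laplacian of the even profile. It therefore suffices to know that the
  one-dimensional fractional heat flow keeps even nonincreasing profiles smooth, even and nonincreasing.
  The flow is obtained as the uniform limit of the compound Poisson semigroups whose jump kernels are the
  truncations \<open>max \<bar>y\<bar> (1/n)\<close> to the power \<open>-1-2s\<close>. These kernels are even and nonincreasing, and
  convolution with them preserves this class of profiles. Everything commutes with translations, which
  yields smoothness in space and time. The flow is identified with the convolution by the heat kernel
  through its action on \<open>cos (\<xi> x)\<close>, tested on Gaussians.
\<close>

section \<open>Semigroups generated by integrable jump kernels\<close>

text \<open>Starting from \<open>frac_heat_kernel\<close> itself would require its positivity and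
  its monotonicity on the half line, and neither is visible in an oscillating integral. For jump
  kernels of finite mass both order properties are inherited term by term from a power series with
  nonnegative coefficients; positivity of the heat kernel then comes out as a limit. On smooth
  functions the truncated generators differ from the fractional Laplacian by a constant times
  \<open>err n\<close>, uniformly in space, and a maximum principle turns this into convergence of
  the semigroups at rate \<open>err n * t\<close>, although the masses of the kernels blow up. A
  separate obstacle is the origin of the n-dimensional space, where the norm is not smooth. The
  gradient of a radial function contains the quotient f'(r)/r, which for even f is an average of
  f''; so every derivative of the radial extension consumes two of the profile. The exact value of
  \<open>C_const s\<close> enters through one identity, the integral of
  \<open>\<nu> y * (1 - cos y)\<close> being \<open>1\<close>, which makes
  \<open>\<bar>\<xi>\<bar> powr (2 * s)\<close> the symbol.\<close>

lemma integrable_mult_bounded: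
  fixes f g :: "real \<Rightarrow> real"
  assumes "integrable lborel g" and [measurable]: "f \<in> borel_measurable borel" and "\<And>y. \<bar>f y\<bar> \<le> M"
  shows "integrable lborel (\<lambda>y. f y * g y)"
proof (rule Bochner_Integration.integrable_bound)
  show "integrable lborel (\<lambda>y. M * g y)" using assms(1) by simp
  have [measurable]: "g \<in> borel_measurable borel" using assms(1) by auto
  show "(\<lambda>y. f y * g y) \<in> borel_measurable lborel" by measurable
  have "0 \<le> M" using assms(3)[of 0] by linarith
  then show "AE y in lborel. norm (f y * g y) \<le> norm (M * g y)"
    using assms(3) by (intro AE_I2) (auto simp: abs_mult intro!: mult_right_mono)
qed

lemma abs_integral_mult_le:
  fixes f g :: "real \<Rightarrow> real"
  assumes "integrable lborel g" "f \<in> borel_measurable borel" "\<And>y. \<bar>f y\<bar> \<le> M" "\<And>y. 0 \<le> g y"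
  shows "\<bar>LBINT y. f y * g y\<bar> \<le> M * (LBINT y. g y)"
proof -
  have "\<bar>LBINT y. f y * g y\<bar> \<le> (LBINT y. M * g y)"
  proof (rule integral_abs_bound_integral)
    show "integrable lborel (\<lambda>y. f y * g y)" by (rule integrable_mult_bounded[OF assms(1-3)])
  qed (use assms in \<open>auto simp: abs_mult intro!: mult_right_mono\<close>)
  then show ?thesis by simp
qed

lemma integrable_lborel_times:
  fixes f g :: "real \<Rightarrow> real"
  assumes f: "integrable lborel f" and g: "integrable lborel g"
  shows "integrable (lborel \<Otimes>\<^sub>M lborel) (\<lambda>(x, y). f x * g y)"
proof (rule lborel_pair.Fubini_integrable)
  have [measurable]: "f \<in> borel_measurable borel" "g \<in> borel_measurable borel"
    using f g by auto
  show "(\<lambda>(x, y). f x * g y) \<in> borel_measurable (lborel \<Otimes>\<^sub>M lborel)" by measurable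
  show "integrable lborel (\<lambda>x. LBINT y. norm (case (x, y) of (x, y) \<Rightarrow> f x * g y))"
    using f by (simp add: abs_mult)
  show "AE x in lborel. integrable lborel (\<lambda>y. case (x, y) of (x, y) \<Rightarrow> f x * g y)"
    using g by simp
qed

text \<open>The two integrable weights dominate the integrand on the plane, since \<open>h\<close>
  is bounded. With a jump kernel as one weight this exchanges a convolution with an integral over a
  parameter.\<close>

lemma Fubini_weighted:
  fixes v w :: "real \<Rightarrow> real" and h :: "real \<Rightarrow> real \<Rightarrow> real"
  assumes v: "integrable lborel v" and w: "integrable lborel w"
    and h[measurable]: "(\<lambda>(x, y). h x y) \<in> borel_measurable (borel \<Otimes>\<^sub>M borel)"
    and M: "\<And>x y. \<bar>h x y\<bar> \<le> M"
  shows "(LBINT x. v x * (LBINT y. w y * h x y)) = (LBINT y. w y * (LBINT x. v x * h x y))"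
proof -
  have [measurable]: "v \<in> borel_measurable borel" "w \<in> borel_measurable borel"
    using v w by auto
  have h': "(\<lambda>z. h (fst z) (snd z)) \<in> borel_measurable (borel \<Otimes>\<^sub>M borel)"
    using h by (simp add: case_prod_unfold)
  have "integrable (lborel \<Otimes>\<^sub>M lborel) (\<lambda>(x, y). v x * w y * h x y)"
  proof (rule Bochner_Integration.integrable_bound)
    show "integrable (lborel \<Otimes>\<^sub>M lborel) (\<lambda>z. M * (case z of (x, y) \<Rightarrow> v x * w y))"
      using integrable_lborel_times[OF v w] by simp
    show "(\<lambda>(x, y). v x * w y * h x y) \<in> borel_measurable (lborel \<Otimes>\<^sub>M lborel)"
      by measurable
    have "\<bar>v x\<bar> * \<bar>w y\<bar> * \<bar>h x y\<bar> \<le> \<bar>v x\<bar> * \<bar>w y\<bar> * \<bar>M\<bar>" for x y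
      using M[of x y] by (intro mult_left_mono) auto
    then show "AE z in lborel \<Otimes>\<^sub>M lborel. norm (case z of (x, y) \<Rightarrow> v x * w y * h x y)
        \<le> norm (M * (case z of (x, y) \<Rightarrow> v x * w y))"
      by (intro AE_I2) (auto simp: abs_mult mult_ac)
  qed
  from lborel_pair.Fubini_integral[OF this]
  have "(LBINT y. LBINT x. v x * w y * h x y) = (LBINT x. LBINT y. v x * w y * h x y)" .
  then show ?thesis by (simp add: mult_ac flip: integral_mult_right_zero)
qed

locale jump_kernel =
  fixes k :: "real \<Rightarrow> real"
  assumes k_nonneg: "0 \<le> k y" and k_integrable: "integrable lborel k" and k_even: "k (- y) = k y"
begin

lemma k_measurable [measurable]: "k \<in> borel_measurable borel"
  using k_integrable by auto

definition mass :: real where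
  "mass = (LBINT y. k y)"

definition jump :: "(real \<Rightarrow> real) \<Rightarrow> real \<Rightarrow> real" where
  "jump f x = (LBINT y. k y * f (x + y))"

definition gen :: "(real \<Rightarrow> real) \<Rightarrow> real \<Rightarrow> real" where
  "gen f x = jump f x - mass * f x"

text \<open>This is exp(t gen) with the scalar part split off: only powers of the positive operator
  \<open>jump\<close> are summed, so for \<open>0 <= t\<close> every term preserves order. The
  series is pointwise, which keeps the argument on bounded Borel functions without operator
  norms.\<close>

definition semi :: "real \<Rightarrow> (real \<Rightarrow> real) \<Rightarrow> real \<Rightarrow> real" where
  "semi t f x = exp (- (mass * t)) * (\<Sum>n. (jump ^^ n) f x / fact n * t ^ n)"

lemma mass_nonneg: "0 \<le> mass"
  unfolding mass_def by (rule Bochner_Integration.integral_nonneg) (simp add: k_nonneg)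

lemma jump_integrable:
  assumes "f \<in> borel_measurable borel" and "\<And>x. \<bar>f x\<bar> \<le> M"
  shows "integrable lborel (\<lambda>y. k y * f (x + y))"
  using integrable_mult_bounded[OF k_integrable, of "\<lambda>y. f (x + y)" M] assms
  by (simp add: mult.commute)

lemma jump_measurable [measurable]:
  assumes [measurable]: "f \<in> borel_measurable borel"
  shows "jump f \<in> borel_measurable borel"
  unfolding jump_def by measurable

lemma jump_bound:
  assumes "f \<in> borel_measurable borel" and "\<And>x. \<bar>f x\<bar> \<le> M"
  shows "\<bar>jump f x\<bar> \<le> mass * M"
  using abs_integral_mult_le[OF k_integrable, of "\<lambda>y. f (x + y)" M] assms k_nonneg
  by (simp add: jump_def mass_def mult.commute)

lemma jump_mono:
  assumes "f \<in> borel_measurable borel" "\<And>x. \<bar>f x\<bar> \<le> M" "g \<in> borel_measurable borel" "\<And>x. \<bar>g x\<bar> \<le> N"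
    and "\<And>x. f x \<le> g x"
  shows "jump f x \<le> jump g x"
  unfolding jump_def
  using assms by (intro integral_mono jump_integrable) (auto intro!: mult_left_mono k_nonneg)

lemma jump_pow_measurable [measurable]:
  assumes "f \<in> borel_measurable borel"
  shows "(jump ^^ n) f \<in> borel_measurable borel"
  using assms by (induction n) (auto intro: jump_measurable)

lemma jump_pow_bound:
  assumes "f \<in> borel_measurable borel" and "\<And>x. \<bar>f x\<bar> \<le> M"
  shows "\<bar>(jump ^^ n) f x\<bar> \<le> mass ^ n * M"
proof (induction n arbitrary: x)
  case (Suc n)
  have "\<bar>jump ((jump ^^ n) f) x\<bar> \<le> mass * (mass ^ n * M)"
    using Suc assms(1) by (intro jump_bound jump_pow_measurable) auto
  then show ?case by (simp add: mult_ac)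
qed (use assms in simp)

lemma jump_linear:
  assumes "f \<in> borel_measurable borel" "\<And>x. \<bar>f x\<bar> \<le> M" "g \<in> borel_measurable borel" "\<And>x. \<bar>g x\<bar> \<le> N"
  shows "jump (\<lambda>x. a * f x + b * g x) x = a * jump f x + b * jump g x"
proof -
  have "jump (\<lambda>x. a * f x + b * g x) x = (LBINT y. a * (k y * f (x + y)) + b * (k y * g (x + y)))"
    unfolding jump_def by (intro Bochner_Integration.integral_cong) (auto simp: algebra_simps)
  also have "\<dots> = a * jump f x + b * jump g x"
    unfolding jump_def using jump_integrable[of f M x] jump_integrable[of g N x] assms by simp
  finally show ?thesis .
qed

lemma jump_pow_linear:
  assumes "f \<in> borel_measurable borel" "\<And>x. \<bar>f x\<bar> \<le> M" "g \<in> borel_measurable borel" "\<And>x. \<bar>g x\<bar> \<le> N"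
  shows "(jump ^^ n) (\<lambda>x. a * f x + b * g x) x = a * (jump ^^ n) f x + b * (jump ^^ n) g x"
proof (induction n arbitrary: x)
  case (Suc n)
  have "jump ((jump ^^ n) (\<lambda>x. a * f x + b * g x)) x
      = jump (\<lambda>x. a * (jump ^^ n) f x + b * (jump ^^ n) g x) x"
    using Suc by presburger
  also have "\<dots> = a * jump ((jump ^^ n) f) x + b * jump ((jump ^^ n) g) x"
    using assms by (intro jump_linear[OF _ jump_pow_bound[of f M n] _ jump_pow_bound[of g N n]]) auto
  finally show ?case by simp
qed simp

lemma jump_pow_translate: "(jump ^^ n) (\<lambda>x. f (x + a)) x = (jump ^^ n) f (x + a)"
  by (induction n arbitrary: x) (auto simp: jump_def add_ac)

lemma jump_pow_const: "(jump ^^ n) (\<lambda>x. c) x = mass ^ n * c"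
proof (induction n arbitrary: x)
  case (Suc n)
  then show ?case by (simp add: jump_def mass_def)
qed simp

lemma jump_parametric:
  fixes w :: "real \<Rightarrow> real"
  assumes w: "integrable lborel w"
    and g[measurable]: "(\<lambda>(x, y). g x y) \<in> borel_measurable (borel \<Otimes>\<^sub>M borel)"
    and M: "\<And>x y. \<bar>g x y\<bar> \<le> M"
  shows "jump (\<lambda>x. LBINT y. w y * g x y) x = (LBINT y. w y * jump (\<lambda>x. g x y) x)"
  unfolding jump_def
proof (rule Fubini_weighted[OF k_integrable w])
  show "(\<lambda>(z, y). g (x + z) y) \<in> borel_measurable (borel \<Otimes>\<^sub>M borel)"
    by measurable
qed (rule M)

lemma jump_pow_joint_measurable:
  assumes "(\<lambda>(x, y). g x y) \<in> borel_measurable (borel \<Otimes>\<^sub>M borel)"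
  shows "(\<lambda>(x, y). (jump ^^ n) (\<lambda>x. g x y) x) \<in> borel_measurable (borel \<Otimes>\<^sub>M borel)"
proof (induction n)
  case (Suc n)
  note Suc[measurable]
  have "(\<lambda>(x, y). LBINT z. k z * (jump ^^ n) (\<lambda>x. g x y) (x + z)) \<in> borel_measurable (borel \<Otimes>\<^sub>M borel)"
    by measurable
  then show ?case by (simp add: jump_def[of "(jump ^^ n) _"])
qed (use assms in simp)

lemma jump_pow_parametric:
  fixes w :: "real \<Rightarrow> real"
  assumes w: "integrable lborel w"
    and g: "(\<lambda>(x, y). g x y) \<in> borel_measurable (borel \<Otimes>\<^sub>M borel)"
    and M: "\<And>x y. \<bar>g x y\<bar> \<le> M"
  shows "(jump ^^ n) (\<lambda>x. LBINT y. w y * g x y) x = (LBINT y. w y * (jump ^^ n) (\<lambda>x. g x y) x)"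
proof (induction n arbitrary: x)
  case (Suc n)
  have [measurable]: "(\<lambda>x. g x y) \<in> borel_measurable borel" for y
    using measurable_compose[OF _ g, of "\<lambda>x. (x, y)" borel] by simp
  have "jump ((jump ^^ n) (\<lambda>x. LBINT y. w y * g x y)) x
      = jump (\<lambda>x. LBINT y. w y * (jump ^^ n) (\<lambda>x. g x y) x) x"
    using Suc by presburger
  also have "\<dots> = (LBINT y. w y * jump (\<lambda>x. (jump ^^ n) (\<lambda>x. g x y) x) x)"
    by (rule jump_parametric[OF w jump_pow_joint_measurable[OF g] jump_pow_bound])
      (auto intro: M)
  finally show ?case by simp
qed simp

lemma semi_series_summable:
  assumes "f \<in> borel_measurable borel" and "\<And>x. \<bar>f x\<bar> \<le> M"
  shows "summable (\<lambda>n. \<bar>(jump ^^ n) f x / fact n * t ^ n\<bar>)"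
proof (rule summable_comparison_test)
  show "\<exists>N. \<forall>n\<ge>N. norm \<bar>(jump ^^ n) f x / fact n * t ^ n\<bar> \<le> M * ((mass * \<bar>t\<bar>) ^ n /\<^sub>R fact n)"
  proof (intro exI allI impI)
    fix n
    have "\<bar>(jump ^^ n) f x\<bar> * \<bar>t\<bar> ^ n \<le> (mass ^ n * M) * \<bar>t\<bar> ^ n"
      using assms by (intro mult_right_mono jump_pow_bound) auto
    then show "norm \<bar>(jump ^^ n) f x / fact n * t ^ n\<bar> \<le> M * ((mass * \<bar>t\<bar>) ^ n /\<^sub>R fact n)"
      by (auto simp: abs_mult power_abs power_mult_distrib divide_simps mult_ac)
  qed
  show "summable (\<lambda>n. M * ((mass * \<bar>t\<bar>) ^ n /\<^sub>R fact n))"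
    by (intro summable_mult summable_exp_generic)
qed

lemmas semi_summable = summable_rabs_cancel[OF semi_series_summable]

lemma semi_series_bound:
  assumes "f \<in> borel_measurable borel" and "\<And>x. \<bar>f x\<bar> \<le> M" and "0 \<le> t"
  shows "\<bar>\<Sum>n. (jump ^^ n) f x / fact n * t ^ n\<bar> \<le> M * exp (mass * t)"
proof -
  have "\<bar>\<Sum>n. (jump ^^ n) f x / fact n * t ^ n\<bar> \<le> (\<Sum>n. \<bar>(jump ^^ n) f x / fact n * t ^ n\<bar>)"
    using assms by (intro summable_rabs semi_series_summable)
  also have "\<dots> \<le> (\<Sum>n. M * ((mass * t) ^ n /\<^sub>R fact n))"
  proof (rule suminf_le)
    fix n
    have "\<bar>(jump ^^ n) f x\<bar> * t ^ n \<le> (mass ^ n * M) * t ^ n"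
      using assms by (intro mult_right_mono jump_pow_bound) auto
    then show "\<bar>(jump ^^ n) f x / fact n * t ^ n\<bar> \<le> M * ((mass * t) ^ n /\<^sub>R fact n)"
      using assms(3) by (auto simp: abs_mult power_mult_distrib divide_simps mult_ac)
  next
    show "summable (\<lambda>n. M * ((mass * t) ^ n /\<^sub>R fact n))"
      by (intro summable_mult summable_exp_generic)
  qed (rule semi_series_summable[OF assms(1,2)])
  also have "\<dots> = M * exp (mass * t)"
    by (subst suminf_mult[OF summable_exp_generic]) (simp add: exp_def)
  finally show ?thesis .
qed

lemma semi_bound:
  assumes "f \<in> borel_measurable borel" and "\<And>x. \<bar>f x\<bar> \<le> M" and "0 \<le> t"
  shows "\<bar>semi t f x\<bar> \<le> M"
proof -
  have "\<bar>semi t f x\<bar> \<le> exp (- (mass * t)) * (M * exp (mass * t))"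
    unfolding semi_def abs_mult abs_exp_cancel
    by (intro mult_left_mono semi_series_bound) (use assms in auto)
  also have "exp (- (mass * t)) * (M * exp (mass * t)) = M" by (simp add: exp_minus)
  finally show ?thesis .
qed

lemma semi_measurable [measurable]:
  assumes [measurable]: "f \<in> borel_measurable borel"
  shows "semi t f \<in> borel_measurable borel"
  unfolding semi_def by measurable

lemma semi_linear:
  assumes "f \<in> borel_measurable borel" "\<And>x. \<bar>f x\<bar> \<le> M" "g \<in> borel_measurable borel" "\<And>x. \<bar>g x\<bar> \<le> N"
  shows "semi t (\<lambda>x. a * f x + b * g x) x = a * semi t f x + b * semi t g x"
proof -
  have "(\<Sum>n. (jump ^^ n) (\<lambda>x. a * f x + b * g x) x / fact n * t ^ n)
      = (\<Sum>n. a * ((jump ^^ n) f x / fact n * t ^ n) + b * ((jump ^^ n) g x / fact n * t ^ n))"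
    by (intro suminf_cong) (simp add: jump_pow_linear[OF assms] field_simps)
  also have "\<dots> = a * (\<Sum>n. (jump ^^ n) f x / fact n * t ^ n) + b * (\<Sum>n. (jump ^^ n) g x / fact n * t ^ n)"
    by (simp only: suminf_add[symmetric] suminf_mult summable_mult
        semi_summable[OF assms(1,2)] semi_summable[OF assms(3,4)])
  finally show ?thesis unfolding semi_def by (simp add: algebra_simps)
qed

lemma semi_translate: "semi t (\<lambda>x. f (x + a)) x = semi t f (x + a)"
  unfolding semi_def jump_pow_translate ..

lemma semi_nonneg:
  assumes "f \<in> borel_measurable borel" and "\<And>x. \<bar>f x\<bar> \<le> M" and "\<And>x. 0 \<le> f x" and "0 \<le> t"
  shows "0 \<le> semi t f x"
proof -
  have "0 \<le> (jump ^^ n) f x" for n x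
    by (induction n arbitrary: x)
      (use assms in \<open>auto simp: jump_def intro!: Bochner_Integration.integral_nonneg mult_nonneg_nonneg k_nonneg\<close>)
  then show ?thesis unfolding semi_def
    using assms by (intro mult_nonneg_nonneg suminf_nonneg semi_summable) auto
qed

lemma semi_const: "semi t (\<lambda>x. c) x = c"
proof -
  have "(\<Sum>n. mass ^ n * c / fact n * t ^ n) = (\<Sum>n. c * ((mass * t) ^ n /\<^sub>R fact n))"
    by (intro suminf_cong) (simp add: power_mult_distrib field_simps)
  also have "\<dots> = c * exp (mass * t)"
    by (subst suminf_mult[OF summable_exp_generic]) (simp add: exp_def)
  finally show ?thesis by (simp add: semi_def jump_pow_const exp_minus)
qed

lemma semi_0: "semi 0 f x = f x"
  using suminf_finite[of "{0}" "\<lambda>n. (jump ^^ n) f x / fact n * 0 ^ n"] by (simp add: semi_def)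

text \<open>The sum over jump powers passes under the integral because term \<open>n\<close> is
  dominated by \<open>\<bar>w y\<bar> * M * (mass * \<bar>t\<bar>) ^ n / fact n\<close>. Averages of
  translates will make two semigroups commute; averages of cosines will give the action on
  Gaussians.\<close>

lemma semi_parametric:
  fixes w :: "real \<Rightarrow> real"
  assumes w: "integrable lborel w"
    and g[measurable]: "(\<lambda>(x, y). g x y) \<in> borel_measurable (borel \<Otimes>\<^sub>M borel)"
    and M: "\<And>x y. \<bar>g x y\<bar> \<le> M"
  shows "semi t (\<lambda>x. LBINT y. w y * g x y) x = (LBINT y. w y * semi t (\<lambda>x. g x y) x)"
proof -
  have [measurable]: "w \<in> borel_measurable borel" using w by auto
  have gm[measurable]: "(\<lambda>x. g x y) \<in> borel_measurable borel" for y
    using measurable_compose[OF _ g, of "\<lambda>x. (x, y)" borel] by simp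
  have jm: "(\<lambda>y. (jump ^^ n) (\<lambda>x. g x y) x) \<in> borel_measurable borel" for n
    using measurable_compose[OF _ jump_pow_joint_measurable[OF g], of "\<lambda>y. (x, y)" borel n] by simp
  have jb: "\<bar>(jump ^^ n) (\<lambda>x. g x y) x\<bar> \<le> mass ^ n * M" for n y
    by (intro jump_pow_bound gm M)
  have int: "integrable lborel (\<lambda>y. w y * ((jump ^^ n) (\<lambda>x. g x y) x / fact n * t ^ n))" for n
    using integrable_mult_bounded[OF w jm jb, of n]
    by (auto simp: mult.assoc[symmetric] mult.commute[of _ "w _"])
  have "(\<Sum>n. (jump ^^ n) (\<lambda>x. LBINT y. w y * g x y) x / fact n * t ^ n)
      = (\<Sum>n. LBINT y. w y * ((jump ^^ n) (\<lambda>x. g x y) x / fact n * t ^ n))"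
    by (intro suminf_cong) (simp add: jump_pow_parametric[OF w g M] mult.assoc[symmetric])
  also have "\<dots> = (LBINT y. \<Sum>n. w y * ((jump ^^ n) (\<lambda>x. g x y) x / fact n * t ^ n))"
  proof (rule integral_suminf[symmetric, OF int])
    show "AE y in lborel. summable (\<lambda>n. norm (w y * ((jump ^^ n) (\<lambda>x. g x y) x / fact n * t ^ n)))"
      by (intro AE_I2, subst norm_mult, intro summable_mult, unfold real_norm_def,
          intro semi_series_summable[of _ M] gm M)
    show "summable (\<lambda>n. LBINT y. norm (w y * ((jump ^^ n) (\<lambda>x. g x y) x / fact n * t ^ n)))"
    proof (rule summable_comparison_test)
      show "summable (\<lambda>n. ((LBINT y. \<bar>w y\<bar>) * M) * ((mass * \<bar>t\<bar>) ^ n /\<^sub>R fact n))"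
        by (intro summable_mult summable_exp_generic)
      have "norm (LBINT y. norm (w y * ((jump ^^ n) (\<lambda>x. g x y) x / fact n * t ^ n)))
           \<le> ((LBINT y. \<bar>w y\<bar>) * M) * ((mass * \<bar>t\<bar>) ^ n /\<^sub>R fact n)" for n
      proof -
        have "(LBINT y. norm (w y * ((jump ^^ n) (\<lambda>x. g x y) x / fact n * t ^ n)))
            \<le> (LBINT y. \<bar>w y\<bar> * (M * ((mass * \<bar>t\<bar>) ^ n /\<^sub>R fact n)))"
        proof (rule integral_mono)
          fix y
          have "\<bar>(jump ^^ n) (\<lambda>x. g x y) x\<bar> * \<bar>t\<bar> ^ n \<le> (mass ^ n * M) * \<bar>t\<bar> ^ n"
            by (intro mult_right_mono jb) auto
          then have "\<bar>(jump ^^ n) (\<lambda>x. g x y) x / fact n * t ^ n\<bar> \<le> M * ((mass * \<bar>t\<bar>) ^ n /\<^sub>R fact n)"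
            by (auto simp: abs_mult power_abs power_mult_distrib divide_simps mult_ac)
          then show "norm (w y * ((jump ^^ n) (\<lambda>x. g x y) x / fact n * t ^ n))
              \<le> \<bar>w y\<bar> * (M * ((mass * \<bar>t\<bar>) ^ n /\<^sub>R fact n))"
            unfolding real_norm_def abs_mult[of "w y"] by (rule mult_left_mono) simp
        qed (use integrable_norm[OF int[of n]] w in auto)
        also have "\<dots> = ((LBINT y. \<bar>w y\<bar>) * M) * ((mass * \<bar>t\<bar>) ^ n /\<^sub>R fact n)"
          by simp
        finally show ?thesis by simp
      qed
      then show "\<exists>N. \<forall>n\<ge>N. norm (LBINT y. norm (w y * ((jump ^^ n) (\<lambda>x. g x y) x / fact n * t ^ n)))
           \<le> ((LBINT y. \<bar>w y\<bar>) * M) * ((mass * \<bar>t\<bar>) ^ n /\<^sub>R fact n)" by blast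
    qed
  qed
  also have "\<dots> = (LBINT y. w y * (\<Sum>n. (jump ^^ n) (\<lambda>x. g x y) x / fact n * t ^ n))"
    by (intro Bochner_Integration.integral_cong refl suminf_mult semi_summable[of _ M] gm M)
  finally show ?thesis
    by (simp add: semi_def mult.left_commute[of "w _"])
qed

text \<open>Termwise differentiation: the coefficient shift \<open>diffs\<close> replaces
  \<open>f\<close> by \<open>jump f\<close> in the series, and the exponential prefactor contributes
  \<open>- mass\<close>.\<close>

lemma semi_deriv:
  assumes f: "f \<in> borel_measurable borel" and M: "\<And>x. \<bar>f x\<bar> \<le> M"
  shows "((\<lambda>t. semi t f x) has_real_derivative semi t (gen f) x) (at t)"
proof -
  define c where "c n = (jump ^^ n) f x / fact n" for n
  have "((\<lambda>t. \<Sum>n. c n * t ^ n) has_field_derivative (\<Sum>n. diffs c n * t ^ n)) (at t)"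
    by (rule termdiffs_strong_converges_everywhere) (unfold c_def, rule semi_summable[OF f M])
  moreover have "diffs c n = (jump ^^ n) (jump f) x / fact n" for n
    by (simp add: diffs_def c_def funpow_swap1)
  ultimately have "((\<lambda>t. \<Sum>n. c n * t ^ n) has_field_derivative
      (\<Sum>n. (jump ^^ n) (jump f) x / fact n * t ^ n)) (at t)" by simp
  then have "((\<lambda>t. semi t f x) has_real_derivative
      - mass * semi t f x + semi t (jump f) x) (at t)"
    unfolding semi_def c_def by (auto intro!: derivative_eq_intros)
  moreover have "semi t (gen f) x = 1 * semi t (jump f) x + (- mass) * semi t f x"
    unfolding gen_def[abs_def] using f M jump_bound[OF f M]
    by (subst semi_linear[symmetric]) auto
  ultimately show ?thesis by (simp add: minus_mult_commute)
qed

section \<open>Commutation, monotonicity and comparison of jump semigroups\<close>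

lemma gen_measurable [measurable]:
  assumes [measurable]: "f \<in> borel_measurable borel"
  shows "gen f \<in> borel_measurable borel"
  unfolding gen_def[abs_def] by measurable

lemma gen_bound:
  assumes "f \<in> borel_measurable borel" and "\<And>x. \<bar>f x\<bar> \<le> M"
  shows "\<bar>gen f x\<bar> \<le> 2 * mass * M"
proof -
  have "mass * \<bar>f x\<bar> \<le> mass * M" using assms mass_nonneg by (intro mult_left_mono) auto
  then have "\<bar>mass * f x\<bar> \<le> mass * M" using mass_nonneg by (simp add: abs_mult)
  moreover have "\<bar>jump f x\<bar> \<le> mass * M" by (rule jump_bound[OF assms])
  moreover have "2 * mass * M = mass * M + mass * M" by simp
  ultimately show ?thesis unfolding gen_def by linarith
qed

text \<open>A jump operator is an average of translates, and the semigroup commutes with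
  translations and with averages.\<close>

lemma semi_jump_commute:
  assumes "jump_kernel j" and f[measurable]: "f \<in> borel_measurable borel" and M: "\<And>x. \<bar>f x\<bar> \<le> M"
  shows "semi t (jump_kernel.jump j f) x = jump_kernel.jump j (semi t f) x"
proof -
  interpret j: jump_kernel j by fact
  have "semi t (\<lambda>x. LBINT y. j y * f (x + y)) x = (LBINT y. j y * semi t (\<lambda>x. f (x + y)) x)"
    by (rule semi_parametric[OF j.k_integrable]) (use M in auto)
  then show ?thesis by (simp add: j.jump_def[abs_def] semi_translate)
qed

lemma semi_gen_commute:
  assumes "jump_kernel j" and f[measurable]: "f \<in> borel_measurable borel" and M: "\<And>x. \<bar>f x\<bar> \<le> M"
  shows "semi t (jump_kernel.gen j f) x = jump_kernel.gen j (semi t f) x"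
proof -
  interpret j: jump_kernel j by fact
  have "semi t (j.gen f) x = semi t (\<lambda>x. 1 * j.jump f x + (- j.mass) * f x) x"
    by (simp add: j.gen_def[abs_def])
  also have "\<dots> = 1 * semi t (j.jump f) x + (- j.mass) * semi t f x"
    by (rule semi_linear[OF _ j.jump_bound[OF f M] f M]) auto
  finally show ?thesis
    by (simp add: semi_jump_commute[OF assms] j.gen_def)
qed

text \<open>Folding the integral at the midpoint of \<open>a\<close> and \<open>b\<close> makes the integrand of \<open>jump f a - jump f b\<close>
  a product of two differences of equal sign.\<close>

lemma jump_radially_nonincreasing:
  assumes k: "radially_nonincreasing k" and f: "radially_nonincreasing f"
    and [measurable]: "f \<in> borel_measurable borel" and M: "\<And>x. \<bar>f x\<bar> \<le> M"
  shows "radially_nonincreasing (jump f)"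
  unfolding radially_nonincreasing_def
proof (intro allI impI)
  fix a b :: real assume ab: "norm a \<le> norm b"
  define D where "D y = f y * (k (y - a) - k (y - b))" for y
  have shift: "jump f x = (LBINT y. f y * k (y - x))" for x
    using lborel_integral_real_affine[of 1 "\<lambda>y. f y * k (y - x)" x] by (simp add: jump_def mult.commute)
  have kint: "integrable lborel (\<lambda>y. k (y - x))" for x
    using lborel_integrable_real_affine[OF k_integrable, of 1 "- x"] by simp
  have intf: "integrable lborel (\<lambda>y. f y * k (y - x))" for x
    by (intro integrable_mult_bounded[OF kint]) (use M in auto)
  have D: "integrable lborel D"
    unfolding D_def right_diff_distrib by (intro Bochner_Integration.integrable_diff intf)
  have diff: "jump f a - jump f b = (LBINT y. D y)"
    unfolding shift D_def right_diff_distrib by (intro Bochner_Integration.integral_diff[symmetric] intf)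
  have D': "integrable lborel (\<lambda>y. D (a + b - y))"
    using lborel_integrable_real_affine[OF D, of "-1" "a + b"] by simp
  have refl: "(LBINT y. D (a + b - y)) = (LBINT y. D y)"
    using lborel_integral_real_affine[of "-1" D "a + b"] by simp
  have ks: "k (a + b - y - a) = k (y - b)" "k (a + b - y - b) = k (y - a)" for y
    using k_even[of "y - b"] k_even[of "y - a"] by (simp_all add: algebra_simps)
  have kle: "\<bar>x\<bar> \<le> \<bar>y\<bar> \<Longrightarrow> k y \<le> k x" and fle: "\<bar>x\<bar> \<le> \<bar>y\<bar> \<Longrightarrow> f y \<le> f x" for x y
    using k f by (auto simp: radially_nonincreasing_def)
  have nn: "0 \<le> D y + D (a + b - y)" for y
  proof -
    have "D y + D (a + b - y) = (f y - f (a + b - y)) * (k (y - a) - k (y - b))"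
      by (simp only: D_def ks) (simp only: algebra_simps)
    moreover have "0 \<le> (f y - f (a + b - y)) * (k (y - a) - k (y - b))"
    proof -
      \<comment> \<open>Both conditions locate \<open>y\<close> relative to the midpoint: the
        difference of squares is (a + b)(a + b - 2y) for the first and (b - a)(a + b - 2y) for the
        second, and (b - a)(a + b) is nonnegative because
        \<open>\<bar>a\<bar> \<le> \<bar>b\<bar>\<close>.\<close>
      consider "\<bar>y\<bar> \<le> \<bar>a + b - y\<bar>" "\<bar>y - a\<bar> \<le> \<bar>y - b\<bar>" | "\<bar>a + b - y\<bar> \<le> \<bar>y\<bar>" "\<bar>y - b\<bar> \<le> \<bar>y - a\<bar>"
        using ab unfolding real_norm_def by argo
      then show ?thesis
      proof cases
        case 1
        then show ?thesis using fle[OF 1(1)] kle[OF 1(2)] by (intro mult_nonneg_nonneg) auto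
      next
        case 2
        then show ?thesis using fle[OF 2(1)] kle[OF 2(2)] by (intro mult_nonpos_nonpos) auto
      qed
    qed
    ultimately show ?thesis by simp
  qed
  have "0 \<le> (LBINT y. D y + D (a + b - y))"
    by (rule Bochner_Integration.integral_nonneg) (rule nn)
  also have "\<dots> = 2 * (LBINT y. D y)"
    using D D' refl by simp
  finally show "jump f b \<le> jump f a" using diff by linarith
qed

text \<open>The property passes to every power of \<open>jump\<close>, and for \<open>0 <= t\<close>
  the series combines these powers with nonnegative coefficients.\<close>

lemma semi_radially_nonincreasing:
  assumes k: "radially_nonincreasing k" and f: "radially_nonincreasing f"
    and fm: "f \<in> borel_measurable borel" and M: "\<And>x. \<bar>f x\<bar> \<le> M" and t: "0 \<le> t"
  shows "radially_nonincreasing (semi t f)"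
proof -
  have "radially_nonincreasing ((jump ^^ n) f)" for n
    by (induction n) (use jump_radially_nonincreasing[OF k _ jump_pow_measurable[OF fm] jump_pow_bound[OF fm M]] f in auto)
  then show ?thesis
    unfolding radially_nonincreasing_def semi_def
    using t by (intro allI impI mult_left_mono suminf_le semi_summable[OF fm M] mult_right_mono divide_right_mono) auto
qed

text \<open>A maximum principle: the supremum \<open>c\<close> of the difference, corrected by \<open>e \<tau>\<close>, over \<open>[0,t]\<close> satisfies
  \<open>c \<le> c (1 - exp (- mass t))\<close>.\<close>

lemma semi_le_of_gen_le:
  assumes "jump_kernel j" and f[measurable]: "f \<in> borel_measurable borel" and M: "\<And>x. \<bar>f x\<bar> \<le> M"
    and le: "\<And>x. gen f x - jump_kernel.gen j f x \<le> e" and t: "0 \<le> t" and e: "0 \<le> e"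
  shows "semi t f x - jump_kernel.semi j t f x \<le> e * t"
proof (cases "t = 0")
  case False
  interpret j: jump_kernel j by fact
  define w where "w \<tau> z = semi \<tau> f z - j.semi \<tau> f z - e * \<tau>" for \<tau> z
  \<comment> \<open>The time derivative of \<open>w\<close>, arranged as \<open>gen\<close> of
    \<open>w\<close> plus a source. Commuting generators past semigroups gives the source this form;
    it is nonpositive because \<open>j.semi\<close> is positive and fixes constants. The correction
    \<open>e * \<tau>\<close> does not disturb the first part, since \<open>gen\<close> annihilates
    constants.\<close>
  define h where "h \<tau> z = jump (w \<tau>) z - mass * w \<tau> z
     + (j.semi \<tau> (\<lambda>z. gen f z - j.gen f z) z - e)" for \<tau> z
  have wm[measurable]: "w \<tau> \<in> borel_measurable borel" for \<tau>
    unfolding w_def by measurable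
  have wb: "\<bar>w \<tau> z\<bar> \<le> 2 * M + e * t" if "\<tau> \<in> {0..t}" for \<tau> z
  proof -
    have "e * \<tau> \<le> e * t" "0 \<le> e * \<tau>" using that e by (auto intro: mult_left_mono)
    then show ?thesis
      unfolding w_def using semi_bound[OF f M, of \<tau> z] j.semi_bound[OF f M, of \<tau> z] that by auto
  qed
  have jb: "\<bar>j.semi \<tau> f z\<bar> \<le> M" and sb: "\<bar>semi \<tau> f z\<bar> \<le> M" if "0 \<le> \<tau>" for \<tau> z
    using semi_bound[OF f M] j.semi_bound[OF f M] that by auto
  have wd: "((\<lambda>\<tau>. w \<tau> z) has_real_derivative h \<tau> z) (at \<tau>)" if "\<tau> \<in> {0..t}" for \<tau> z
  proof -
    have 1: "semi \<tau> (gen f) z = gen (semi \<tau> f) z"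
      by (rule semi_gen_commute[OF jump_kernel_axioms f M])
    have "j.semi \<tau> (\<lambda>z. 1 * gen f z + (-1) * j.gen f z) z = 1 * j.semi \<tau> (gen f) z + (-1) * j.semi \<tau> (j.gen f) z"
      by (rule j.semi_linear[OF _ gen_bound[OF f M] _ j.gen_bound[OF f M]]) auto
    then have "j.semi \<tau> (\<lambda>z. gen f z - j.gen f z) z = j.semi \<tau> (gen f) z - j.semi \<tau> (j.gen f) z"
      by simp
    also have "\<dots> = gen (j.semi \<tau> f) z - j.semi \<tau> (j.gen f) z"
      by (simp only: j.semi_gen_commute[OF jump_kernel_axioms f M])
    finally have 2: "j.semi \<tau> (\<lambda>z. gen f z - j.gen f z) z = gen (j.semi \<tau> f) z - j.semi \<tau> (j.gen f) z" .
    have "jump (w \<tau>) z = jump (\<lambda>z. 1 * (1 * semi \<tau> f z + (-1) * j.semi \<tau> f z) + (- e * \<tau>) * 1) z"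
      by (simp add: w_def[abs_def])
    also have "\<dots> = 1 * jump (\<lambda>z. 1 * semi \<tau> f z + (-1) * j.semi \<tau> f z) z + (- e * \<tau>) * jump (\<lambda>z. 1) z"
    proof (rule jump_linear[where M = "2 * M" and N = 1])
      show "\<bar>1 * semi \<tau> f y + - 1 * j.semi \<tau> f y\<bar> \<le> 2 * M" for y
        using jb[of \<tau> y] sb[of \<tau> y] that by auto
    qed auto
    also have "jump (\<lambda>z. 1 * semi \<tau> f z + (-1) * j.semi \<tau> f z) z = 1 * jump (semi \<tau> f) z + (-1) * jump (j.semi \<tau> f) z"
      by (rule jump_linear[where M = M and N = M]) (use jb sb that in auto)
    also have "jump (\<lambda>z. 1) z = mass" by (simp add: jump_def mass_def)
    finally have 3: "jump (w \<tau>) z = jump (semi \<tau> f) z - jump (j.semi \<tau> f) z - e * \<tau> * mass" by simp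
    have eq: "h \<tau> z = semi \<tau> (gen f) z - j.semi \<tau> (j.gen f) z - e"
      unfolding h_def 1 2 3 unfolding w_def gen_def by (simp add: algebra_simps)
    show ?thesis unfolding eq unfolding w_def
      by (auto intro!: derivative_eq_intros semi_deriv[OF f M] j.semi_deriv[OF f M])
  qed
  define c where "c = (SUP p\<in>{0..t} \<times> UNIV. w (fst p) (snd p))"
  have bdd: "bdd_above ((\<lambda>p. w (fst p) (snd p)) ` ({0..t} \<times> UNIV))"
    using wb by (intro bdd_aboveI[of _ "2 * M + e * t"]) (force simp: abs_le_iff)
  have cw: "w \<tau> z \<le> c" if "\<tau> \<in> {0..t}" for \<tau> z
    unfolding c_def using that cSUP_upper[OF _ bdd, of "(\<tau>, z)"] by simp
  have w0: "w 0 z = 0" for z by (simp add: w_def semi_0 j.semi_0)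
  have c0: "0 \<le> c" using cw[of 0 0] t w0 by simp
  have step: "w \<tau> z \<le> c * (1 - exp (- (mass * t)))" if \<tau>: "\<tau> \<in> {0..t}" for \<tau> z
  proof -
    \<comment> \<open>The exponential factor absorbs \<open>- mass * w\<close>; what remains is
      controlled by \<open>jump (w \<sigma>) z \<le> mass * c\<close>, so the weighted difference to
      the supremum \<open>c\<close> is nonincreasing in time.\<close>
    have "exp (mass * \<tau>) * (w \<tau> z - c) \<le> exp (mass * 0) * (w 0 z - c)"
    proof (rule DERIV_nonpos_imp_nonincreasing[where f = "\<lambda>\<tau>. exp (mass * \<tau>) * (w \<tau> z - c)"])
      show "0 \<le> \<tau>" using \<tau> by simp
      fix \<sigma> assume \<sigma>: "0 \<le> \<sigma>" "\<sigma> \<le> \<tau>"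
      then have \<sigma>': "\<sigma> \<in> {0..t}" using \<tau> by auto
      have "jump (w \<sigma>) z \<le> jump (\<lambda>_. c) z"
        by (rule jump_mono[where M = "2 * M + e * t" and N = "\<bar>c\<bar>"]) (use wb cw \<sigma>' in auto)
      also have "jump (\<lambda>_. c) z = mass * c" by (simp add: jump_def mass_def)
      finally have 1: "jump (w \<sigma>) z \<le> mass * c" .
      have "0 \<le> j.semi \<sigma> (\<lambda>z. 1 * e + (-1) * (gen f z - j.gen f z)) z"
      proof (rule j.semi_nonneg)
        show "\<bar>1 * e + - 1 * (gen f x - j.gen f x)\<bar> \<le> e + 2 * mass * M + 2 * j.mass * M" for x
          using e gen_bound[OF f M, of x] j.gen_bound[OF f M, of x] by auto
        show "0 \<le> 1 * e + - 1 * (gen f x - j.gen f x)" for x using le[of x] by simp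
      qed (use \<sigma> in auto)
      also have "\<dots> = 1 * j.semi \<sigma> (\<lambda>z. e) z + (-1) * j.semi \<sigma> (\<lambda>z. gen f z - j.gen f z) z"
      proof (rule j.semi_linear[where M = e and N = "2 * mass * M + 2 * j.mass * M"])
        show "\<bar>gen f x - j.gen f x\<bar> \<le> 2 * mass * M + 2 * j.mass * M" for x
          using gen_bound[OF f M, of x] j.gen_bound[OF f M, of x] by auto
      qed (use e in auto)
      finally have 2: "j.semi \<sigma> (\<lambda>z. gen f z - j.gen f z) z \<le> e" by (simp add: j.semi_const)
      have "((\<lambda>\<tau>. exp (mass * \<tau>) * (w \<tau> z - c)) has_real_derivative
          exp (mass * \<sigma>) * (mass * (w \<sigma> z - c) + h \<sigma> z)) (at \<sigma>)"
        by (auto intro!: derivative_eq_intros wd[OF \<sigma>'] simp: algebra_simps)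
      moreover have "mass * (w \<sigma> z - c) + h \<sigma> z \<le> 0"
        using 1 2 unfolding h_def by (simp add: algebra_simps)
      ultimately show "\<exists>y. ((\<lambda>\<tau>. exp (mass * \<tau>) * (w \<tau> z - c)) has_real_derivative y) (at \<sigma>) \<and> y \<le> 0"
        by (meson exp_ge_zero mult_nonneg_nonpos)
    qed
    then have "exp (mass * \<tau>) * (w \<tau> z - c) \<le> - c" by (simp add: w0)
    then have "w \<tau> z - c \<le> - c * exp (- (mass * \<tau>))"
      by (simp add: exp_minus field_simps)
    also have "\<dots> \<le> - c * exp (- (mass * t))"
      using c0 \<tau> mass_nonneg by (auto intro!: mult_left_mono)
    finally show ?thesis by (simp add: algebra_simps)
  qed
  have "c \<le> c * (1 - exp (- (mass * t)))"
    unfolding c_def[symmetric] by (subst (1) c_def, rule cSUP_least) (use step t in auto)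
  then have "c * exp (- (mass * t)) \<le> 0" by (simp add: algebra_simps)
  then have "c \<le> 0" by (simp add: mult_le_0_iff)
  with cw[of t x] t show ?thesis by (simp add: w_def)
qed (simp add: semi_0 jump_kernel.semi_0[OF assms(1)])

text \<open>The comparison is applied in both directions, with the kernels exchanged. The bound
  involves no mass, which is essential because the masses of the truncations tend to
  infinity.\<close>

lemma semi_diff_le:
  assumes j: "jump_kernel j" and f: "f \<in> borel_measurable borel" and M: "\<And>x. \<bar>f x\<bar> \<le> M"
    and le: "\<And>x. \<bar>gen f x - jump_kernel.gen j f x\<bar> \<le> e" and t: "0 \<le> t"
  shows "\<bar>semi t f x - jump_kernel.semi j t f x\<bar> \<le> e * t"
proof -
  have e: "0 \<le> e" using le[of 0] by linarith
  have "semi t f x - jump_kernel.semi j t f x \<le> e * t"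
    by (rule semi_le_of_gen_le[OF j f M _ t e]) (use le in \<open>auto simp: abs_le_iff\<close>)
  moreover have "jump_kernel.semi j t f x - semi t f x \<le> e * t"
    by (rule jump_kernel.semi_le_of_gen_le[OF j jump_kernel_axioms f M _ t e]) (use le in \<open>auto simp: abs_le_iff\<close>)
  ultimately show ?thesis by linarith
qed

end

section \<open>Functions with bounded derivatives\<close>

lemma Cb_upto_SucI:
  assumes "continuous_on U f" "bounded (f ` U)"
    and "\<And>x. x \<in> U \<Longrightarrow> (f has_derivative f' x) (at x within U)"
    and "\<And>b. b \<in> Basis \<Longrightarrow> Cb_upto k U (\<lambda>x. f' x b)"
  shows "Cb_upto (Suc k) U f"
  unfolding Cb_upto.simps(2) using assms by blast

lemma Cb_upto_SucE:
  assumes "Cb_upto (Suc k) U f"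
  obtains f' where "\<And>x. x \<in> U \<Longrightarrow> (f has_derivative f' x) (at x within U)"
    and "\<And>b. b \<in> Basis \<Longrightarrow> Cb_upto k U (\<lambda>x. f' x b)"
    and "continuous_on U f" "bounded (f ` U)"
  using assms unfolding Cb_upto.simps(2) by blast

lemma Cb_upto_SucD: "Cb_upto (Suc k) U f \<Longrightarrow> Cb_upto k U f"
proof (induction k arbitrary: f)
  case (Suc k)
  from Suc.prems show ?case
    by (rule Cb_upto_SucE) (rule Cb_upto_SucI, auto intro: Suc.IH)
qed simp

lemma Cb_upto_continuous_on: "Cb_upto k U f \<Longrightarrow> continuous_on U f"
  by (cases k) auto

lemma Cb_upto_bounded: "Cb_upto k U f \<Longrightarrow> bounded (f ` U)"
  by (cases k) auto

lemma bounded_const_image: "bounded ((\<lambda>x. c) ` U)"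
  by (rule bounded_subset[of "{c}"]) auto

lemma Cb_upto_const [simp]: "Cb_upto k U (\<lambda>x. c)"
proof (induction k arbitrary: c)
  case (Suc k)
  then show ?case
    by (intro Cb_upto_SucI[where f' = "\<lambda>x h. 0"]) (auto intro: bounded_const_image)
qed (auto intro: bounded_const_image)

lemma Cb_upto_add: "Cb_upto k U f \<Longrightarrow> Cb_upto k U g \<Longrightarrow> Cb_upto k U (\<lambda>x. f x + g x)"
proof (induction k arbitrary: f g)
  case (Suc k)
  from Suc.prems(1) obtain f' where f': "\<And>x. x \<in> U \<Longrightarrow> (f has_derivative f' x) (at x within U)"
    "\<And>b. b \<in> Basis \<Longrightarrow> Cb_upto k U (\<lambda>x. f' x b)" "continuous_on U f" "bounded (f ` U)"
    by (rule Cb_upto_SucE) (rule that; assumption)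
  from Suc.prems(2) obtain g' where g': "\<And>x. x \<in> U \<Longrightarrow> (g has_derivative g' x) (at x within U)"
    "\<And>b. b \<in> Basis \<Longrightarrow> Cb_upto k U (\<lambda>x. g' x b)" "continuous_on U g" "bounded (g ` U)"
    by (rule Cb_upto_SucE) (rule that; assumption)
  show ?case
    by (rule Cb_upto_SucI[where f' = "\<lambda>x h. f' x h + g' x h"])
      (intro continuous_on_add bounded_plus_comp has_derivative_add Suc.IH f' g'; assumption)+
qed (auto intro: continuous_on_add bounded_plus_comp)

lemma bounded_mult_image:
  fixes f g :: "'a \<Rightarrow> real"
  assumes "bounded (f ` U)" "bounded (g ` U)"
  shows "bounded ((\<lambda>x. f x * g x) ` U)"
proof -
  obtain A B where "\<forall>x\<in>U. \<bar>f x\<bar> \<le> A" "\<forall>x\<in>U. \<bar>g x\<bar> \<le> B"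
    using assms by (auto simp: bounded_iff)
  then show ?thesis unfolding bounded_iff
    by (intro exI[of _ "A * B"]) (force simp: abs_mult intro!: mult_mono')
qed

lemma Cb_upto_mult: "Cb_upto k U f \<Longrightarrow> Cb_upto k U g \<Longrightarrow> Cb_upto k U (\<lambda>x. f x * g x)"
proof (induction k arbitrary: f g)
  case (Suc k)
  from Suc.prems(1) obtain f' where f': "\<And>x. x \<in> U \<Longrightarrow> (f has_derivative f' x) (at x within U)"
    "\<And>b. b \<in> Basis \<Longrightarrow> Cb_upto k U (\<lambda>x. f' x b)" "continuous_on U f" "bounded (f ` U)"
    by (rule Cb_upto_SucE) (rule that; assumption)
  from Suc.prems(2) obtain g' where g': "\<And>x. x \<in> U \<Longrightarrow> (g has_derivative g' x) (at x within U)"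
    "\<And>b. b \<in> Basis \<Longrightarrow> Cb_upto k U (\<lambda>x. g' x b)" "continuous_on U g" "bounded (g ` U)"
    by (rule Cb_upto_SucE) (rule that; assumption)
  note fg = Suc.prems[THEN Cb_upto_SucD]
  show ?case
    by (rule Cb_upto_SucI[where f' = "\<lambda>x h. f x * g' x h + f' x h * g x"])
      (intro continuous_on_mult bounded_mult_image has_derivative_mult Cb_upto_add Suc.IH f' g' fg; assumption)+
qed (auto intro: continuous_on_mult bounded_mult_image)

lemma Cb_upto_cong:
  "Cb_upto k U f \<Longrightarrow> (\<And>x. x \<in> U \<Longrightarrow> g x = f x) \<Longrightarrow> Cb_upto k U g"
proof (induction k arbitrary: f g)
  case 0
  then show ?case by (simp cong: continuous_on_cong image_cong)
next
  case (Suc k)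
  from Suc.prems(1) obtain f' where f': "\<And>x. x \<in> U \<Longrightarrow> (f has_derivative f' x) (at x within U)"
    "\<And>b. b \<in> Basis \<Longrightarrow> Cb_upto k U (\<lambda>x. f' x b)" "continuous_on U f" "bounded (f ` U)"
    by (rule Cb_upto_SucE) (rule that; assumption)
  show ?case
  proof (rule Cb_upto_SucI[where f' = f'])
    show "continuous_on U g" "bounded (g ` U)"
      using f'(3,4) Suc.prems(2) by (simp_all cong: continuous_on_cong image_cong)
    show "(g has_derivative f' x) (at x within U)" if "x \<in> U" for x
      using has_derivative_transform[OF that Suc.prems(2) f'(1)[OF that]] .
  qed (rule f'(2))
qed

lemma Cb_upto_uminus: "Cb_upto k U f \<Longrightarrow> Cb_upto k U (\<lambda>x. - f x)"
  using Cb_upto_mult[OF Cb_upto_const[of k U "-1"], of f] by simp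

lemma Cb_upto_sum: "(\<And>i. i \<in> I \<Longrightarrow> Cb_upto k U (f i)) \<Longrightarrow> Cb_upto k U (\<lambda>x. \<Sum>i\<in>I. f i x)"
  by (induction I rule: infinite_finite_induct) (auto intro: Cb_upto_add)

text \<open>\<open>Cb_upto\<close> controls derivatives along \<open>Basis\<close> only, so the
  derivative in direction \<open>v\<close> is expanded in the basis before the induction hypothesis
  applies.\<close>

lemma Cb_upto_along_line:
  fixes v :: "'a::euclidean_space"
  assumes "Cb_upto k UNIV f"
  shows "Cb_upto k UNIV (\<lambda>r::real. f (r *\<^sub>R v))"
proof -
  have *: "continuous_on UNIV (\<lambda>r. f (r *\<^sub>R v)) \<and> bounded (range (\<lambda>r. f (r *\<^sub>R v)))"
    if "continuous_on UNIV f" "bounded (range f)" for f :: "'a \<Rightarrow> real"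
  proof
    show "continuous_on UNIV (\<lambda>r. f (r *\<^sub>R v))"
      by (rule continuous_on_compose2[OF that(1)]) (auto intro!: continuous_intros)
    show "bounded (range (\<lambda>r. f (r *\<^sub>R v)))"
      by (rule bounded_subset[OF that(2)]) auto
  qed
  show ?thesis using assms
  proof (induction k arbitrary: f)
    case 0
    then show ?case using *[of f] by simp
  next
    case (Suc k)
    from Suc.prems obtain f' where "\<And>x. x \<in> UNIV \<Longrightarrow> (f has_derivative f' x) (at x within UNIV)"
      and f'2: "\<And>b. b \<in> Basis \<Longrightarrow> Cb_upto k UNIV (\<lambda>x. f' x b)"
      and c: "continuous_on UNIV f" "bounded (range f)"
      by (rule Cb_upto_SucE) (rule that; assumption)
    then have f'1: "(f has_derivative f' x) (at x)" for x by auto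
    have "f' x v = (\<Sum>b\<in>Basis. (v \<bullet> b) * f' x b)" for x
    proof -
      interpret bounded_linear "f' x" using f'1 by (rule has_derivative_bounded_linear)
      have "f' x v = f' x (\<Sum>b\<in>Basis. (v \<bullet> b) *\<^sub>R b)" by (simp add: euclidean_representation)
      then show ?thesis by (simp add: sum scaleR)
    qed
    then have "Cb_upto k UNIV (\<lambda>r. f' (r *\<^sub>R v) v)"
      using Suc.IH[OF f'2] by (auto intro!: Cb_upto_sum Cb_upto_mult)
    moreover have "((\<lambda>r. f (r *\<^sub>R v)) has_derivative (\<lambda>h. f' (r *\<^sub>R v) (h *\<^sub>R v))) (at r)" for r
      by (rule has_derivative_compose[OF _ f'1, where f = "\<lambda>r. r *\<^sub>R v"]) (auto intro!: derivative_eq_intros)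
    ultimately show ?case using *[OF c]
      by (intro Cb_upto_SucI[where f' = "\<lambda>r h. f' (r *\<^sub>R v) (h *\<^sub>R v)"]) auto
  qed
qed

lemma Cb_upto_real_SucE:
  assumes "Cb_upto (Suc k) UNIV (f :: real \<Rightarrow> real)"
  obtains f' where "\<And>x. (f has_real_derivative f' x) (at x)" "Cb_upto k UNIV f'"
proof -
  from assms obtain f' where f'0: "\<And>x. x \<in> UNIV \<Longrightarrow> (f has_derivative f' x) (at x within UNIV)"
    and f'1: "\<And>b. b \<in> Basis \<Longrightarrow> Cb_upto k UNIV (\<lambda>x. f' x b)"
    by (rule Cb_upto_SucE) (rule that; assumption)
  have f': "(f has_derivative f' x) (at x)" "Cb_upto k UNIV (\<lambda>x. f' x 1)" for x
    using f'0 f'1 by auto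
  have "f' x h = f' x 1 * h" for x h
  proof -
    interpret bounded_linear "f' x" using f'(1) by (rule has_derivative_bounded_linear)
    show ?thesis using scaleR[of h 1] by simp
  qed
  then have "(f has_real_derivative f' x 1) (at x)" for x
    unfolding has_field_derivative_def by (intro has_derivative_eq_rhs[OF f'(1)] ext)
  then show ?thesis by (rule that) (rule f'(2))
qed

lemma Cb_infty_derivD:
  assumes "f \<in> Cb_infty (UNIV :: real set)"
  shows "(f has_real_derivative deriv f x) (at x)" "deriv f \<in> Cb_infty UNIV"
proof -
  have *: "(\<forall>x. (f has_real_derivative deriv f x) (at x)) \<and> Cb_upto k UNIV (deriv f)" for k
  proof -
    have "Cb_upto (Suc k) UNIV f" using assms unfolding Cb_infty_def by blast
    then obtain f' where f': "\<And>x. (f has_real_derivative f' x) (at x)" "Cb_upto k UNIV f'"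
      by (rule Cb_upto_real_SucE) (rule that; assumption)
    moreover have "deriv f = f'" using DERIV_imp_deriv[OF f'(1)] by auto
    ultimately show ?thesis by simp
  qed
  then show "(f has_real_derivative deriv f x) (at x)" by blast
  from * show "deriv f \<in> Cb_infty UNIV" by (simp add: Cb_infty_def)
qed

text \<open>A coinduction principle: a class of bounded functions that is closed under
  differentiation contains derivatives of all orders, and each is continuous because it is
  differentiable. It spares an induction on the order for every operator considered later.\<close>

lemma Cb_infty_real_coinduct:
  fixes F :: "(real \<Rightarrow> real) set"
  assumes "f \<in> F" and "\<And>f. f \<in> F \<Longrightarrow> bounded (range f) \<and> (\<exists>f'\<in>F. \<forall>x. (f has_real_derivative f' x) (at x))"
  shows "f \<in> Cb_infty UNIV"
proof -
  have "f \<in> F \<Longrightarrow> Cb_upto k UNIV f" for k f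
  proof (induction k arbitrary: f)
    case 0
    then obtain f' where "\<And>x. (f has_real_derivative f' x) (at x)" "bounded (range f)"
      using assms(2)[OF 0] by blast
    then show ?case by (auto intro!: DERIV_continuous_on[where D = f'])
  next
    case (Suc k)
    obtain f' where f': "f' \<in> F" "\<And>x. (f has_real_derivative f' x) (at x)" "bounded (range f)"
      using assms(2)[OF Suc.prems] by blast
    show ?case
      by (rule Cb_upto_SucI[where f' = "\<lambda>x h. f' x * h"])
        (use Suc.IH[OF f'(1)] f'(2,3) in \<open>auto simp: has_field_derivative_def intro!: DERIV_continuous_on[where D = f']\<close>)
  qed
  then show ?thesis using assms(1) by (auto simp: Cb_infty_def)
qed

lemma Cb_infty_bound:
  assumes "f \<in> Cb_infty UNIV"
  obtains M where "\<And>x. \<bar>f x\<bar> \<le> M"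
proof -
  have "bounded (range f)" using assms Cb_upto_bounded[of 0 UNIV f] by (auto simp: Cb_infty_def)
  then show ?thesis using that by (auto simp: bounded_iff)
qed

lemma Cb_infty_continuous: "f \<in> Cb_infty UNIV \<Longrightarrow> continuous_on UNIV f"
  using Cb_upto_continuous_on[of 0 UNIV f] by (simp add: Cb_infty_def)

lemma Cb_infty_borel: "f \<in> Cb_infty UNIV \<Longrightarrow> f \<in> borel_measurable borel"
  by (rule borel_measurable_continuous_onI) (rule Cb_infty_continuous)

section \<open>Bounded derivatives on the half space, one-sided in time at
  \<open>t = 0\<close>\<close>

abbreviation (input) half_space :: "('a::euclidean_space \<times> real) set" where
  "half_space \<equiv> UNIV \<times> {0..}"

text \<open>Differentiability in \<open>x\<close> together with a jointly continuous time derivative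
  already gives joint differentiability on the convex half space, boundary included.\<close>

lemma Cb_upto_halfI:
  fixes f :: "'a::euclidean_space \<Rightarrow> real \<Rightarrow> real"
  assumes bdd: "bounded ((\<lambda>(x, t). f x t) ` half_space)"
    and fx: "\<And>x t. 0 \<le> t \<Longrightarrow> ((\<lambda>x. f x t) has_derivative fx x t) (at x)"
    and ft: "\<And>x t. 0 \<le> t \<Longrightarrow> ((\<lambda>t. f x t) has_real_derivative ft x t) (at t within {0..})"
    and Cx: "\<And>b. b \<in> Basis \<Longrightarrow> Cb_upto k half_space (\<lambda>(x, t). fx x t b)"
    and Ct: "Cb_upto k half_space (\<lambda>(x, t). ft x t)"
  shows "Cb_upto (Suc k) half_space (\<lambda>(x, t). f x t)"
proof -
  have cft: "continuous_on half_space (\<lambda>(x, t). ft x t)" using Ct by (rule Cb_upto_continuous_on)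
  have D: "((\<lambda>(x, t). f x t) has_derivative (\<lambda>(h, \<tau>). fx x t h + ft x t * \<tau>)) (at (x, t) within half_space)"
    if t: "0 \<le> t" for x t
  proof -
    have "((\<lambda>(x, t). f x t) has_derivative (\<lambda>(h, \<tau>). fx x t h + blinfun_apply (blinfun_mult_right (ft x t)) \<tau>)) (at (x, t) within half_space)"
    proof (rule has_derivative_partialsI)
      show "((\<lambda>x. f x t) has_derivative fx x t) (at x)" by (rule fx[OF t])
      show "((\<lambda>t. f x t) has_derivative blinfun_apply (blinfun_mult_right (ft x t))) (at t within {0..})"
        if "t \<in> {0..}" for x t
        using ft[of t x] that by (simp add: has_field_derivative_def)
      have "continuous_on half_space (\<lambda>z. blinfun_mult_right (case z of (x, t) \<Rightarrow> ft x t))"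
        by (intro bounded_linear.continuous_on[OF bounded_linear_blinfun_mult_right] cft)
      then show "continuous (at (x, t) within half_space) (\<lambda>(x, t). blinfun_mult_right (ft x t))"
        using t by (auto simp: continuous_on_eq_continuous_within case_prod_unfold)
    qed (use t in auto)
    then show ?thesis by simp
  qed
  have fx0: "fx x t 0 = 0" if "0 \<le> t" for x t
    using linear_0[OF has_derivative_linear[OF fx[OF that]]] .
  have "continuous_on half_space (\<lambda>(x, t). f x t)"
    using D by (auto simp: continuous_on_eq_continuous_within intro: has_derivative_continuous)
  then show ?thesis
  proof (rule Cb_upto_SucI[where f' = "\<lambda>(x, t) (h, \<tau>). fx x t h + ft x t * \<tau>", OF _ bdd])
    fix b :: "'a \<times> real" assume b: "b \<in> Basis"
    consider h where "h \<in> Basis" "b = (h, 0)" | "b = (0, 1)"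
      using b by (auto simp: Basis_prod_def)
    then show "Cb_upto k half_space (\<lambda>x. (case x of (x, t) \<Rightarrow> \<lambda>(h, \<tau>). fx x t h + ft x t * \<tau>) b)"
    proof cases
      case 1
      then show ?thesis using Cx by (simp add: case_prod_unfold)
    next
      case 2
      \<comment> \<open>In the time direction the spatial derivative is evaluated at
        \<open>0\<close> and vanishes by linearity.\<close>
      have "Cb_upto k half_space (\<lambda>x. fx (fst x) (snd x) 0 + ft (fst x) (snd x))"
        by (rule Cb_upto_cong[OF Ct]) (auto simp: fx0)
      then show ?thesis using 2 by (simp add: case_prod_unfold)
    qed
  qed (use D in auto)
qed


lemma Cb_upto_half_SucE:
  fixes f :: "'a::euclidean_space \<Rightarrow> real \<Rightarrow> real"
  assumes "Cb_upto (Suc k) half_space (\<lambda>(x, t). f x t)"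
  obtains fx ft where "\<And>x t. 0 \<le> t \<Longrightarrow> ((\<lambda>x. f x t) has_derivative fx x t) (at x)"
    and "\<And>x t. 0 \<le> t \<Longrightarrow> ((\<lambda>t. f x t) has_real_derivative ft x t) (at t within {0..})"
    and "\<And>b. b \<in> Basis \<Longrightarrow> Cb_upto k half_space (\<lambda>(x, t). fx x t b)"
    and "Cb_upto k half_space (\<lambda>(x, t). ft x t)"
proof -
  from assms obtain f' where f': "\<And>z. z \<in> half_space \<Longrightarrow> ((\<lambda>(x, t). f x t) has_derivative f' z) (at z within half_space)"
    and C: "\<And>b. b \<in> Basis \<Longrightarrow> Cb_upto k half_space (\<lambda>x. f' x b)"
    by (rule Cb_upto_SucE) (rule that; assumption)
  have Dx: "((\<lambda>x. f x t) has_derivative (\<lambda>h. f' (x, t) (h, 0))) (at x)" if t: "0 \<le> t" for x t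
  proof -
    have sub: "range (\<lambda>z::'a. (z, t)) \<subseteq> half_space" using t by (intro image_subsetI) simp
    have "((\<lambda>z. case (z, t) of (x, t) \<Rightarrow> f x t) has_derivative (\<lambda>h. f' (x, t) (h, 0))) (at x within UNIV)"
      by (rule has_derivative_in_compose2[where t = half_space and f = "\<lambda>z. (z, t)", OF f' _ _ has_derivative_Pair[OF has_derivative_ident has_derivative_const]])
        (simp_all only: sub UNIV_I)
    then show ?thesis by simp
  qed
  have Dt: "((\<lambda>t. f x t) has_real_derivative f' (x, t) (0, 1)) (at t within {0..})" if t: "0 \<le> t" for x t
  proof -
    have "(x, t) \<in> half_space" using t by simp
    then interpret bounded_linear "f' (x, t)" by (rule has_derivative_bounded_linear[OF f'])
    have sub: "Pair x ` {0..} \<subseteq> half_space" by auto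
    have D: "((\<lambda>t. case (x, t) of (x, t) \<Rightarrow> f x t) has_derivative (\<lambda>h. f' (x, t) (0, h))) (at t within {0..})"
      by (rule has_derivative_in_compose2[where t = half_space and f = "\<lambda>t. (x, t)", OF f' _ _ has_derivative_Pair[OF has_derivative_const has_derivative_ident]])
        (use t sub in simp_all)
    have eq: "f' (x, t) (0, h) = f' (x, t) (0, 1) * h" for h
      using scaleR[of h "(0, 1)"] by simp
    show ?thesis
      using has_derivative_eq_rhs[OF D ext[OF eq]] by (simp add: has_field_derivative_def)
  qed
  have Cx: "Cb_upto k half_space (\<lambda>(x, t). f' (x, t) (b, 0))" if "b \<in> Basis" for b
  proof -
    have "(b, 0) \<in> Basis" using that by (simp add: Basis_prod_def)
    from C[OF this] show ?thesis by (simp add: case_prod_unfold)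
  qed
  have Ct: "Cb_upto k half_space (\<lambda>(x, t). f' (x, t) (0, 1))"
  proof -
    have "(0, 1) \<in> (Basis :: ('a \<times> real) set)" by (auto simp: Basis_prod_def)
    from C[OF this] show ?thesis by (simp add: case_prod_unfold)
  qed
  show ?thesis by (rule that[OF Dx Dt Cx Ct])
qed

lemma Cb_upto_half_real_SucE:
  fixes f :: "real \<Rightarrow> real \<Rightarrow> real"
  assumes "Cb_upto (Suc k) half_space (\<lambda>(r, t). f r t)"
  obtains fr ft where "\<And>r t. 0 \<le> t \<Longrightarrow> ((\<lambda>r. f r t) has_real_derivative fr r t) (at r)"
    and "\<And>r t. 0 \<le> t \<Longrightarrow> ((\<lambda>t. f r t) has_real_derivative ft r t) (at t within {0..})"
    and "Cb_upto k half_space (\<lambda>(r, t). fr r t)"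
    and "Cb_upto k half_space (\<lambda>(r, t). ft r t)"
proof -
  from assms obtain fx ft where fx: "\<And>x t. 0 \<le> t \<Longrightarrow> ((\<lambda>x. f x t) has_derivative fx x t) (at x)"
    and ft: "\<And>x t. 0 \<le> t \<Longrightarrow> ((\<lambda>t. f x t) has_real_derivative ft x t) (at t within {0..})"
    and Cx: "\<And>b. b \<in> Basis \<Longrightarrow> Cb_upto k half_space (\<lambda>(x, t). fx x t b)"
    and Ct: "Cb_upto k half_space (\<lambda>(x, t). ft x t)"
    by (rule Cb_upto_half_SucE) (rule that; assumption)
  have Dr: "((\<lambda>r. f r t) has_real_derivative fx r t 1) (at r)" if t: "0 \<le> t" for r t
  proof -
    interpret bounded_linear "fx r t" by (rule has_derivative_bounded_linear[OF fx[OF t]])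
    have "fx r t h = fx r t 1 * h" for h using scaleR[of h 1] by simp
    then show ?thesis
      unfolding has_field_derivative_def by (intro has_derivative_eq_rhs[OF fx[OF t]] ext)
  qed
  have Cr: "Cb_upto k half_space (\<lambda>(r, t). fx r t 1)" using Cx[of 1] by simp
  show ?thesis by (rule that[OF Dr ft Cr Ct])
qed

lemma Cb_upto_half_realI:
  fixes f :: "real \<Rightarrow> real \<Rightarrow> real"
  assumes bdd: "bounded ((\<lambda>(r, t). f r t) ` half_space)"
    and fr: "\<And>r t. 0 \<le> t \<Longrightarrow> ((\<lambda>r. f r t) has_real_derivative fr r t) (at r)"
    and ft: "\<And>r t. 0 \<le> t \<Longrightarrow> ((\<lambda>t. f r t) has_real_derivative ft r t) (at t within {0..})"
    and Cr: "Cb_upto k half_space (\<lambda>(r, t). fr r t)"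
    and Ct: "Cb_upto k half_space (\<lambda>(r, t). ft r t)"
  shows "Cb_upto (Suc k) half_space (\<lambda>(r, t). f r t)"
proof (rule Cb_upto_halfI[where fx = "\<lambda>r t h. fr r t * h", OF bdd _ ft _ Ct])
  show "((\<lambda>r. f r t) has_derivative (\<lambda>h. fr r t * h)) (at r)" if "0 \<le> t" for r t
    using fr[OF that] by (simp add: has_field_derivative_def)
  show "Cb_upto k half_space (\<lambda>(r, t). fr r t * b)" if "b \<in> Basis" for b
    using that Cr by simp
qed

lemma continuous_on_half_compose:
  assumes "continuous_on half_space (\<lambda>(x, t). f x t)" "continuous_on S a" "continuous_on S b" "\<And>w. w \<in> S \<Longrightarrow> 0 \<le> b w"
  shows "continuous_on S (\<lambda>w. f (a w) (b w))"
proof -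
  have "continuous_on S (\<lambda>w. case (a w, b w) of (x, t) \<Rightarrow> f x t)"
    by (rule continuous_on_compose2[OF assms(1) continuous_on_Pair[OF assms(2,3)]]) (use assms(4) in auto)
  then show ?thesis by simp
qed

text \<open>The application is f'(r)/r, the average of f''(\<theta> r) over \<theta> in [0,1]. A
  power of \<theta> is carried along because every derivative in \<open>r\<close> produces one more
  factor \<theta>.\<close>

lemma Cb_upto_average:
  fixes f :: "real \<Rightarrow> real \<Rightarrow> real"
  assumes "Cb_upto k half_space (\<lambda>(r, t). f r t)"
  shows "Cb_upto k half_space (\<lambda>(r, t). integral {0..1} (\<lambda>\<theta>. \<theta> ^ m * f (\<theta> * r) t))"
  using assms
proof (induction k arbitrary: f m)
  case 0
  then have c: "continuous_on half_space (\<lambda>(r, t). f r t)" and b: "bounded ((\<lambda>(r, t). f r t) ` half_space)"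
    by (rule Cb_upto_continuous_on, rule Cb_upto_bounded)
  have c1: "continuous_on (half_space \<times> cbox 0 1) (\<lambda>(z, \<theta>). \<theta> ^ m * f (\<theta> * fst z) (snd z))"
    unfolding case_prod_unfold
    by (intro continuous_on_mult continuous_on_power continuous_on_half_compose[OF c] continuous_on_const continuous_on_id continuous_on_fst continuous_on_snd) auto
  have c2: "continuous_on {0..1} (\<lambda>\<theta>. \<theta> ^ m * f (\<theta> * r) t)" if "0 \<le> t" for r t
    using that by (intro continuous_on_mult continuous_on_power continuous_on_half_compose[OF c] continuous_on_const continuous_on_id continuous_on_fst continuous_on_snd) auto
  from b obtain B where "\<forall>z\<in>half_space. norm (case z of (r, t) \<Rightarrow> f r t) \<le> B"
    unfolding bounded_iff by blast
  then have B: "\<bar>f r t\<bar> \<le> B" if "0 \<le> t" for r t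
    using that by force
  have "\<bar>integral {0..1} (\<lambda>\<theta>. \<theta> ^ m * f (\<theta> * r) t)\<bar> \<le> B * (1 - 0)" if t: "0 \<le> t" for r t
    unfolding real_norm_def[symmetric]
  proof (rule integral_bound)
    fix \<theta> :: real assume "\<theta> \<in> {0..1}"
    then have "\<bar>\<theta> ^ m\<bar> * \<bar>f (\<theta> * r) t\<bar> \<le> 1 * B"
      using B[OF t, of 0] by (intro mult_mono B t) (auto simp: power_le_one)
    then show "norm (\<theta> ^ m * f (\<theta> * r) t) \<le> B" by (simp add: abs_mult)
  qed (simp, rule c2[OF t])
  then have "bounded ((\<lambda>(r, t). integral {0..1} (\<lambda>\<theta>. \<theta> ^ m * f (\<theta> * r) t)) ` half_space)"
    unfolding bounded_iff by (intro exI[of _ B]) simp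
  moreover have "continuous_on half_space (\<lambda>z. integral (cbox 0 1) (\<lambda>\<theta>. \<theta> ^ m * f (\<theta> * fst z) (snd z)))"
    by (rule integral_continuous_on_param[OF c1])
  ultimately show ?case by (simp add: case_prod_unfold)
next
  case (Suc k)
  have c: "continuous_on half_space (\<lambda>(r, t). f r t)" and C: "Cb_upto k half_space (\<lambda>(r, t). f r t)"
    by (rule Cb_upto_continuous_on[OF Suc.prems], rule Cb_upto_SucD[OF Suc.prems])
  from Suc.prems obtain fr ft where fr: "\<And>r t. 0 \<le> t \<Longrightarrow> ((\<lambda>r. f r t) has_real_derivative fr r t) (at r)"
    and ft: "\<And>r t. 0 \<le> t \<Longrightarrow> ((\<lambda>t. f r t) has_real_derivative ft r t) (at t within {0..})"
    and Cr: "Cb_upto k half_space (\<lambda>(r, t). fr r t)"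
    and Ct: "Cb_upto k half_space (\<lambda>(r, t). ft r t)"
    by (rule Cb_upto_half_real_SucE) (rule that; assumption)
  have c2: "(\<lambda>\<theta>. \<theta> ^ m * f (\<theta> * r) t) integrable_on cbox 0 1" if "0 \<le> t" for r t
    using that by (intro integrable_continuous continuous_on_mult continuous_on_power continuous_on_half_compose[OF c] continuous_on_const continuous_on_id) auto
  show ?case
  proof (rule Cb_upto_half_realI[OF _ _ _ Suc.IH[OF Cr, of "Suc m"] Suc.IH[OF Ct, of m]])
    show "bounded ((\<lambda>(r, t). integral {0..1} (\<lambda>\<theta>. \<theta> ^ m * f (\<theta> * r) t)) ` half_space)"
      using Suc.IH[OF C, of m] by (rule Cb_upto_bounded)
    fix r t :: real assume t: "0 \<le> t"
    have "((\<lambda>r. integral (cbox 0 1) (\<lambda>\<theta>. \<theta> ^ m * f (\<theta> * r) t)) has_field_derivative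
       integral (cbox 0 1) (\<lambda>\<theta>. \<theta> ^ Suc m * fr (\<theta> * r) t)) (at r within UNIV)"
    proof (rule leibniz_rule_field_derivative)
      show "((\<lambda>r. \<theta> ^ m * f (\<theta> * r) t) has_field_derivative \<theta> ^ Suc m * fr (\<theta> * r) t) (at r within UNIV)" for r \<theta>
      proof -
        have "((\<lambda>r. f (\<theta> * r) t) has_real_derivative fr (\<theta> * r) t * \<theta>) (at r)"
          by (rule DERIV_chain2[OF fr[OF t]]) (auto intro!: derivative_eq_intros)
        from DERIV_cmult[OF this, of "\<theta> ^ m"] show ?thesis by (simp add: mult_ac)
      qed
      show "continuous_on (UNIV \<times> cbox 0 1) (\<lambda>(r, \<theta>). \<theta> ^ Suc m * fr (\<theta> * r) t)"
        unfolding case_prod_unfold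
        by (intro continuous_on_mult continuous_on_power continuous_on_half_compose[OF Cb_upto_continuous_on[OF Cr]] continuous_on_const continuous_on_id continuous_on_fst continuous_on_snd) (use t in auto)
    qed (rule c2[OF t], auto)
    then show "((\<lambda>r. integral {0..1} (\<lambda>\<theta>. \<theta> ^ m * f (\<theta> * r) t)) has_real_derivative
       integral {0..1} (\<lambda>\<theta>. \<theta> ^ Suc m * fr (\<theta> * r) t)) (at r)" by simp
    have "((\<lambda>t. integral (cbox 0 1) (\<lambda>\<theta>. \<theta> ^ m * f (\<theta> * r) t)) has_field_derivative
       integral (cbox 0 1) (\<lambda>\<theta>. \<theta> ^ m * ft (\<theta> * r) t)) (at t within {0..})"
    proof (rule leibniz_rule_field_derivative)
      show "((\<lambda>t. \<theta> ^ m * f (\<theta> * r) t) has_field_derivative \<theta> ^ m * ft (\<theta> * r) t) (at t within {0..})"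
        if "t \<in> {0..}" for t \<theta>
        using that by (intro DERIV_cmult ft) auto
      show "continuous_on ({0..} \<times> cbox 0 1) (\<lambda>(t, \<theta>). \<theta> ^ m * ft (\<theta> * r) t)"
        unfolding case_prod_unfold
        by (intro continuous_on_mult continuous_on_power continuous_on_half_compose[OF Cb_upto_continuous_on[OF Ct]] continuous_on_const continuous_on_id continuous_on_fst continuous_on_snd) auto
    next
      show "(\<lambda>\<theta>. \<theta> ^ m * f (\<theta> * r) t) integrable_on cbox 0 1" if "t \<in> {0..}" for t
        using that by (intro c2) auto
    qed (use t in auto)
    then show "((\<lambda>t. integral {0..1} (\<lambda>\<theta>. \<theta> ^ m * f (\<theta> * r) t)) has_real_derivative
       integral {0..1} (\<lambda>\<theta>. \<theta> ^ m * ft (\<theta> * r) t)) (at t within {0..})" by simp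
  qed
qed

text \<open>The derivatives of \<open>J\<close> and of \<open>(x \<bullet> b) * J x\<close> are
  polynomials in \<open>J\<close> and the functions \<open>(x \<bullet> b') * J x\<close>, all
  bounded. The two claims feed each other and are therefore proved in one induction.\<close>

lemma Cb_upto_inverse_bracket:
  fixes b :: "'a::euclidean_space"
  defines "J \<equiv> \<lambda>x::'a. 1 / sqrt (1 + x \<bullet> x)"
  shows "Cb_upto k half_space (\<lambda>(x, t::real). J x) \<and> (\<forall>b\<in>Basis. Cb_upto k half_space (\<lambda>(x, t::real). (x \<bullet> b) * J x))"
proof (induction k)
  have pos: "0 < 1 + x \<bullet> x" for x :: 'a by (simp add: add_pos_nonneg)
  have J1: "\<bar>J x\<bar> \<le> 1" for x
    using pos[of x] unfolding J_def by (simp add: divide_le_eq)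
  have J2: "\<bar>(x \<bullet> b) * J x\<bar> \<le> 1" if "b \<in> Basis" for x b
  proof -
    have "\<bar>x \<bullet> b\<bar> \<le> sqrt (x \<bullet> x)" using Basis_le_norm[OF that, of x] by (simp add: norm_eq_sqrt_inner)
    also have "\<dots> \<le> sqrt (1 + x \<bullet> x)" by simp
    finally show ?thesis using pos[of x] by (simp add: J_def abs_mult)
  qed
  have bJ: "bounded ((\<lambda>(x, t::real). J x) ` half_space)" using J1 by (auto simp: bounded_iff)
  have bxJ: "bounded ((\<lambda>(x, t::real). (x \<bullet> b) * J x) ` half_space)" if "b \<in> Basis" for b
    using J2[OF that] by (auto simp: bounded_iff simp del: real_norm_def simp: real_norm_def)
  have nz: "sqrt (1 + x \<bullet> x) \<noteq> 0" for x :: 'a using pos[of x] by simp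
  {
    case 0
    have "continuous_on half_space (\<lambda>(x, t::real). J x)" "continuous_on half_space (\<lambda>(x, t::real). (x \<bullet> b) * J x)" for b
      unfolding J_def case_prod_unfold by (intro continuous_intros ballI nz)+
    then show ?case using bJ bxJ by simp
  next
    case (Suc k)
    have dJ: "(J has_derivative (\<lambda>h. - ((x \<bullet> h) * J x) * J x * J x)) (at x)" for x
    proof -
      have "((\<lambda>y. 1 / sqrt (1 + y)) has_real_derivative - (1 / (2 * (1 + x \<bullet> x) * sqrt (1 + x \<bullet> x)))) (at (x \<bullet> x))"
        using pos[of x] by (auto intro!: derivative_eq_intros simp: field_simps)
      then have D: "((\<lambda>y. 1 / sqrt (1 + y)) has_derivative (*) (- (1 / (2 * (1 + x \<bullet> x) * sqrt (1 + x \<bullet> x))))) (at (x \<bullet> x))"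
        by (simp add: has_field_derivative_def)
      have "((\<lambda>x. x \<bullet> x) has_derivative (\<lambda>h. 2 * (x \<bullet> h))) (at x)"
        by (auto intro!: derivative_eq_intros simp: inner_commute)
      from has_derivative_compose[where g = "\<lambda>y. 1 / sqrt (1 + y)", OF this D]
      have "(J has_derivative (\<lambda>h. - (1 / (2 * (1 + x \<bullet> x) * sqrt (1 + x \<bullet> x))) * (2 * (x \<bullet> h)))) (at x)"
        unfolding J_def .
      moreover have "- (1 / (2 * (1 + x \<bullet> x) * sqrt (1 + x \<bullet> x))) * (2 * (x \<bullet> h)) = - ((x \<bullet> h) * J x) * J x * J x" for h
      proof -
        have "J x * J x = 1 / (1 + x \<bullet> x)" using pos[of x] by (simp add: J_def)
        then have "- ((x \<bullet> h) * J x) * J x * J x = - ((x \<bullet> h) * J x * (1 / (1 + x \<bullet> x)))"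
          by (simp add: mult.assoc)
        moreover have "2 * (1 + x \<bullet> x) * sqrt (1 + x \<bullet> x) = 2 * ((1 + x \<bullet> x) * sqrt (1 + x \<bullet> x))" by simp
        ultimately show ?thesis unfolding J_def by (simp only: mult_divide_mult_cancel_left_if) (simp add: divide_simps)
      qed
      ultimately show ?thesis by simp
    qed
    have C0: "Cb_upto k half_space (\<lambda>(x::'a, t::real). 0)" by (simp add: case_prod_unfold)
    have CJ: "Cb_upto k half_space (\<lambda>z::'a \<times> real. J (fst z))"
      and CxJ: "\<And>b. b \<in> Basis \<Longrightarrow> Cb_upto k half_space (\<lambda>z::'a \<times> real. (fst z \<bullet> b) * J (fst z))"
      using Suc by (auto simp: case_prod_unfold)
    show ?case
    proof (intro conjI ballI)
      show "Cb_upto (Suc k) half_space (\<lambda>(x, t::real). J x)"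
        by (rule Cb_upto_halfI[OF bJ dJ DERIV_const _ C0])
          (auto simp: case_prod_unfold intro!: Cb_upto_mult Cb_upto_uminus CJ CxJ)
      fix b :: 'a assume b: "b \<in> Basis"
      show "Cb_upto (Suc k) half_space (\<lambda>(x, t::real). (x \<bullet> b) * J x)"
      proof (rule Cb_upto_halfI[where fx = "\<lambda>x t h. (h \<bullet> b) * J x + (x \<bullet> b) * J x * - ((x \<bullet> h) * J x) * J x", OF bxJ[OF b] _ DERIV_const _ C0])
        show "((\<lambda>x. (x \<bullet> b) * J x) has_derivative (\<lambda>h. (h \<bullet> b) * J x + (x \<bullet> b) * J x * - ((x \<bullet> h) * J x) * J x)) (at x)" for x
          by (auto intro!: derivative_eq_intros dJ simp: algebra_simps)
        show "Cb_upto k half_space (\<lambda>(x, t::real). (b' \<bullet> b) * J x + (x \<bullet> b) * J x * - ((x \<bullet> b') * J x) * J x)"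
          if "b' \<in> Basis" for b'
          unfolding case_prod_unfold using b that
          by (intro Cb_upto_add Cb_upto_mult Cb_upto_uminus Cb_upto_const CJ CxJ)
      qed
    qed
  }
qed


section \<open>Radial extension of even functions\<close>

lemma DERIV_even_imp_odd:
  assumes "\<And>x. f (- x) = (f x :: real)" and "\<And>x. (f has_real_derivative f' x) (at x)"
  shows "f' (- x) = - f' x"
proof -
  have "((\<lambda>x. f (- x)) has_real_derivative f' (- (- x)) * - 1) (at (- x))"
    by (rule DERIV_chain2[OF assms(2)]) (auto intro!: derivative_eq_intros)
  then have "(f has_real_derivative - f' x) (at (- x))" using assms(1) by simp
  then show ?thesis using DERIV_unique assms(2) by blast
qed

lemma DERIV_unique_atLeast:
  assumes "(f has_real_derivative a) (at t within {0..})" "(f has_real_derivative b) (at t within {0..})" "0 \<le> (t::real)"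
  shows "a = b"
proof (rule vector_derivative_unique_within[of t "{0..}"])
  have "t islimpt {t..t+1}" by (subst islimpt_Icc) auto
  then have "t islimpt {0..}" by (rule islimpt_subset) (use assms(3) in auto)
  then show "at t within {0..} \<noteq> bot" by (simp add: trivial_limit_within)
qed (use assms in \<open>simp_all add: has_real_derivative_iff_has_vector_derivative\<close>)

text \<open>The weight \<open>sqrt (1 + r\<^sup>2)\<close> compensates the unbounded factor \<open>x\<close> in the gradient
  \<open>(f' r / r) x\<close> of a radial function, so that no decay of \<open>f' r / r\<close> has to be tracked.\<close>

lemma even_weighted_radial_derivative:
  fixes f fr :: "real \<Rightarrow> real \<Rightarrow> real"
  assumes C: "Cb_upto (Suc (Suc k)) half_space (\<lambda>(r, t). f r t)"
    and even: "\<And>r t. 0 \<le> t \<Longrightarrow> f (- r) t = f r t"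
    and fr: "\<And>r t. 0 \<le> t \<Longrightarrow> ((\<lambda>r. f r t) has_real_derivative fr r t) (at r)"
  obtains Q where "Cb_upto k half_space (\<lambda>(r, t). sqrt (1 + r\<^sup>2) * Q r t)"
    and "\<And>r t. 0 \<le> t \<Longrightarrow> Q (- r) t = Q r t" and "\<And>r t. 0 \<le> t \<Longrightarrow> r * Q r t = fr r t"
proof -
  from C obtain gr gt where gr: "\<And>r t. 0 \<le> t \<Longrightarrow> ((\<lambda>r. f r t) has_real_derivative gr r t) (at r)"
    and "\<And>r t. 0 \<le> t \<Longrightarrow> ((\<lambda>t. f r t) has_real_derivative gt r t) (at t within {0..})"
    and Cgr: "Cb_upto (Suc k) half_space (\<lambda>(r, t). gr r t)"
    and "Cb_upto (Suc k) half_space (\<lambda>(r, t). gt r t)"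
    by (rule Cb_upto_half_real_SucE) (rule that; assumption)
  have gr_eq: "gr r t = fr r t" if "0 \<le> t" for r t
    using DERIV_unique[OF gr[OF that] fr[OF that]] .
  from Cgr obtain grr grt where grr: "\<And>r t. 0 \<le> t \<Longrightarrow> ((\<lambda>r. gr r t) has_real_derivative grr r t) (at r)"
    and "\<And>r t. 0 \<le> t \<Longrightarrow> ((\<lambda>t. gr r t) has_real_derivative grt r t) (at t within {0..})"
    and Cgrr: "Cb_upto k half_space (\<lambda>(r, t). grr r t)"
    and "Cb_upto k half_space (\<lambda>(r, t). grt r t)"
    by (rule Cb_upto_half_real_SucE) (rule that; assumption)
  \<comment> \<open>This average of the second derivative equals \<open>fr r t / r\<close> away from
    the origin and supplies the smooth continuation across it.\<close>
  define Q where "Q r t = integral {0..1} (\<lambda>\<theta>. \<theta> ^ 0 * grr (\<theta> * r) t)" for r t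
  have CQ: "Cb_upto k half_space (\<lambda>(r, t). Q r t)"
    unfolding Q_def by (rule Cb_upto_average[OF Cgrr])
  have odd: "gr (- r) t = - gr r t" if "0 \<le> t" for r t
    by (rule DERIV_even_imp_odd[of "\<lambda>r. f r t"]) (use even gr that in blast)+
  then have gr0: "gr 0 t = 0" if "0 \<le> t" for t using odd[OF that, of 0] by simp
  have rQ: "r * Q r t = gr r t" if t: "0 \<le> t" for r t
  proof -
    have "((\<lambda>\<theta>. grr (\<theta> * r) t * r) has_integral (gr (1 * r) t - gr (0 * r) t)) {0..1}"
    proof (rule fundamental_theorem_of_calculus)
      show "((\<lambda>\<theta>. gr (\<theta> * r) t) has_vector_derivative grr (\<theta> * r) t * r) (at \<theta> within {0..1})" for \<theta>
        unfolding has_real_derivative_iff_has_vector_derivative[symmetric]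
        by (rule DERIV_chain2[OF grr[OF t]]) (auto intro!: derivative_eq_intros)
    qed simp
    then have "integral {0..1} (\<lambda>\<theta>. grr (\<theta> * r) t * r) = gr r t"
      using gr0[OF t] by (intro integral_unique) simp
    then show ?thesis by (simp add: Q_def mult.commute[of r])
  qed
  define J where "J r = 1 / sqrt (1 + r\<^sup>2)" for r :: real
  have J: "Cb_upto k half_space (\<lambda>(r::real, t::real). J r)" "Cb_upto k half_space (\<lambda>(r::real, t::real). r * J r)"
    using Cb_upto_inverse_bracket[where 'a = real, of k] by (auto simp: J_def power2_eq_square)
  show ?thesis
  proof (rule that[of Q])
    have "Cb_upto k half_space (\<lambda>z. J (fst z) * Q (fst z) (snd z) + fst z * J (fst z) * gr (fst z) (snd z))"
      using Cb_upto_add[OF Cb_upto_mult[OF J(1) CQ] Cb_upto_mult[OF J(2) Cb_upto_SucD[OF Cgr]]]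
      unfolding case_prod_unfold .
    then show "Cb_upto k half_space (\<lambda>(r, t). sqrt (1 + r\<^sup>2) * Q r t)"
    proof (rule Cb_upto_cong)
      fix z :: "real \<times> real" assume "z \<in> half_space"
      then obtain r t where z: "z = (r, t)" "0 \<le> t" by auto
      have pos: "0 < 1 + r\<^sup>2" by (simp add: add_pos_nonneg)
      \<comment> \<open>The factor \<open>1 + r\<^sup>2\<close> is split: one summand keeps the
        bounded \<open>Q\<close>, the other turns \<open>r * Q r t\<close> into the bounded first
        derivative.\<close>
      have "J r * Q r t + r * J r * gr r t = J r * (1 + r\<^sup>2) * Q r t"
        unfolding rQ[OF z(2), symmetric] by (simp add: power2_eq_square algebra_simps)
      also have "J r * (1 + r\<^sup>2) = sqrt (1 + r\<^sup>2)"
        using pos by (simp add: J_def real_div_sqrt)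
      finally show "(case z of (r, t) \<Rightarrow> sqrt (1 + r\<^sup>2) * Q r t)
          = J (fst z) * Q (fst z) (snd z) + fst z * J (fst z) * gr (fst z) (snd z)"
        by (simp add: z)
    qed
    fix r t :: real assume t: "0 \<le> t"
    show "Q (- r) t = Q r t"
    proof (cases "r = 0")
      case False
      have "r * Q (- r) t = r * Q r t" using rQ[OF t, of r] rQ[OF t, of "- r"] odd[OF t, of r] by simp
      then show ?thesis using False by simp
    qed simp
    show "r * Q r t = fr r t" using rQ[OF t] gr_eq[OF t] by simp
  qed
qed

text \<open>Writing the derivative as \<open>r * Q r\<close> includes the origin: there it vanishes,
  so f(norm x) - f(0) is of smaller order than the norm, although the norm itself is not
  differentiable.\<close>

lemma has_derivative_radial:
  fixes x :: "'a::euclidean_space"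
  assumes f: "\<And>r. (f has_real_derivative r * Q r) (at r)"
  shows "((\<lambda>x. f (norm x)) has_derivative (\<lambda>h. (x \<bullet> h) * Q (norm x))) (at x)"
proof (cases "x = 0")
  case False
  have "((\<lambda>x. f (norm x)) has_derivative (\<lambda>h. (norm x * Q (norm x)) * (h \<bullet> sgn x))) (at x)"
    by (rule has_derivative_compose[where g = f, OF has_derivative_norm[OF False]])
      (use f[of "norm x"] in \<open>simp add: has_field_derivative_def\<close>)
  then show ?thesis
    by (rule has_derivative_eq_rhs) (use False in \<open>auto simp: sgn_div_norm inner_commute\<close>)
next
  case True
  have "((\<lambda>y. (f y - f 0) / y) \<longlongrightarrow> 0) (at 0)"
    using f[of 0] by (simp add: DERIV_def)
  moreover have "filterlim norm (at 0) (at (0::'a))"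
    by (intro filterlim_atI tendsto_norm_zero tendsto_ident_at) (auto simp: eventually_at_filter)
  ultimately have "((\<lambda>y::'a. (f (norm y) - f 0) / norm y) \<longlongrightarrow> 0) (at 0)"
    by (rule filterlim_compose)
  then show ?thesis using True
    by (auto simp: has_derivative_def bounded_linear_zero divide_inverse mult.commute)
qed

text \<open>Each derivative costs two orders of the profile because \<open>Q\<close> is an average
  of second derivatives; hence \<open>2 * k\<close>. The induction hypothesis is applied to the
  weighted profile \<open>sqrt (1 + r\<^sup>2) * Q r t\<close>, which is again even, and to the time
  derivative.\<close>

lemma Cb_upto_radial_extension:
  fixes f :: "real \<Rightarrow> real \<Rightarrow> real"
  assumes "Cb_upto (2 * k) half_space (\<lambda>(r, t). f r t)" and "\<And>r t. 0 \<le> t \<Longrightarrow> f (- r) t = f r t"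
  shows "Cb_upto k half_space (\<lambda>(x::'a::euclidean_space, t). f (norm x) t)"
  using assms
proof (induction k arbitrary: f)
  case 0
  then have c: "continuous_on half_space (\<lambda>(r, t). f r t)" and b: "bounded ((\<lambda>(r, t). f r t) ` half_space)" by simp_all
  have "continuous_on half_space (\<lambda>z. f (norm (fst z :: 'a)) (snd z))"
    by (rule continuous_on_half_compose[OF c]) (auto intro!: continuous_intros)
  moreover have "bounded ((\<lambda>z. f (norm (fst z :: 'a)) (snd z)) ` half_space)"
    by (rule bounded_subset[OF b]) force
  ultimately show ?case by (simp add: case_prod_unfold)
next
  case (Suc k)
  have C: "Cb_upto (Suc (Suc (2 * k))) half_space (\<lambda>(r, t). f r t)" using Suc.prems(1) by simp
  from C obtain fr ft where fr: "\<And>r t. 0 \<le> t \<Longrightarrow> ((\<lambda>r. f r t) has_real_derivative fr r t) (at r)"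
    and ft: "\<And>r t. 0 \<le> t \<Longrightarrow> ((\<lambda>t. f r t) has_real_derivative ft r t) (at t within {0..})"
    and Cr: "Cb_upto (Suc (2 * k)) half_space (\<lambda>(r, t). fr r t)"
    and Ct: "Cb_upto (Suc (2 * k)) half_space (\<lambda>(r, t). ft r t)"
    by (rule Cb_upto_half_real_SucE) (rule that; assumption)
  obtain Q where CQ: "Cb_upto (2 * k) half_space (\<lambda>(r, t). sqrt (1 + r\<^sup>2) * Q r t)"
    and Qe: "\<And>r t. 0 \<le> t \<Longrightarrow> Q (- r) t = Q r t" and rQ: "\<And>r t. 0 \<le> t \<Longrightarrow> r * Q r t = fr r t"
    by (rule even_weighted_radial_derivative[OF C Suc.prems(2) fr]) (assumption | rule that)+
  have 1: "Cb_upto k half_space (\<lambda>(x::'a, t). sqrt (1 + (norm x)\<^sup>2) * Q (norm x) t)"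
    by (rule Suc.IH[OF CQ]) (simp add: Qe)
  have 2: "Cb_upto k half_space (\<lambda>(x::'a, t). ft (norm x) t)"
  proof (rule Suc.IH[OF Cb_upto_SucD[OF Ct]])
    fix r t :: real assume t: "0 \<le> t"
    \<comment> \<open>The functions \<open>f r\<close> and \<open>f (- r)\<close> agree on the half
      line, hence so do their one-sided derivatives, also at \<open>t = 0\<close>.\<close>
    have "((\<lambda>t. f r t) has_real_derivative ft (- r) t) (at t within {0..})"
      using has_derivative_transform[OF _ _ ft[OF t, of "- r", unfolded has_field_derivative_def], of "\<lambda>t. f r t"]
        t Suc.prems(2) by (simp add: has_field_derivative_def)
    from DERIV_unique_atLeast[OF this ft[OF t] t] show "ft (- r) t = ft r t" .
  qed
  show ?case
  proof (rule Cb_upto_halfI[where fx = "\<lambda>x t h. (x \<bullet> h) * Q (norm x) t", OF _ _ _ _ 2])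
    have b: "bounded ((\<lambda>(r, t). f r t) ` half_space)" using C by (rule Cb_upto_bounded)
    show "bounded ((\<lambda>(x::'a, t). f (norm x) t) ` half_space)"
      by (rule bounded_subset[OF b]) force
    fix x :: 'a and t :: real assume t: "0 \<le> t"
    show "((\<lambda>x. f (norm x) t) has_derivative (\<lambda>h. (x \<bullet> h) * Q (norm x) t)) (at x)"
      by (rule has_derivative_radial[where Q = "\<lambda>r. Q r t"]) (use fr rQ t in simp)
    show "((\<lambda>t. f (norm x) t) has_real_derivative ft (norm x) t) (at t within {0..})"
      by (rule ft[OF t])
  next
    fix b :: 'a assume b: "b \<in> Basis"
    \<comment> \<open>The factor \<open>x \<bullet> b\<close> is unbounded, but its product with the
      inverse bracket is smooth and bounded; the weight on \<open>Q\<close> restores the original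
      function.\<close>
    have "Cb_upto k half_space (\<lambda>z. ((fst z :: 'a) \<bullet> b) * (1 / sqrt (1 + fst z \<bullet> fst z)) * (sqrt (1 + (norm (fst z))\<^sup>2) * Q (norm (fst z)) (snd z)))"
      using Cb_upto_inverse_bracket[where 'a = 'a, of k] b 1 unfolding case_prod_unfold
      by (intro Cb_upto_mult[of _ _ "\<lambda>z. (fst z \<bullet> b) * (1 / sqrt (1 + fst z \<bullet> fst z))"]) auto
    then show "Cb_upto k half_space (\<lambda>(x, t). (x \<bullet> b) * Q (norm x) t)"
    proof (rule Cb_upto_cong)
      fix z :: "'a \<times> real"
      have "0 < 1 + fst z \<bullet> fst z" by (simp add: add_pos_nonneg)
      then show "(case z of (x, t) \<Rightarrow> (x \<bullet> b) * Q (norm x) t)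
        = ((fst z :: 'a) \<bullet> b) * (1 / sqrt (1 + fst z \<bullet> fst z)) * (sqrt (1 + (norm (fst z))\<^sup>2) * Q (norm (fst z)) (snd z))"
        by (simp add: case_prod_unfold power2_norm_eq_inner)
    qed
  qed
qed

section \<open>The fractional Laplacian and its truncations\<close>

text \<open>A bridge from gauge integrals, used to integrate powers and exponentials, to Lebesgue
  integrals: for nonnegative functions gauge integrability is absolute.\<close>

lemma set_integrable_lborel_nonneg:
  fixes f :: "real \<Rightarrow> real"
  assumes "f integrable_on A" "\<And>x. x \<in> A \<Longrightarrow> 0 \<le> f x" "A \<in> sets borel" "f \<in> borel_measurable borel"
  shows "set_integrable lborel A f"
proof -
  have "set_integrable lebesgue A f"
    using nonnegative_absolutely_integrable_1[OF assms(1,2)] .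
  moreover have "(\<lambda>x. indicator A x *\<^sub>R f x) \<in> borel_measurable lborel"
    using assms(3,4) by simp
  ultimately show ?thesis
    unfolding set_integrable_def by (simp add: integrable_completion)
qed

lemma integrable_even:
  fixes f :: "real \<Rightarrow> real"
  assumes even: "\<And>x. f (- x) = f x" and [measurable]: "f \<in> borel_measurable borel"
    and int: "set_integrable lborel {0<..} f"
  shows "integrable lborel f" and "(LBINT y. f y) = 2 * (LBINT y:{0<..}. f y)"
proof -
  have 1: "integrable lborel (\<lambda>y. indicator {0<..} y * f y)"
    using int by (simp add: set_integrable_def)
  have ind: "indicator {0<..} (- y) = (indicator {..<0} y :: real)" for y :: real
    by (simp add: indicator_def)
  have 2: "integrable lborel (\<lambda>y. indicator {..<0} y * f y)"
    using lborel_integrable_real_affine[OF 1, of "-1" 0] by (simp add: even ind)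
  have 3: "(LBINT y. indicator {..<0} y * f y) = (LBINT y. indicator {0<..} y * f y)"
    using lborel_integral_real_affine[of "-1" "\<lambda>y. indicator {0<..} y * f y" 0] by (simp add: even ind)
  have ae: "AE y in lborel. indicator {0<..} y * f y + indicator {..<0} y * f y = f y"
    using AE_lborel_singleton[of 0] by eventually_elim (auto simp: indicator_def)
  have sum: "integrable lborel (\<lambda>y. indicator {0<..} y * f y + indicator {..<0} y * f y)"
    by (intro Bochner_Integration.integrable_add 1 2)
  show "integrable lborel f"
    using sum by (rule integrable_cong_AE_imp) (use ae in auto)
  have "(LBINT y. f y) = (LBINT y. indicator {0<..} y * f y + indicator {..<0} y * f y)"
    by (rule integral_cong_AE) (use ae in auto)
  also have "\<dots> = 2 * (LBINT y:{0<..}. f y)"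
    using 1 2 3 by (simp add: set_lebesgue_integral_def)
  finally show "(LBINT y. f y) = 2 * (LBINT y:{0<..}. f y)" .
qed

lemma has_real_derivative_bound:
  assumes "\<And>x. (f has_real_derivative f' x) (at x)" and "\<And>x. \<bar>f' x\<bar> \<le> B"
  shows "\<bar>f x - f y\<bar> \<le> B * \<bar>x - y\<bar>"
  using field_differentiable_bound[of UNIV f f' B y x] assms by (simp add: abs_minus_commute)

text \<open>The mean value inequality is used twice, for the derivative and then for the remainder,
  which gives \<open>B\<close> in place of the sharp \<open>B / 2\<close>.\<close>

lemma first_order_remainder:
  fixes f :: "real \<Rightarrow> real"
  assumes f: "\<And>x. (f has_real_derivative f' x) (at x)" "\<And>x. (f' has_real_derivative f'' x) (at x)"
    and B: "\<And>x. \<bar>f'' x\<bar> \<le> B"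
  shows "\<bar>f (x + h) - f x - h * f' x\<bar> \<le> B * h\<^sup>2"
proof -
  define g where "g z = f (x + z) - z * f' x" for z
  have "0 \<le> B" using B[of 0] by linarith
  have "\<bar>g h - g 0\<bar> \<le> (B * \<bar>h\<bar>) * \<bar>h - 0\<bar>"
    unfolding real_norm_def[symmetric]
  proof (rule field_differentiable_bound[of "cball 0 \<bar>h\<bar>"])
    fix z :: real assume z: "z \<in> cball 0 \<bar>h\<bar>"
    have "((\<lambda>z. f (x + z)) has_real_derivative f' (x + z) * 1) (at z)"
      by (rule DERIV_chain2[OF f(1)]) (auto intro!: derivative_eq_intros)
    then have "(g has_field_derivative (f' (x + z) * 1 - 1 * f' x)) (at z)"
      unfolding g_def by (rule DERIV_diff[OF _ DERIV_cmult_right[OF DERIV_ident]])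
    then show "(g has_field_derivative (f' (x + z) - f' x)) (at z within cball 0 \<bar>h\<bar>)"
      by (simp add: has_field_derivative_at_within)
    have "\<bar>f' (x + z) - f' x\<bar> \<le> B * \<bar>x + z - x\<bar>"
      by (rule has_real_derivative_bound[OF f(2) B])
    also have "\<dots> \<le> B * \<bar>h\<bar>" using z \<open>0 \<le> B\<close> by (intro mult_left_mono) (auto simp: dist_real_def)
    finally show "norm (f' (x + z) - f' x) \<le> B * norm h" by simp
  qed (auto simp: dist_real_def)
  moreover have "g h - g 0 = f (x + h) - f x - h * f' x" by (simp add: g_def)
  moreover have "(B * \<bar>h\<bar>) * \<bar>h - 0\<bar> = B * h\<^sup>2" by (simp add: power2_eq_square)
  ultimately show ?thesis by argo
qed

text \<open>The minimum matches the two regimes of the Levy density: \<open>4 * A\<close> bounds the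
  difference for large \<open>y\<close>, and the remainders at \<open>y\<close> and
  \<open>- y\<close>, whose first-order terms cancel, give \<open>2 * B * y\<^sup>2\<close> near the
  origin.\<close>

lemma second_difference_bound:
  fixes f :: "real \<Rightarrow> real"
  assumes f: "\<And>x. (f has_real_derivative f' x) (at x)" "\<And>x. (f' has_real_derivative f'' x) (at x)"
    and A: "\<And>x. \<bar>f x\<bar> \<le> A" and B: "\<And>x. \<bar>f'' x\<bar> \<le> B"
  shows "\<bar>f (x + y) + f (x - y) - 2 * f x\<bar> \<le> (4 * A + 2 * B) * min 1 (y\<^sup>2)"
proof -
  have AB: "0 \<le> A" "0 \<le> B" using A[of 0] B[of 0] by linarith+
  have "\<bar>f (x + y) + f (x - y) - 2 * f x\<bar> \<le> 4 * A"
    using A[of "x + y"] A[of "x - y"] A[of x] by linarith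
  moreover have "\<bar>f (x + y) + f (x - y) - 2 * f x\<bar> \<le> 2 * B * y\<^sup>2"
    using first_order_remainder[OF f B, of x y] first_order_remainder[OF f B, of x "- y"] by simp
  moreover have "0 \<le> 4 * (A * y\<^sup>2)" using AB by simp
  moreover have "(4 * A + 2 * B) * y\<^sup>2 = 4 * (A * y\<^sup>2) + 2 * B * y\<^sup>2" by (simp add: algebra_simps)
  ultimately have "\<bar>f (x + y) + f (x - y) - 2 * f x\<bar> \<le> (4 * A + 2 * B) * y\<^sup>2"
    "\<bar>f (x + y) + f (x - y) - 2 * f x\<bar> \<le> 4 * A + 2 * B"
    using AB by linarith+
  then show ?thesis by (auto simp: min_def)
qed

section \<open>Translation invariant operators on smooth bounded functions\<close>

lemma Cb_infty_linear:
  assumes "f \<in> Cb_infty U" "g \<in> Cb_infty U"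
  shows "(\<lambda>x. a * f x + b * g x) \<in> Cb_infty U"
  using assms unfolding Cb_infty_def
  by (auto intro!: Cb_upto_add Cb_upto_mult)

lemma Cb_infty_translate:
  assumes "f \<in> Cb_infty (UNIV :: real set)"
  shows "(\<lambda>x. f (x + a)) \<in> Cb_infty UNIV"
proof (rule Cb_infty_real_coinduct[where F = "{\<lambda>x. f (x + a) | f. f \<in> Cb_infty UNIV}"])
  show "(\<lambda>x. f (x + a)) \<in> {\<lambda>x. f (x + a) | f. f \<in> Cb_infty UNIV}" using assms by blast
  fix g assume "g \<in> {\<lambda>x. f (x + a) | f. f \<in> Cb_infty UNIV}"
  then obtain f where g: "g = (\<lambda>x. f (x + a))" and f: "f \<in> Cb_infty UNIV" by blast
  obtain M where "\<And>x. \<bar>f x\<bar> \<le> M" using Cb_infty_bound[OF f] by blast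
  then have "bounded (range g)" unfolding g by (intro boundedI[of _ M]) auto
  moreover have "(g has_real_derivative deriv f (x + a)) (at x)" for x
    unfolding g DERIV_shift[symmetric] by (rule Cb_infty_derivD(1)[OF f])
  ultimately show "bounded (range g) \<and> (\<exists>f'\<in>{\<lambda>x. f (x + a) | f. f \<in> Cb_infty UNIV}. \<forall>x. (g has_real_derivative f' x) (at x))"
    using Cb_infty_derivD(2)[OF f] by (intro conjI bexI[of _ "\<lambda>x. deriv f (x + a)"]) auto
qed

lemma Cb_infty_deriv2_bound:
  assumes "f \<in> Cb_infty UNIV"
  obtains B where "\<And>x. \<bar>f x\<bar> \<le> B" "\<And>x. \<bar>deriv (deriv f) x\<bar> \<le> B"
proof -
  obtain A where A: "\<And>x. \<bar>f x\<bar> \<le> A" using Cb_infty_bound[OF assms] by blast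
  obtain B where B: "\<And>x. \<bar>deriv (deriv f) x\<bar> \<le> B"
    using Cb_infty_bound[OF Cb_infty_derivD(2)[OF Cb_infty_derivD(2)[OF assms]]] by blast
  show ?thesis by (rule that[of "max A B"]) (use A B in \<open>auto simp: le_max_iff_disj\<close>)
qed

text \<open>A translation invariant operator that is bounded from \<open>C\<^sup>2\<close> to \<open>C\<^sup>0\<close> commutes with differentiation,
  since it may be applied to the difference quotients.\<close>

lemma translation_invariant_operator_deriv:
  fixes Op :: "(real \<Rightarrow> real) \<Rightarrow> real \<Rightarrow> real"
  assumes lin: "\<And>f g a b x. f \<in> Cb_infty UNIV \<Longrightarrow> g \<in> Cb_infty UNIV \<Longrightarrow>
      Op (\<lambda>x. a * f x + b * g x) x = a * Op f x + b * Op g x"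
    and trans: "\<And>f a x. Op (\<lambda>x. f (x + a)) x = Op f (x + a)"
    and bound: "\<And>f B x. f \<in> Cb_infty UNIV \<Longrightarrow> (\<And>x. \<bar>f x\<bar> \<le> B) \<Longrightarrow> (\<And>x. \<bar>deriv (deriv f) x\<bar> \<le> B) \<Longrightarrow> \<bar>Op f x\<bar> \<le> K * B"
    and f: "f \<in> Cb_infty UNIV"
  shows "(Op f has_real_derivative Op (deriv f) x) (at x)"
proof -
  note f1 = Cb_infty_derivD(2)[OF f]
  note f2 = Cb_infty_derivD(2)[OF f1]
  note f3 = Cb_infty_derivD(2)[OF f2]
  note d0 = Cb_infty_derivD(1)[OF f] and d1 = Cb_infty_derivD(1)[OF f1]
    and d2 = Cb_infty_derivD(1)[OF f2] and d3 = Cb_infty_derivD(1)[OF f3]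
  obtain B where B: "\<And>x. \<bar>deriv (deriv f) x\<bar> \<le> B" "\<And>x. \<bar>deriv (deriv (deriv (deriv f))) x\<bar> \<le> B"
    using Cb_infty_deriv2_bound[OF f2] by blast
  have K: "0 \<le> K"
    using bound[of "\<lambda>x. 0" 1 0] by (force simp: Cb_infty_def)
  have est: "\<bar>(Op f (x + h) - Op f x) / h - Op (deriv f) x\<bar> \<le> K * (B * \<bar>h\<bar>)" if h: "h \<noteq> 0" for h
  proof -
    \<comment> \<open>\<open>q g\<close> is the difference quotient minus the derivative. It
      commutes with differentiation, so the second derivative of \<open>q f\<close> is
      \<open>q\<close> of the second derivative of \<open>f\<close>; the fourth derivative of
      \<open>f\<close> makes it of order \<open>\<bar>h\<bar>\<close> as well, and
      \<open>bound\<close> applies.\<close>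
    define q where "q g z = (1 / h) * g (z + h) + (-1) * ((1 / h) * g z + 1 * deriv g z)" for g z
    have fh: "(\<lambda>z. f (z + h)) \<in> Cb_infty UNIV" by (rule Cb_infty_translate[OF f])
    have q: "q f \<in> Cb_infty UNIV"
      unfolding q_def by (intro Cb_infty_linear fh f f1)
    have quot: "\<bar>q g z\<bar> \<le> B * \<bar>h\<bar>"
      if "\<And>z. (g has_real_derivative deriv g z) (at z)" "\<And>z. (deriv g has_real_derivative deriv (deriv g) z) (at z)"
        "\<And>z. \<bar>deriv (deriv g) z\<bar> \<le> B" for g z
    proof -
      have "\<bar>g (z + h) - g z - h * deriv g z\<bar> / \<bar>h\<bar> \<le> B * h\<^sup>2 / \<bar>h\<bar>"
        by (intro divide_right_mono first_order_remainder[of g "deriv g" "deriv (deriv g)"] that) auto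
      also have "B * h\<^sup>2 / \<bar>h\<bar> = B * \<bar>h\<bar>"
        using h by (simp add: power2_eq_square abs_if)
      also have "\<bar>g (z + h) - g z - h * deriv g z\<bar> / \<bar>h\<bar> = \<bar>q g z\<bar>"
        unfolding abs_divide[symmetric] q_def using h by (intro arg_cong[of _ _ abs]) (simp add: field_simps)
      finally show ?thesis .
    qed
    have dq: "(q g has_real_derivative q (deriv g) z) (at z)" if "g \<in> Cb_infty UNIV" for g z
    proof -
      note g = Cb_infty_derivD(1)[OF that] Cb_infty_derivD(1)[OF Cb_infty_derivD(2)[OF that]]
      have "((\<lambda>z. g (z + h)) has_real_derivative deriv g (z + h)) (at z)"
        unfolding DERIV_shift[symmetric] by (rule g(1))
      then show ?thesis unfolding q_def by (intro DERIV_add DERIV_cmult g)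
    qed
    have "deriv (q f) = q (deriv f)" "deriv (q (deriv f)) = q (deriv (deriv f))"
      using DERIV_imp_deriv[OF dq[OF f]] DERIV_imp_deriv[OF dq[OF f1]] by auto
    then have "\<bar>deriv (deriv (q f)) z\<bar> \<le> B * \<bar>h\<bar>" for z
      using quot[OF d2 d3 B(2)] by simp
    from bound[OF q quot[OF d0 d1 B(1)] this]
    have "\<bar>Op (q f) x\<bar> \<le> K * (B * \<bar>h\<bar>)" by blast
    also have "Op (q f) x = (1 / h) * Op (\<lambda>z. f (z + h)) x + (-1) * Op (\<lambda>z. (1 / h) * f z + 1 * deriv f z) x"
      unfolding q_def by (intro lin fh Cb_infty_linear f f1)
    also have "Op (\<lambda>z. (1 / h) * f z + 1 * deriv f z) x = (1 / h) * Op f x + 1 * Op (deriv f) x"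
      by (intro lin f f1)
    also have "(1 / h) * Op (\<lambda>z. f (z + h)) x + (-1) * ((1 / h) * Op f x + 1 * Op (deriv f) x)
        = (Op f (x + h) - Op f x) / h - Op (deriv f) x"
      unfolding trans by (simp add: diff_divide_distrib)
    finally show ?thesis .
  qed
  have "((\<lambda>h. (Op f (x + h) - Op f x) / h - Op (deriv f) x) \<longlongrightarrow> 0) (at 0)"
  proof (rule Lim_null_comparison)
    show "\<forall>\<^sub>F h in at 0. norm ((Op f (x + h) - Op f x) / h - Op (deriv f) x) \<le> K * (B * \<bar>h\<bar>)"
      using est by (auto simp: eventually_at_filter)
    show "((\<lambda>h. K * (B * \<bar>h\<bar>)) \<longlongrightarrow> 0) (at 0)"
      by (auto intro!: tendsto_eq_intros)
  qed
  then show ?thesis by (simp add: DERIV_def LIM_zero_iff)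
qed

text \<open>The image of \<open>Cb_infty UNIV\<close> under \<open>Op\<close> is closed under
  differentiation, because the derivative of \<open>Op f\<close> is \<open>Op (deriv f)\<close>;
  this is what the coinduction asks for.\<close>

lemma translation_invariant_operator_Cb_infty:
  fixes Op :: "(real \<Rightarrow> real) \<Rightarrow> real \<Rightarrow> real"
  assumes lin: "\<And>f g a b x. f \<in> Cb_infty UNIV \<Longrightarrow> g \<in> Cb_infty UNIV \<Longrightarrow>
      Op (\<lambda>x. a * f x + b * g x) x = a * Op f x + b * Op g x"
    and trans: "\<And>f a x. Op (\<lambda>x. f (x + a)) x = Op f (x + a)"
    and bound: "\<And>f B x. f \<in> Cb_infty UNIV \<Longrightarrow> (\<And>x. \<bar>f x\<bar> \<le> B) \<Longrightarrow> (\<And>x. \<bar>deriv (deriv f) x\<bar> \<le> B) \<Longrightarrow> \<bar>Op f x\<bar> \<le> K * B"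
    and f: "f \<in> Cb_infty UNIV"
  shows "Op f \<in> Cb_infty UNIV"
proof (rule Cb_infty_real_coinduct[where F = "Op ` Cb_infty UNIV"])
  show "Op f \<in> Op ` Cb_infty UNIV" using f by blast
  fix g assume "g \<in> Op ` Cb_infty UNIV"
  then obtain f where g: "g = Op f" and f: "f \<in> Cb_infty UNIV" by blast
  obtain B where B: "\<And>x. \<bar>f x\<bar> \<le> B" "\<And>x. \<bar>deriv (deriv f) x\<bar> \<le> B"
    using Cb_infty_deriv2_bound[OF f] by blast
  have "bounded (range g)"
    unfolding g by (intro boundedI[of _ "K * B"]) (use bound[OF f B] in auto)
  moreover have "\<forall>x. (g has_real_derivative Op (deriv f) x) (at x)"
    unfolding g using translation_invariant_operator_deriv[of Op, OF lin trans bound f] by blast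
  ultimately show "bounded (range g) \<and> (\<exists>f'\<in>Op ` Cb_infty UNIV. \<forall>x. (g has_real_derivative f' x) (at x))"
    using Cb_infty_derivD(2)[OF f] by blast
qed

section \<open>The Levy density, its capped truncations and the fractional Laplacian\<close>

locale fractional =
  fixes s :: real
  assumes s_pos: "0 < s" and s_less: "s < 1"
begin

definition \<nu> :: "real \<Rightarrow> real" where
  "\<nu> y = C_const s * \<bar>y\<bar> powr - (1 + 2 * s)"

text \<open>The density is capped at its value at \<open>1 / Suc n\<close>, so that it becomes
  integrable and stays even and nonincreasing; deleting a neighbourhood of the origin would destroy
  the monotonicity.\<close>

definition \<kappa> :: "nat \<Rightarrow> real \<Rightarrow> real" where
  "\<kappa> n y = C_const s * max \<bar>y\<bar> (1 / Suc n) powr - (1 + 2 * s)"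

text \<open>The negative of the one-dimensional operator of order \<open>2 * s\<close>, taken over
  the whole line with a compensating factor 1/2. The symmetric second difference makes the integral
  absolutely convergent and matches the symmetrised form of the jump generators.\<close>

definition lap :: "(real \<Rightarrow> real) \<Rightarrow> real \<Rightarrow> real" where
  "lap f x = (LBINT y. (f (x + y) + f (x - y) - 2 * f x) / 2 * \<nu> y)"

text \<open>The truncation error measured on functions with second differences of size
  \<open>min 1 (y\<^sup>2)\<close>; it bounds the difference of \<open>K.gen n\<close> and
  \<open>lap\<close> uniformly in space.\<close>

definition err :: "nat \<Rightarrow> real" where
  "err n = (LBINT y. min 1 (y\<^sup>2) * (\<nu> y - \<kappa> n y))"

lemma C_pos: "0 < C_const s"
  using s_pos s_less by (auto simp: C_const_def intro!: divide_pos_pos mult_pos_pos Gamma_real_pos)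

lemma \<nu>_nonneg: "0 \<le> \<nu> y" and \<kappa>_nonneg: "0 \<le> \<kappa> n y"
  unfolding \<nu>_def \<kappa>_def using C_pos by (intro mult_nonneg_nonneg powr_ge_zero, simp)+

lemma \<nu>_measurable [measurable]: "\<nu> \<in> borel_measurable borel"
  and \<kappa>_measurable [measurable]: "\<kappa> n \<in> borel_measurable borel"
  unfolding \<nu>_def[abs_def] \<kappa>_def[abs_def] by measurable

text \<open>The origin has to be excluded: \<open>0 powr\<close> is \<open>0\<close>, so
  \<open>\<nu> 0 = 0\<close>, while the capped kernel is positive there.\<close>

lemma \<kappa>_le_\<nu>: "y \<noteq> 0 \<Longrightarrow> \<kappa> n y \<le> \<nu> y"
  unfolding \<nu>_def \<kappa>_def using C_pos s_pos by (intro mult_left_mono powr_mono2') auto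

lemma \<kappa>_eventually: "y \<noteq> 0 \<Longrightarrow> \<forall>\<^sub>F n in sequentially. \<kappa> n y = \<nu> y"
proof -
  assume "y \<noteq> 0"
  then have "\<forall>\<^sub>F n in sequentially. 1 / real (Suc n) < \<bar>y\<bar>"
    by (intro order_tendstoD(2)[OF LIMSEQ_Suc[OF lim_1_over_n[where 'a = real]]]) simp
  then show ?thesis by eventually_elim (auto simp: \<nu>_def \<kappa>_def max_def)
qed

lemma \<kappa>_tendsto: "y \<noteq> 0 \<Longrightarrow> (\<lambda>n. \<kappa> n y) \<longlonglongrightarrow> \<nu> y"
  by (rule tendsto_eventually) (rule \<kappa>_eventually)

lemma min_\<nu>_nonneg: "0 \<le> min 1 (y\<^sup>2) * \<nu> y"
  by (intro mult_nonneg_nonneg \<nu>_nonneg) simp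

text \<open>The integral is split at \<open>1\<close>: the inner power \<open>1 - 2 * s\<close>
  exceeds \<open>-1\<close> because \<open>s < 1\<close>, and the outer power is below
  \<open>-1\<close> because \<open>0 < s\<close>.\<close>

lemma levy_integrable: "integrable lborel (\<lambda>y. min 1 (y\<^sup>2) * \<nu> y)"
proof (rule integrable_even(1))
  let ?f = "\<lambda>y. min 1 (y\<^sup>2) * \<nu> y"
  show fm: "?f \<in> borel_measurable borel" by measurable
  have "(\<lambda>y. y powr (1 - 2 * s)) integrable_on {0<..1}"
    by (rule integrable_on_powr_from_0') (use s_less in auto)
  then have "(\<lambda>y. C_const s * y powr (1 - 2 * s)) integrable_on {0<..1}"
    by (rule integrable_on_mult_right)
  then have "?f integrable_on {0<..1}"
  proof (rule integrable_eq)
    fix y :: real assume y: "y \<in> {0<..1}"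
    then have "y powr (1 - 2 * s) = y\<^sup>2 * y powr - (1 + 2 * s)" "y\<^sup>2 \<le> 1"
      using powr_add[of y 2 "- (1 + 2 * s)"] by (auto simp: power_le_one)
    then show "C_const s * y powr (1 - 2 * s) = min 1 (y\<^sup>2) * \<nu> y"
      using y by (simp add: \<nu>_def min_absorb2)
  qed
  then have 1: "set_integrable lborel {0<..1} ?f"
    by (rule set_integrable_lborel_nonneg[OF _ min_\<nu>_nonneg _ fm]) simp
  have "(\<lambda>y. y powr (- (1 + 2 * s))) integrable_on {1..}"
    using has_integral_powr_to_inf[of "- (1 + 2 * s)" 1] s_pos unfolding integrable_on_def by (intro exI) simp
  then have "(\<lambda>y. C_const s * y powr (- (1 + 2 * s))) integrable_on {1..}"
    by (rule integrable_on_mult_right)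
  then have "?f integrable_on {1..}"
  proof (rule integrable_eq)
    fix y :: real assume y: "y \<in> {1..}"
    then have "1 \<le> y\<^sup>2" by simp
    then show "C_const s * y powr - (1 + 2 * s) = min 1 (y\<^sup>2) * \<nu> y"
      using y by (simp add: \<nu>_def)
  qed
  then have 2: "set_integrable lborel {1..} ?f"
    by (rule set_integrable_lborel_nonneg[OF _ min_\<nu>_nonneg _ fm]) simp
  have "{0<..} = {0<..1} \<union> {1::real..}" by auto
  then show "set_integrable lborel {0<..} ?f"
    by (rule ssubst) (rule set_integrable_Un[OF 1 2], simp, simp)
qed (simp add: \<nu>_def)

text \<open>Outside the cap, \<open>N\<^sup>2 * min 1 (y\<^sup>2)\<close> is at least
  \<open>1\<close>, so a multiple of the Levy integrand dominates; on the cap the kernel is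
  constant.\<close>

lemma \<kappa>_integrable: "integrable lborel (\<kappa> n)"
proof (rule Bochner_Integration.integrable_bound)
  define N where "N = real (Suc n)"
  have N: "1 \<le> N" by (simp add: N_def)
  show "integrable lborel (\<lambda>y. N\<^sup>2 * (min 1 (y\<^sup>2) * \<nu> y) + indicator {-1..1} y * \<kappa> n 0)"
    by (intro Bochner_Integration.integrable_add integrable_mult_right levy_integrable)
      (auto intro!: integrable_real_mult_indicator simp: mult.commute)
  show "AE y in lborel. norm (\<kappa> n y) \<le> norm (N\<^sup>2 * (min 1 (y\<^sup>2) * \<nu> y) + indicator {-1..1} y * \<kappa> n 0)"
  proof (rule AE_I2)
    fix y :: real
    have nn: "0 \<le> min 1 (y\<^sup>2) * \<nu> y" by (simp add: \<nu>_nonneg)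
    show "norm (\<kappa> n y) \<le> norm (N\<^sup>2 * (min 1 (y\<^sup>2) * \<nu> y) + indicator {-1..1} y * \<kappa> n 0)"
    proof (cases "\<bar>y\<bar> \<le> 1 / N")
      case True
      moreover have "1 / N \<le> 1" using N by simp
      ultimately have "y \<in> {-1..1}" by auto
      moreover have "\<kappa> n y = \<kappa> n 0" using True by (simp add: \<kappa>_def max_absorb2 N_def)
      ultimately show ?thesis using nn \<kappa>_nonneg[of n y] by simp
    next
      case False
      then have y: "1 / N < \<bar>y\<bar>" by simp
      have "1 \<le> N\<^sup>2 * min 1 (y\<^sup>2)"
      proof -
        have "1 \<le> N\<^sup>2" using N by simp
        moreover have "1 \<le> (N * \<bar>y\<bar>)\<^sup>2" using y N by (intro one_le_power) (simp add: field_simps)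
        ultimately show ?thesis by (simp add: min_def power_mult_distrib)
      qed
      then have "1 * \<nu> y \<le> N\<^sup>2 * min 1 (y\<^sup>2) * \<nu> y" by (intro mult_right_mono \<nu>_nonneg)
      moreover have "\<kappa> n y \<le> \<nu> y" using y N by (intro \<kappa>_le_\<nu>) auto
      moreover have "0 \<le> indicator {-1..1} y * \<kappa> n 0" using \<kappa>_nonneg[of n 0] by simp
      ultimately show ?thesis using \<kappa>_nonneg[of n y] by (simp add: mult.assoc)
    qed
  qed
qed simp

sublocale K: jump_kernel "\<kappa> n" for n
  by unfold_locales (auto simp: \<kappa>_nonneg \<kappa>_integrable, simp add: \<kappa>_def)

lemma \<kappa>_radially_nonincreasing: "radially_nonincreasing (\<kappa> n)"
  unfolding radially_nonincreasing_def \<kappa>_def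
  using C_pos s_pos by (auto intro!: mult_left_mono powr_mono2' simp: max_def)

lemma min_\<kappa>_integrable: "integrable lborel (\<lambda>y. min 1 (y\<^sup>2) * \<kappa> n y)"
  by (rule integrable_mult_bounded[OF \<kappa>_integrable, where M = 1]) auto

lemma err_tendsto: "err \<longlonglongrightarrow> 0"
proof -
  have "(\<lambda>n. LBINT y. min 1 (y\<^sup>2) * (\<nu> y - \<kappa> n y)) \<longlonglongrightarrow> (LBINT (y::real). 0)"
  proof (rule integral_dominated_convergence)
    show "integrable lborel (\<lambda>y. min 1 (y\<^sup>2) * \<nu> y)" by (rule levy_integrable)
    show "AE y in lborel. (\<lambda>n. min 1 (y\<^sup>2) * (\<nu> y - \<kappa> n y)) \<longlonglongrightarrow> 0"
    proof (rule AE_I2)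
      fix y :: real
      show "(\<lambda>n. min 1 (y\<^sup>2) * (\<nu> y - \<kappa> n y)) \<longlonglongrightarrow> 0"
      proof (cases "y = 0")
        case False
        then show ?thesis by (auto intro!: tendsto_eq_intros \<kappa>_tendsto)
      qed simp
    qed
    show "AE y in lborel. norm (min 1 (y\<^sup>2) * (\<nu> y - \<kappa> n y)) \<le> min 1 (y\<^sup>2) * \<nu> y" for n
    proof (rule AE_I2)
      fix y :: real
      show "norm (min 1 (y\<^sup>2) * (\<nu> y - \<kappa> n y)) \<le> min 1 (y\<^sup>2) * \<nu> y"
        using \<kappa>_le_\<nu>[of y n] \<kappa>_nonneg[of n y] \<nu>_nonneg[of y]
        by (cases "y = 0") (auto simp: abs_mult intro!: mult_left_mono)
    qed
  qed auto
  then show ?thesis by (simp add: err_def[abs_def])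
qed

lemma err_nonneg: "0 \<le> err n"
  unfolding err_def
proof (rule Bochner_Integration.integral_nonneg)
  show "0 \<le> min 1 (y\<^sup>2) * (\<nu> y - \<kappa> n y)" for y
    using \<kappa>_le_\<nu>[of y n] by (cases "y = 0") auto
qed

lemma lap_integrable:
  assumes [measurable]: "f \<in> borel_measurable borel"
    and K: "\<And>y. \<bar>f (x + y) + f (x - y) - 2 * f x\<bar> \<le> K * min 1 (y\<^sup>2)"
  shows "integrable lborel (\<lambda>y. (f (x + y) + f (x - y) - 2 * f x) / 2 * \<nu> y)"
proof (rule Bochner_Integration.integrable_bound)
  show "integrable lborel (\<lambda>y. K * (min 1 (y\<^sup>2) * \<nu> y))" using levy_integrable by simp
  show "AE y in lborel. norm ((f (x + y) + f (x - y) - 2 * f x) / 2 * \<nu> y) \<le> norm (K * (min 1 (y\<^sup>2) * \<nu> y))"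
  proof (rule AE_I2)
    fix y
    have "\<bar>f (x + y) + f (x - y) - 2 * f x\<bar> / 2 \<le> \<bar>K * min 1 (y\<^sup>2)\<bar>"
      using K[of y] abs_ge_self[of "K * min 1 (y\<^sup>2)"] by simp
    then show "norm ((f (x + y) + f (x - y) - 2 * f x) / 2 * \<nu> y) \<le> norm (K * (min 1 (y\<^sup>2) * \<nu> y))"
      unfolding mult.assoc[symmetric] real_norm_def abs_mult[of _ "\<nu> y"]
      by (intro mult_right_mono) simp_all
  qed
qed measurable

text \<open>Evenness of the kernel symmetrises the jump integral and brings the generator to the
  form of \<open>lap\<close>, with \<open>\<kappa> n\<close> in place of
  \<open>\<nu>\<close>.\<close>

lemma gen_eq:
  assumes f[measurable]: "f \<in> borel_measurable borel" and M: "\<And>x. \<bar>f x\<bar> \<le> M"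
  shows "K.gen n f x = (LBINT y. (f (x + y) + f (x - y) - 2 * f x) / 2 * \<kappa> n y)"
proof -
  have p: "integrable lborel (\<lambda>y. \<kappa> n y * f (x + y))" by (rule K.jump_integrable[OF f M])
  have m: "integrable lborel (\<lambda>y. \<kappa> n y * f (x - y))"
    using lborel_integrable_real_affine[OF p, of "-1" 0] by (simp add: K.k_even)
  have eq: "(LBINT y. \<kappa> n y * f (x - y)) = (LBINT y. \<kappa> n y * f (x + y))"
    using lborel_integral_real_affine[of "-1" "\<lambda>y. \<kappa> n y * f (x + y)" 0] by (simp add: K.k_even)
  have "(LBINT y. (f (x + y) + f (x - y) - 2 * f x) / 2 * \<kappa> n y)
     = (LBINT y. (1 / 2) * (\<kappa> n y * f (x + y)) + (1 / 2) * (\<kappa> n y * f (x - y)) - f x * \<kappa> n y)"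
    by (intro Bochner_Integration.integral_cong refl) (simp add: field_simps)
  also have "\<dots> = (1 / 2) * (LBINT y. \<kappa> n y * f (x + y)) + (1 / 2) * (LBINT y. \<kappa> n y * f (x - y)) - f x * (LBINT y. \<kappa> n y)"
    using p m \<kappa>_integrable[of n] by simp
  also have "\<dots> = K.gen n f x"
    unfolding eq by (simp add: K.gen_def K.jump_def K.mass_def)
  finally show ?thesis by simp
qed

lemma gen_lap_diff:
  assumes f[measurable]: "f \<in> borel_measurable borel" and M: "\<And>x. \<bar>f x\<bar> \<le> M"
    and K: "\<And>y. \<bar>f (x + y) + f (x - y) - 2 * f x\<bar> \<le> K * min 1 (y\<^sup>2)"
  shows "\<bar>K.gen n f x - lap f x\<bar> \<le> K * err n"
proof -
  define d where "d y = (f (x + y) + f (x - y) - 2 * f x) / 2" for y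
  have i1: "integrable lborel (\<lambda>y. d y * \<nu> y)"
    unfolding d_def by (rule lap_integrable[OF f K])
  have [measurable]: "d \<in> borel_measurable borel" unfolding d_def by measurable
  have i2: "integrable lborel (\<lambda>y. d y * \<kappa> n y)"
  proof (rule integrable_mult_bounded[OF \<kappa>_integrable, where M = "2 * M"])
    show "\<bar>d y\<bar> \<le> 2 * M" for y
    proof -
      have "\<bar>f (x + y) + f (x - y) - 2 * f x\<bar> \<le> 4 * M"
        using M[of "x + y"] M[of "x - y"] M[of x] by linarith
      then show ?thesis by (simp add: d_def)
    qed
  qed measurable
  have i3: "integrable lborel (\<lambda>y. K * (min 1 (y\<^sup>2) * (\<nu> y - \<kappa> n y)))"
    using levy_integrable min_\<kappa>_integrable by (simp add: right_diff_distrib)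
  have "\<bar>K.gen n f x - lap f x\<bar> = \<bar>LBINT y. d y * \<kappa> n y - d y * \<nu> y\<bar>"
    unfolding gen_eq[OF f M] lap_def d_def[symmetric] using i1 i2 by simp
  also have "\<dots> \<le> (LBINT y. K * (min 1 (y\<^sup>2) * (\<nu> y - \<kappa> n y)))"
  proof (rule integral_abs_bound_integral[OF Bochner_Integration.integrable_diff[OF i2 i1] i3])
    fix y :: real
    have dK: "\<bar>d y\<bar> \<le> K * min 1 (y\<^sup>2)" using K[of y] unfolding d_def by simp
    show "\<bar>d y * \<kappa> n y - d y * \<nu> y\<bar> \<le> K * (min 1 (y\<^sup>2) * (\<nu> y - \<kappa> n y))"
    \<comment> \<open>At the origin, where \<open>\<kappa> n\<close> exceeds \<open>\<nu>\<close>,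
      both sides vanish because the second difference and \<open>min 1 (y\<^sup>2)\<close>
      do.\<close>
    proof (cases "y = 0")
      case False
      have "\<bar>d y * \<kappa> n y - d y * \<nu> y\<bar> = \<bar>d y\<bar> * (\<nu> y - \<kappa> n y)"
        using \<kappa>_le_\<nu>[OF False, of n] by (simp add: abs_mult right_diff_distrib[symmetric])
      also have "\<dots> \<le> (K * min 1 (y\<^sup>2)) * (\<nu> y - \<kappa> n y)"
        using \<kappa>_le_\<nu>[OF False, of n] by (intro mult_right_mono dK) auto
      finally show ?thesis by (simp add: mult.assoc)
    qed (use dK in simp)
  qed
  also have "\<dots> = K * err n" by (simp add: err_def)
  finally show ?thesis .
qed

end

section \<open>The limit semigroup\<close>

lemma (in jump_kernel) gen_linear:
  assumes f: "f \<in> borel_measurable borel" "\<And>x. \<bar>f x\<bar> \<le> M" and g: "g \<in> borel_measurable borel" "\<And>x. \<bar>g x\<bar> \<le> N"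
  shows "gen (\<lambda>x. a * f x + b * g x) x = a * gen f x + b * gen g x"
  unfolding gen_def jump_linear[OF f g] by (simp add: algebra_simps)

lemma (in jump_kernel) gen_translate: "gen (\<lambda>x. f (x + a)) x = gen f (x + a)"
  by (simp add: gen_def jump_def add_ac)

context fractional
begin

lemma Cb_infty_second_difference:
  assumes "f \<in> Cb_infty UNIV"
  obtains K where "0 \<le> K" "\<And>x y. \<bar>f (x + y) + f (x - y) - 2 * f x\<bar> \<le> K * min 1 (y\<^sup>2)"
proof -
  obtain B where B: "\<And>x. \<bar>f x\<bar> \<le> B" "\<And>x. \<bar>deriv (deriv f) x\<bar> \<le> B"
    using Cb_infty_deriv2_bound[OF assms] by blast
  have "0 \<le> B" using B(1)[of 0] by linarith
  then show ?thesis
    by (intro that[of "4 * B + 2 * B"] second_difference_bound[OF Cb_infty_derivD(1)[OF assms]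
          Cb_infty_derivD(1)[OF Cb_infty_derivD(2)[OF assms]] B]) simp
qed

definition levy_mass :: real where
  "levy_mass = (LBINT y. min 1 (y\<^sup>2) * \<nu> y)"

lemma lap_bound:
  assumes "f \<in> borel_measurable borel" and K: "\<And>y. \<bar>f (x + y) + f (x - y) - 2 * f x\<bar> \<le> K * min 1 (y\<^sup>2)"
  shows "\<bar>lap f x\<bar> \<le> K * levy_mass"
proof -
  have "\<bar>lap f x\<bar> \<le> (LBINT y. K * (min 1 (y\<^sup>2) * \<nu> y))"
    unfolding lap_def
  proof (rule integral_abs_bound_integral[OF lap_integrable[OF assms]])
    show "integrable lborel (\<lambda>y. K * (min 1 (y\<^sup>2) * \<nu> y))" using levy_integrable by simp
    fix y
    have "\<bar>f (x + y) + f (x - y) - 2 * f x\<bar> / 2 \<le> K * min 1 (y\<^sup>2)"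
      by (rule order_trans[OF _ K[of y]]) simp
    then have "\<bar>f (x + y) + f (x - y) - 2 * f x\<bar> / 2 * \<nu> y \<le> K * min 1 (y\<^sup>2) * \<nu> y"
      by (rule mult_right_mono[OF _ \<nu>_nonneg])
    then show "\<bar>(f (x + y) + f (x - y) - 2 * f x) / 2 * \<nu> y\<bar> \<le> K * (min 1 (y\<^sup>2) * \<nu> y)"
      using \<nu>_nonneg[of y] by (simp add: abs_mult mult.assoc)
  qed
  then show ?thesis by (simp add: levy_mass_def)
qed

lemma lap_linear:
  assumes f: "f \<in> Cb_infty UNIV" and g: "g \<in> Cb_infty UNIV"
  shows "lap (\<lambda>x. a * f x + b * g x) x = a * lap f x + b * lap g x"
proof -
  obtain K where K0: "0 \<le> K" and K: "\<And>x y. \<bar>f (x + y) + f (x - y) - 2 * f x\<bar> \<le> K * min 1 (y\<^sup>2)"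
    by (rule Cb_infty_second_difference[OF f]) (rule that; assumption)
  obtain L where L0: "0 \<le> L" and L: "\<And>x y. \<bar>g (x + y) + g (x - y) - 2 * g x\<bar> \<le> L * min 1 (y\<^sup>2)"
    by (rule Cb_infty_second_difference[OF g]) (rule that; assumption)
  note i = lap_integrable[OF Cb_infty_borel[OF f] K, of x] and j = lap_integrable[OF Cb_infty_borel[OF g] L, of x]
  have "lap (\<lambda>x. a * f x + b * g x) x = (LBINT y. a * ((f (x + y) + f (x - y) - 2 * f x) / 2 * \<nu> y)
      + b * ((g (x + y) + g (x - y) - 2 * g x) / 2 * \<nu> y))"
    unfolding lap_def
  proof (intro Bochner_Integration.integral_cong refl)
    fix y
    have "(a * f (x + y) + b * g (x + y)) + (a * f (x - y) + b * g (x - y)) - 2 * (a * f x + b * g x)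
      = a * (f (x + y) + f (x - y) - 2 * f x) + b * (g (x + y) + g (x - y) - 2 * g x)"
      by (simp only: distrib_left right_diff_distrib)
    then show "((a * f (x + y) + b * g (x + y)) + (a * f (x - y) + b * g (x - y)) - 2 * (a * f x + b * g x)) / 2 * \<nu> y
      = a * ((f (x + y) + f (x - y) - 2 * f x) / 2 * \<nu> y) + b * ((g (x + y) + g (x - y) - 2 * g x) / 2 * \<nu> y)"
      by (simp only: add_divide_distrib distrib_right mult.assoc times_divide_eq_right times_divide_eq_left)
  qed
  also have "\<dots> = a * lap f x + b * lap g x"
    unfolding lap_def Bochner_Integration.integral_add[OF integrable_mult_right[OF i] integrable_mult_right[OF j]]
    by (simp only: integral_mult_right_zero)
  finally show ?thesis .
qed

lemma lap_translate: "lap (\<lambda>x. f (x + a)) x = lap f (x + a)"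
proof -
  have "x + y + a = x + a + y" "x - y + a = x + a - y" for y by simp_all
  then show ?thesis by (simp only: lap_def)
qed

lemma lap_C2_bound:
  assumes f: "f \<in> Cb_infty UNIV" and B: "\<And>x. \<bar>f x\<bar> \<le> B" "\<And>x. \<bar>deriv (deriv f) x\<bar> \<le> B"
  shows "\<bar>lap f x\<bar> \<le> 6 * levy_mass * B"
proof -
  note d = Cb_infty_derivD(1)[OF f] Cb_infty_derivD(1)[OF Cb_infty_derivD(2)[OF f]]
  have "\<bar>f (x + y) + f (x - y) - 2 * f x\<bar> \<le> (4 * B + 2 * B) * min 1 (y\<^sup>2)" for y
    by (rule second_difference_bound[OF d B])
  then have "\<bar>lap f x\<bar> \<le> (4 * B + 2 * B) * levy_mass"
    by (rule lap_bound[OF Cb_infty_borel[OF f]])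
  also have "(4 * B + 2 * B) * levy_mass = 6 * levy_mass * B" by simp
  finally show ?thesis .
qed

lemma lap_Cb_infty:
  assumes "f \<in> Cb_infty UNIV"
  shows "lap f \<in> Cb_infty UNIV"
proof (rule translation_invariant_operator_Cb_infty[where Op = lap and K = "6 * levy_mass", OF _ lap_translate _ assms])
  show "\<bar>lap f x\<bar> \<le> 6 * levy_mass * B"
    if "f \<in> Cb_infty UNIV" "\<And>x. \<bar>f x\<bar> \<le> B" "\<And>x. \<bar>deriv (deriv f) x\<bar> \<le> B" for f B x
    by (rule lap_C2_bound[OF that])
qed (rule lap_linear)

lemma gen_Cb_infty:
  assumes "f \<in> Cb_infty UNIV"
  shows "K.gen n f \<in> Cb_infty UNIV"
proof (rule translation_invariant_operator_Cb_infty[where Op = "K.gen n" and K = "2 * K.mass n", OF _ K.gen_translate _ assms])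
  fix f g :: "real \<Rightarrow> real" and a b x B :: real
  assume f: "f \<in> Cb_infty UNIV"
  {
    assume g: "g \<in> Cb_infty UNIV"
    obtain M N where "\<And>x. \<bar>f x\<bar> \<le> M" "\<And>x. \<bar>g x\<bar> \<le> N" using Cb_infty_bound f g by metis
    then show "K.gen n (\<lambda>x. a * f x + b * g x) x = a * K.gen n f x + b * K.gen n g x"
      by (intro K.gen_linear Cb_infty_borel f g)
  next
    assume "\<And>x. \<bar>f x\<bar> \<le> B"
    then show "\<bar>K.gen n f x\<bar> \<le> 2 * K.mass n * B"
      by (intro K.gen_bound Cb_infty_borel f)
  }
qed

text \<open>The limit is genuine for \<open>f\<close> in \<open>Cb_infty UNIV\<close> and
  \<open>0 <= t\<close>, where the sequence is Cauchy.\<close>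

definition heat :: "real \<Rightarrow> (real \<Rightarrow> real) \<Rightarrow> real \<Rightarrow> real" where
  "heat t f x = lim (\<lambda>n. K.semi n t f x)"

text \<open>Both generators are compared with \<open>lap\<close>, so their errors add; the maximum
  principle carries the bound over to the semigroups.\<close>

lemma semi_diff:
  assumes f: "f \<in> Cb_infty UNIV" and K: "\<And>x y. \<bar>f (x + y) + f (x - y) - 2 * f x\<bar> \<le> K * min 1 (y\<^sup>2)"
    and t: "0 \<le> t"
  shows "\<bar>K.semi n t f x - K.semi m t f x\<bar> \<le> (K * err n + K * err m) * t"
proof -
  obtain M where M: "\<And>x. \<bar>f x\<bar> \<le> M" using Cb_infty_bound[OF f] by blast
  note fm = Cb_infty_borel[OF f]
  show ?thesis
  proof (rule K.semi_diff_le[OF K.jump_kernel_axioms fm M _ t])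
    fix x
    show "\<bar>K.gen n f x - K.gen m f x\<bar> \<le> K * err n + K * err m"
      using gen_lap_diff[OF fm M K, where n = n and x = x] gen_lap_diff[OF fm M K, where n = m and x = x]
      by linarith
  qed
qed

lemma heat_tendsto:
  assumes f: "f \<in> Cb_infty UNIV" and t: "0 \<le> t"
  shows "(\<lambda>n. K.semi n t f x) \<longlonglongrightarrow> heat t f x"
proof -
  obtain K where K0: "0 \<le> K" and K: "\<And>x y. \<bar>f (x + y) + f (x - y) - 2 * f x\<bar> \<le> K * min 1 (y\<^sup>2)"
    by (rule Cb_infty_second_difference[OF f]) (rule that; assumption)
  have "Cauchy (\<lambda>n. K.semi n t f x)"
  proof (rule metric_CauchyI)
    fix e :: real assume e: "0 < e"
    have "(\<lambda>n. K * err n * t) \<longlonglongrightarrow> 0"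
      by (auto intro!: tendsto_eq_intros err_tendsto)
    then have "\<forall>\<^sub>F n in sequentially. K * err n * t < e / 2"
      using e by (intro order_tendstoD(2)) auto
    then obtain N where N: "\<And>n. n \<ge> N \<Longrightarrow> K * err n * t < e / 2"
      unfolding eventually_sequentially by blast
    have "dist (K.semi m t f x) (K.semi n t f x) < e" if "m \<ge> N" "n \<ge> N" for m n
    proof -
      have "\<bar>K.semi m t f x - K.semi n t f x\<bar> \<le> K * err m * t + K * err n * t"
        using semi_diff[OF f K t, of m x n] by (simp add: algebra_simps)
      then show ?thesis using N[OF that(1)] N[OF that(2)] by (simp add: dist_real_def)
    qed
    then show "\<exists>N. \<forall>m\<ge>N. \<forall>n\<ge>N. dist (K.semi m t f x) (K.semi n t f x) < e" by blast
  qed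
  then show ?thesis
    unfolding heat_def by (simp add: Cauchy_convergent_iff convergent_LIMSEQ_iff)
qed

text \<open>Sending one index of the Cauchy estimate to infinity leaves a rate that is uniform in
  \<open>x\<close> and linear in \<open>t\<close>.\<close>

lemma semi_heat_diff:
  assumes f: "f \<in> Cb_infty UNIV" and K: "\<And>x y. \<bar>f (x + y) + f (x - y) - 2 * f x\<bar> \<le> K * min 1 (y\<^sup>2)"
    and t: "0 \<le> t"
  shows "\<bar>K.semi n t f x - heat t f x\<bar> \<le> K * err n * t"
proof (rule LIMSEQ_le)
  show "(\<lambda>m. \<bar>K.semi n t f x - K.semi m t f x\<bar>) \<longlonglongrightarrow> \<bar>K.semi n t f x - heat t f x\<bar>"
    by (intro tendsto_intros heat_tendsto f t)
  show "(\<lambda>m. (K * err n + K * err m) * t) \<longlonglongrightarrow> K * err n * t"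
    by (auto intro!: tendsto_eq_intros err_tendsto)
  show "\<exists>N. \<forall>m\<ge>N. \<bar>K.semi n t f x - K.semi m t f x\<bar> \<le> (K * err n + K * err m) * t"
    using semi_diff[OF f K t] by blast
qed

lemma heat_bound:
  assumes f: "f \<in> Cb_infty UNIV" and t: "0 \<le> t" and M: "\<And>x. \<bar>f x\<bar> \<le> M"
  shows "\<bar>heat t f x\<bar> \<le> M"
proof (rule LIMSEQ_le_const2)
  show "(\<lambda>n. \<bar>K.semi n t f x\<bar>) \<longlonglongrightarrow> \<bar>heat t f x\<bar>"
    by (intro tendsto_intros heat_tendsto f t)
  show "\<exists>N. \<forall>n\<ge>N. \<bar>K.semi n t f x\<bar> \<le> M"
    using K.semi_bound[OF Cb_infty_borel[OF f] M t] by blast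
qed

lemma heat_linear:
  assumes f: "f \<in> Cb_infty UNIV" and g: "g \<in> Cb_infty UNIV" and t: "0 \<le> t"
  shows "heat t (\<lambda>x. a * f x + b * g x) x = a * heat t f x + b * heat t g x"
proof -
  obtain M N where M: "\<And>x. \<bar>f x\<bar> \<le> M" and N: "\<And>x. \<bar>g x\<bar> \<le> N" using Cb_infty_bound f g by metis
  have "(\<lambda>n. a * K.semi n t f x + b * K.semi n t g x) \<longlonglongrightarrow> a * heat t f x + b * heat t g x"
    by (intro tendsto_intros heat_tendsto f g t)
  then have "(\<lambda>n. K.semi n t (\<lambda>x. a * f x + b * g x) x) \<longlonglongrightarrow> a * heat t f x + b * heat t g x"
    by (simp add: K.semi_linear[OF Cb_infty_borel[OF f] M Cb_infty_borel[OF g] N])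
  then show ?thesis
    using heat_tendsto[OF Cb_infty_linear[OF f g] t] LIMSEQ_unique by blast
qed

text \<open>Both sides are \<open>lim\<close> of the same sequence. This form, for arbitrary
  functions, is the one that the results on translation invariant operators ask for.\<close>

lemma heat_translate: "heat t (\<lambda>x. f (x + a)) x = heat t f (x + a)"
  by (simp add: heat_def K.semi_translate)

lemma heat_0: "heat 0 f x = f x"
  by (simp add: heat_def K.semi_0)

lemma heat_radially_nonincreasing:
  assumes f: "f \<in> Cb_infty UNIV" and t: "0 \<le> t" and mono: "radially_nonincreasing f"
  shows "radially_nonincreasing (heat t f)"
  unfolding radially_nonincreasing_def
proof (intro allI impI)
  fix x y :: real assume xy: "norm x \<le> norm y"
  obtain M where M: "\<And>x. \<bar>f x\<bar> \<le> M" using Cb_infty_bound[OF f] by blast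
  have "radially_nonincreasing (K.semi n t f)" for n
    by (rule K.semi_radially_nonincreasing[OF \<kappa>_radially_nonincreasing mono Cb_infty_borel[OF f] M t])
  then have "K.semi n t f y \<le> K.semi n t f x" for n
    using xy unfolding radially_nonincreasing_def by blast
  then show "heat t f y \<le> heat t f x"
    by (intro LIMSEQ_le[OF heat_tendsto[OF f t] heat_tendsto[OF f t]]) blast
qed

lemma
  assumes f: "f \<in> Cb_infty UNIV" and t: "0 \<le> t"
  shows heat_Cb_infty: "heat t f \<in> Cb_infty UNIV"
    and heat_deriv: "(heat t f has_real_derivative heat t (deriv f) x) (at x)"
proof -
  have bound: "\<bar>heat t f x\<bar> \<le> 1 * B"
    if "f \<in> Cb_infty UNIV" "\<And>x. \<bar>f x\<bar> \<le> B" "\<And>x. \<bar>deriv (deriv f) x\<bar> \<le> B" for f B x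
    using heat_bound[OF that(1) t that(2)] by simp
  have lin: "heat t (\<lambda>x. a * f x + b * g x) x = a * heat t f x + b * heat t g x"
    if "f \<in> Cb_infty UNIV" "g \<in> Cb_infty UNIV" for f g a b x
    by (rule heat_linear[OF that t])
  show "heat t f \<in> Cb_infty UNIV"
    by (rule translation_invariant_operator_Cb_infty[where Op = "heat t" and K = 1, OF lin heat_translate bound f])
  show "(heat t f has_real_derivative heat t (deriv f) x) (at x)"
    by (rule translation_invariant_operator_deriv[where Op = "heat t" and K = 1, OF lin heat_translate bound f])
qed

section \<open>Time derivative of the heat flow and commutation with \<open>lap\<close>\<close>

text \<open>Two errors add up: the generator against \<open>lap\<close>, which the contraction
  \<open>K.semi n t\<close> does not enlarge, and the semigroup against its limit, on the smooth
  function \<open>lap f\<close>. The result is convergence of the time derivatives, uniform on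
  bounded time intervals.\<close>

lemma semi_gen_heat_lap_diff:
  assumes f: "f \<in> Cb_infty UNIV" and K: "\<And>x y. \<bar>f (x + y) + f (x - y) - 2 * f x\<bar> \<le> K * min 1 (y\<^sup>2)"
    and L: "\<And>x y. \<bar>lap f (x + y) + lap f (x - y) - 2 * lap f x\<bar> \<le> L * min 1 (y\<^sup>2)"
    and t: "0 \<le> t"
  shows "\<bar>K.semi n t (K.gen n f) x - heat t (lap f) x\<bar> \<le> (K + L * t) * err n"
proof -
  note lf = lap_Cb_infty[OF f]
  obtain M where M: "\<And>x. \<bar>f x\<bar> \<le> M" using Cb_infty_bound[OF f] by blast
  obtain N where N: "\<And>x. \<bar>lap f x\<bar> \<le> N" using Cb_infty_bound[OF lf] by blast
  note [measurable] = Cb_infty_borel[OF f] Cb_infty_borel[OF lf]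
  have d: "\<bar>1 * K.gen n f x + (-1) * lap f x\<bar> \<le> K * err n" for x
    using gen_lap_diff[OF Cb_infty_borel[OF f] M K] by simp
  have "\<bar>K.semi n t (\<lambda>x. 1 * K.gen n f x + (-1) * lap f x) x\<bar> \<le> K * err n"
    by (rule K.semi_bound[OF _ d t]) measurable
  also have "K.semi n t (\<lambda>x. 1 * K.gen n f x + (-1) * lap f x) x = 1 * K.semi n t (K.gen n f) x + (-1) * K.semi n t (lap f) x"
    by (rule K.semi_linear[OF _ K.gen_bound[OF Cb_infty_borel[OF f] M] _ N]) measurable
  finally have "\<bar>K.semi n t (K.gen n f) x - K.semi n t (lap f) x\<bar> \<le> K * err n" by simp
  moreover have "\<bar>K.semi n t (lap f) x - heat t (lap f) x\<bar> \<le> L * err n * t"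
    by (rule semi_heat_diff[OF lf L t])
  moreover have "(K + L * t) * err n = K * err n + L * err n * t" by (simp add: algebra_simps)
  ultimately show ?thesis by linarith
qed

lemma heat_time_deriv:
  assumes f: "f \<in> Cb_infty UNIV" and t: "0 \<le> t"
  shows "((\<lambda>t. heat t f x) has_real_derivative heat t (lap f) x) (at t within {0..})"
proof -
  obtain M where M: "\<And>x. \<bar>f x\<bar> \<le> M" using Cb_infty_bound[OF f] by blast
  obtain K where K0: "0 \<le> K" and K: "\<And>x y. \<bar>f (x + y) + f (x - y) - 2 * f x\<bar> \<le> K * min 1 (y\<^sup>2)"
    by (rule Cb_infty_second_difference[OF f]) (rule that; assumption)
  obtain L where L0: "0 \<le> L" and L: "\<And>x y. \<bar>lap f (x + y) + lap f (x - y) - 2 * lap f x\<bar> \<le> L * min 1 (y\<^sup>2)"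
    by (rule Cb_infty_second_difference[OF lap_Cb_infty[OF f]]) (rule that; assumption)
  \<comment> \<open>The interval is bounded because the error of the derivatives grows with time,
    and it extends beyond \<open>t\<close> so that near \<open>t\<close> it coincides with the half
    line.\<close>
  define S where "S = {0..t + 1}"
  have "\<exists>g. \<forall>\<tau>\<in>S. (\<lambda>n. K.semi n \<tau> f x) \<longlonglongrightarrow> g \<tau> \<and>
      (g has_derivative ((*) (heat \<tau> (lap f) x))) (at \<tau> within S)"
  proof (rule has_derivative_sequence)
    show "convex S" "0 \<in> S" using t by (auto simp: S_def)
    show "(\<lambda>n. K.semi n 0 f x) \<longlonglongrightarrow> f x" by (simp add: K.semi_0)
    show "((\<lambda>\<tau>. K.semi n \<tau> f x) has_derivative ((*) (K.semi n \<tau> (K.gen n f) x))) (at \<tau> within S)" for n \<tau>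
      using K.semi_deriv[OF Cb_infty_borel[OF f] M, where t = \<tau> and x = x]
      unfolding has_field_derivative_def by (rule has_derivative_at_withinI)
    fix e :: real assume e: "0 < e"
    have "(\<lambda>n. (K + L * (t + 1)) * err n) \<longlonglongrightarrow> 0"
      by (auto intro!: tendsto_eq_intros err_tendsto)
    then have "\<forall>\<^sub>F n in sequentially. (K + L * (t + 1)) * err n < e"
      using e by (intro order_tendstoD(2)) auto
    then show "\<forall>\<^sub>F n in sequentially. \<forall>\<tau>\<in>S. \<forall>h. norm (K.semi n \<tau> (K.gen n f) x * h - heat \<tau> (lap f) x * h) \<le> e * norm h"
    proof eventually_elim
      case (elim n)
      show ?case
      proof (intro ballI allI)
        fix \<tau> h assume \<tau>: "\<tau> \<in> S"
        have "\<bar>K.semi n \<tau> (K.gen n f) x - heat \<tau> (lap f) x\<bar> \<le> (K + L * \<tau>) * err n"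
          by (rule semi_gen_heat_lap_diff[OF f K L]) (use \<tau> in \<open>simp add: S_def\<close>)
        also have "\<dots> \<le> (K + L * (t + 1)) * err n"
          using \<tau> L0 err_nonneg by (intro mult_right_mono add_left_mono mult_left_mono) (auto simp: S_def)
        also have "\<dots> \<le> e" using elim by simp
        finally have "\<bar>h\<bar> * \<bar>K.semi n \<tau> (K.gen n f) x - heat \<tau> (lap f) x\<bar> \<le> \<bar>h\<bar> * e"
          by (rule mult_left_mono) simp
        then show "norm (K.semi n \<tau> (K.gen n f) x * h - heat \<tau> (lap f) x * h) \<le> e * norm h"
          unfolding left_diff_distrib[symmetric] real_norm_def abs_mult by (simp only: mult.commute)
      qed
    qed
  qed
  then obtain g where g: "\<And>\<tau>. \<tau> \<in> S \<Longrightarrow> (\<lambda>n. K.semi n \<tau> f x) \<longlonglongrightarrow> g \<tau>"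
    "\<And>\<tau>. \<tau> \<in> S \<Longrightarrow> (g has_derivative ((*) (heat \<tau> (lap f) x))) (at \<tau> within S)"
    by blast
  have geq: "heat \<tau> f x = g \<tau>" if "\<tau> \<in> S" for \<tau>
    using LIMSEQ_unique[OF heat_tendsto[OF f] g(1)[OF that]] that by (simp add: S_def)
  have tS: "t \<in> S" using t by (simp add: S_def)
  have "((\<lambda>t. heat t f x) has_derivative ((*) (heat t (lap f) x))) (at t within S)"
    by (rule has_derivative_transform[OF tS geq g(2)[OF tS]])
  moreover have "at t within S = at t within {0..}"
  proof (rule at_within_nhd)
    show "t \<in> {..<t + 1}" "open {..<t + 1}" by auto
    show "S \<inter> {..<t + 1} - {t} = {0..} \<inter> {..<t + 1} - {t}" by (auto simp: S_def)
  qed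
  ultimately show ?thesis by (simp add: has_field_derivative_def)
qed

text \<open>For a fixed index the generator is bounded in the supremum norm, so its commutation with
  each \<open>K.semi n t\<close> survives the uniform limit.\<close>

lemma gen_heat_commute:
  assumes f: "f \<in> Cb_infty UNIV" and t: "0 \<le> t"
  shows "K.gen m (heat t f) x = heat t (K.gen m f) x"
proof -
  obtain M where M: "\<And>x. \<bar>f x\<bar> \<le> M" using Cb_infty_bound[OF f] by blast
  obtain K where K0: "0 \<le> K" and K: "\<And>x y. \<bar>f (x + y) + f (x - y) - 2 * f x\<bar> \<le> K * min 1 (y\<^sup>2)"
    by (rule Cb_infty_second_difference[OF f]) (rule that; assumption)
  note [measurable] = Cb_infty_borel[OF f] Cb_infty_borel[OF heat_Cb_infty[OF f t]]
  have "\<bar>K.gen m (K.semi n t f) x - K.gen m (heat t f) x\<bar> \<le> 2 * K.mass m * (K * err n * t)" for n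
  proof -
    have "\<bar>K.gen m (\<lambda>x. 1 * K.semi n t f x + (-1) * heat t f x) x\<bar> \<le> 2 * K.mass m * (K * err n * t)"
    proof (rule K.gen_bound)
      show "\<bar>1 * K.semi n t f x + (-1) * heat t f x\<bar> \<le> K * err n * t" for x
        using semi_heat_diff[OF f K t, of n x] by simp
    qed measurable
    also have "K.gen m (\<lambda>x. 1 * K.semi n t f x + (-1) * heat t f x) x
        = 1 * K.gen m (K.semi n t f) x + (-1) * K.gen m (heat t f) x"
      by (rule K.gen_linear[OF _ K.semi_bound[OF Cb_infty_borel[OF f] M t] _ heat_bound[OF f t M]]) measurable
    finally show ?thesis by simp
  qed
  then have "\<forall>\<^sub>F n in sequentially. norm (K.gen m (K.semi n t f) x - K.gen m (heat t f) x) \<le> 2 * K.mass m * (K * err n * t)"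
    by simp
  moreover have "(\<lambda>n. 2 * K.mass m * (K * err n * t)) \<longlonglongrightarrow> 0"
    by (auto intro!: tendsto_eq_intros err_tendsto)
  ultimately have "(\<lambda>n. K.gen m (K.semi n t f) x - K.gen m (heat t f) x) \<longlonglongrightarrow> 0"
    by (rule Lim_null_comparison)
  then have "(\<lambda>n. K.gen m (K.semi n t f) x) \<longlonglongrightarrow> K.gen m (heat t f) x"
    by (simp add: LIM_zero_iff)
  moreover have "K.gen m (K.semi n t f) x = K.semi n t (K.gen m f) x" for n
    by (rule K.semi_gen_commute[OF K.jump_kernel_axioms Cb_infty_borel[OF f] M, symmetric])
  ultimately have "(\<lambda>n. K.semi n t (K.gen m f) x) \<longlonglongrightarrow> K.gen m (heat t f) x"
    by (simp only:)
  then show ?thesis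
    by (rule LIMSEQ_unique[OF _ heat_tendsto[OF gen_Cb_infty[OF f] t]])
qed

text \<open>\<open>lap\<close> is not continuous under uniform convergence, so it is reached through
  the bounded generators by a second limit, in their index. The time derivative
  \<open>heat t (lap f)\<close> thereby becomes the \<open>lap (heat t f)\<close> that the equation
  requires.\<close>

lemma lap_heat_commute:
  assumes f: "f \<in> Cb_infty UNIV" and t: "0 \<le> t"
  shows "lap (heat t f) x = heat t (lap f) x"
proof -
  note hf = heat_Cb_infty[OF f t] and lf = lap_Cb_infty[OF f]
  obtain M where M: "\<And>x. \<bar>f x\<bar> \<le> M" using Cb_infty_bound[OF f] by blast
  obtain K where K0: "0 \<le> K" and K: "\<And>x y. \<bar>f (x + y) + f (x - y) - 2 * f x\<bar> \<le> K * min 1 (y\<^sup>2)"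
    by (rule Cb_infty_second_difference[OF f]) (rule that; assumption)
  obtain L where L0: "0 \<le> L" and L: "\<And>x y. \<bar>heat t f (x + y) + heat t f (x - y) - 2 * heat t f x\<bar> \<le> L * min 1 (y\<^sup>2)"
    by (rule Cb_infty_second_difference[OF hf]) (rule that; assumption)
  have "\<bar>heat t (K.gen m f) x - heat t (lap f) x\<bar> \<le> K * err m" for m
  proof -
    have "\<bar>heat t (\<lambda>x. 1 * K.gen m f x + (-1) * lap f x) x\<bar> \<le> K * err m"
      by (rule heat_bound[OF Cb_infty_linear[OF gen_Cb_infty[OF f] lf] t])
        (use gen_lap_diff[OF Cb_infty_borel[OF f] M K] in simp)
    then show ?thesis
      unfolding heat_linear[OF gen_Cb_infty[OF f] lf t] by simp
  qed
  moreover have "\<bar>K.gen m (heat t f) x - lap (heat t f) x\<bar> \<le> L * err m" for m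
    by (rule gen_lap_diff[OF Cb_infty_borel[OF hf] heat_bound[OF f t M] L])
  ultimately have "\<bar>heat t (lap f) x - lap (heat t f) x\<bar> \<le> K * err m + L * err m" for m
    unfolding gen_heat_commute[OF f t] by (smt (verit))
  moreover have "(\<lambda>m. K * err m + L * err m) \<longlonglongrightarrow> 0"
    by (auto intro!: tendsto_eq_intros err_tendsto)
  ultimately have "\<bar>heat t (lap f) x - lap (heat t f) x\<bar> \<le> 0"
    by (intro LIMSEQ_le_const) auto
  then show ?thesis by simp
qed

text \<open>The flow is Lipschitz in space with a bound on \<open>deriv f\<close> and in time with a
  bound on \<open>lap f\<close>, each uniformly in the other variable.\<close>

lemma heat_continuous:
  assumes f: "f \<in> Cb_infty UNIV"
  shows "continuous_on half_space (\<lambda>(r, t). heat t f r)"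
proof -
  obtain A where A: "\<And>x. \<bar>deriv f x\<bar> \<le> A" using Cb_infty_bound[OF Cb_infty_derivD(2)[OF f]] by blast
  obtain B where B: "\<And>x. \<bar>lap f x\<bar> \<le> B" using Cb_infty_bound[OF lap_Cb_infty[OF f]] by blast
  have "\<bar>heat t f r - heat t' f r'\<bar> \<le> A * \<bar>r - r'\<bar> + B * \<bar>t - t'\<bar>" if t: "0 \<le> t" "0 \<le> t'" for r t r' t'
  proof -
    have "\<bar>heat t f r - heat t f r'\<bar> \<le> A * \<bar>r - r'\<bar>"
      by (rule has_real_derivative_bound[OF heat_deriv[OF f t(1)]])
        (rule heat_bound[OF Cb_infty_derivD(2)[OF f] t(1) A])
    moreover have "norm (heat t f r' - heat t' f r') \<le> B * norm (t - t')"
    proof (rule field_differentiable_bound[of "{0..}"])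
      show "((\<lambda>t. heat t f r') has_field_derivative heat t (lap f) r') (at t within {0..})" if "t \<in> {0..}" for t
        using heat_time_deriv[OF f] that by simp
      show "norm (heat t (lap f) r') \<le> B" if "t \<in> {0..}" for t
        using heat_bound[OF lap_Cb_infty[OF f] _ B] that by simp
    qed (use t in auto)
    ultimately show ?thesis unfolding real_norm_def by linarith
  qed
  then have est: "\<bar>heat (snd z) f (fst z) - heat (snd z') f (fst z')\<bar> \<le> A * \<bar>fst z - fst z'\<bar> + B * \<bar>snd z - snd z'\<bar>"
    if "z \<in> half_space" "z' \<in> half_space" for z z'
    using that by auto
  show ?thesis unfolding continuous_on_def case_prod_unfold
  proof
    fix z :: "real \<times> real" assume z: "z \<in> half_space"
    have "((\<lambda>z'. heat (snd z') f (fst z') - heat (snd z) f (fst z)) \<longlongrightarrow> 0) (at z within half_space)"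
    proof (rule Lim_null_comparison)
      show "\<forall>\<^sub>F z' in at z within half_space. norm (heat (snd z') f (fst z') - heat (snd z) f (fst z)) \<le> A * \<bar>fst z' - fst z\<bar> + B * \<bar>snd z' - snd z\<bar>"
        using est z by (auto simp: eventually_at_filter)
      show "((\<lambda>z'. A * \<bar>fst z' - fst z\<bar> + B * \<bar>snd z' - snd z\<bar>) \<longlongrightarrow> 0) (at z within half_space)"
        by (auto intro!: tendsto_eq_intros)
    qed
    then show "((\<lambda>z. heat (snd z) f (fst z)) \<longlongrightarrow> heat (snd z) f (fst z)) (at z within half_space)"
      by (simp add: LIM_zero_iff)
  qed
qed

text \<open>The induction runs over all profiles at once: the space and time derivatives are the
  heat flows of \<open>deriv f\<close> and \<open>lap f\<close>, again members of
  \<open>Cb_infty UNIV\<close>.\<close>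

lemma Cb_upto_heat:
  assumes "f \<in> Cb_infty UNIV"
  shows "Cb_upto k half_space (\<lambda>(r, t). heat t f r)"
  using assms
proof (induction k arbitrary: f)
  case (0 f)
  obtain M where M: "\<And>x. \<bar>f x\<bar> \<le> M" using Cb_infty_bound[OF 0] by blast
  have "bounded ((\<lambda>(r, t). heat t f r) ` half_space)"
    by (intro boundedI[of _ M]) (use heat_bound[OF 0 _ M] in auto)
  then show ?case using heat_continuous[OF 0] by simp
next
  case (Suc k f)
  obtain M where M: "\<And>x. \<bar>f x\<bar> \<le> M" using Cb_infty_bound[OF Suc.prems] by blast
  have "bounded ((\<lambda>(r, t). heat t f r) ` half_space)"
    by (intro boundedI[of _ M]) (use heat_bound[OF Suc.prems _ M] in auto)
  then show ?case
    by (rule Cb_upto_half_realI[OF _ heat_deriv[OF Suc.prems] heat_time_deriv[OF Suc.prems]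
          Suc.IH[OF Cb_infty_derivD(2)[OF Suc.prems]] Suc.IH[OF lap_Cb_infty[OF Suc.prems]]])
qed

end

section \<open>The infinity fractional Laplacian of radially nonincreasing functions\<close>

lemma radially_nonincreasing_even: "radially_nonincreasing g \<Longrightarrow> g (- r) = g (r::real)"
  unfolding radially_nonincreasing_def by (intro antisym) auto

lemma gradient_eqI: "GDERIV f x :> D \<Longrightarrow> gradient f x = D"
  unfolding gradient_def
proof (rule the_equality)
  fix D' assume "GDERIV f x :> D'" "GDERIV f x :> D"
  then have "(\<lambda>h. h \<bullet> D') = (\<lambda>h. h \<bullet> D)"
    unfolding gderiv_def by (rule has_derivative_unique)
  then have "(D' - D) \<bullet> D' = (D' - D) \<bullet> D" by (rule fun_cong)
  then have "(D' - D) \<bullet> (D' - D) = 0" unfolding inner_diff_right[of "D' - D"] by simp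
  then show "D' = D" by simp
qed

text \<open>The formula also holds at the origin: the quotient by \<open>norm x = 0\<close> is
  \<open>0\<close>, and the gradient vanishes since \<open>g' 0 = 0\<close>.\<close>

lemma gradient_radial:
  fixes x :: "'a::euclidean_space"
  assumes g: "\<And>r. (g has_real_derivative g' r) (at r)" and g0: "g' 0 = 0"
  shows "gradient (\<lambda>x. g (norm x)) x = (g' (norm x) / norm x) *\<^sub>R x"
proof (rule gradient_eqI)
  have "(g has_real_derivative r * (g' r / r)) (at r)" for r
    using g[of r] g0 by (cases "r = 0") auto
  from has_derivative_radial[OF this, of x]
  show "GDERIV (\<lambda>x. g (norm x)) x :> (g' (norm x) / norm x) *\<^sub>R x"
    unfolding gderiv_def by (rule has_derivative_eq_rhs) (simp add: inner_commute mult.commute)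
qed

context fractional
begin

text \<open>The integrand of \<open>lap\<close> is even, so the whole line counts the half line
  twice, which cancels the factor 1/2.\<close>

lemma lap_half_line:
  assumes f: "f \<in> Cb_infty UNIV"
  shows "set_integrable lborel {0<..} (\<lambda>y. (f (x + y) + f (x - y) - 2 * f x) / y powr (1 + 2 * s))"
    and "lap f x = C_const s * (LBINT y:{0<..}. (f (x + y) + f (x - y) - 2 * f x) / y powr (1 + 2 * s))"
proof -
  let ?d = "\<lambda>y. f (x + y) + f (x - y) - 2 * f x"
  note [measurable] = Cb_infty_borel[OF f]
  obtain K where K: "0 \<le> K" "\<And>x y. \<bar>f (x + y) + f (x - y) - 2 * f x\<bar> \<le> K * min 1 (y\<^sup>2)"
    by (rule Cb_infty_second_difference[OF f]) (rule that; assumption)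
  have i: "integrable lborel (\<lambda>y. ?d y / 2 * \<nu> y)"
    by (rule lap_integrable[OF Cb_infty_borel[OF f] K(2)])
  have si: "set_integrable lborel {0<..} (\<lambda>y. ?d y / 2 * \<nu> y)"
    unfolding set_integrable_def by (rule integrable_mult_indicator[OF _ i]) simp
  have eq: "?d y / y powr (1 + 2 * s) = (2 / C_const s) * (?d y / 2 * \<nu> y)" if "y \<in> {0<..}" for y
  proof -
    have nu: "\<nu> y = C_const s * inverse (y powr (1 + 2 * s))"
      using that unfolding \<nu>_def powr_minus by simp
    have cancel: "(2 / c) * (a / 2 * (c * b)) = a * b" if "c \<noteq> 0" for a b c :: real using that by simp
    show ?thesis unfolding nu cancel[OF C_pos[THEN less_imp_neq[THEN not_sym]]] by (rule divide_inverse)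
  qed
  have "set_integrable lborel {0<..} (\<lambda>y. ?d y / y powr (1 + 2 * s)) = set_integrable lborel {0<..} (\<lambda>y. (2 / C_const s) * (?d y / 2 * \<nu> y))"
    by (rule set_integrable_cong[OF refl refl]) (rule eq)
  then show "set_integrable lborel {0<..} (\<lambda>y. ?d y / y powr (1 + 2 * s))"
    by (rule iffD2) (rule set_integrable_mult_right, rule si)
  have "(LBINT y:{0<..}. ?d y / y powr (1 + 2 * s)) = (LBINT y:{0<..}. (2 / C_const s) * (?d y / 2 * \<nu> y))"
    by (rule set_lebesgue_integral_cong) (simp, intro allI impI, rule eq)
  also have "\<dots> = (2 / C_const s) * (LBINT y:{0<..}. ?d y / 2 * \<nu> y)" by (rule set_integral_mult_right)
  finally have "C_const s * (LBINT y:{0<..}. ?d y / y powr (1 + 2 * s)) = C_const s * ((2 / C_const s) * (LBINT y:{0<..}. ?d y / 2 * \<nu> y))"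
    by (simp only:)
  also have "\<dots> = 2 * (LBINT y:{0<..}. ?d y / 2 * \<nu> y)"
  proof -
    have "c * ((2 / c) * a) = 2 * a" if "c \<noteq> 0" for a c :: real using that by simp
    then show ?thesis by this (use C_pos in simp)
  qed
  finally have "C_const s * (LBINT y:{0<..}. ?d y / y powr (1 + 2 * s)) = 2 * (LBINT y:{0<..}. ?d y / 2 * \<nu> y)" .
  moreover have "lap f x = 2 * (LBINT y:{0<..}. ?d y / 2 * \<nu> y)"
    unfolding lap_def
  proof (rule integrable_even(2)[OF _ _ si])
    fix y
    have "x + - y = x - y" "x - - y = x + y" by simp_all
    then show "(f (x + - y) + f (x - - y) - 2 * f x) / 2 * \<nu> (- y) = ?d y / 2 * \<nu> y"
      by (simp only: \<nu>_def abs_minus_cancel add.commute[of "f (x - y)"])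
  qed measurable
  ultimately show "lap f x = C_const s * (LBINT y:{0<..}. ?d y / y powr (1 + 2 * s))" by (simp only:)
qed

text \<open>This serves the one-sided integrals of the degenerate case, in which the first
  difference itself, and not only the second, is of quadratic order.\<close>

lemma set_integrable_over_powr:
  assumes [measurable]: "h \<in> borel_measurable borel" and K: "\<And>y. 0 < y \<Longrightarrow> \<bar>h y\<bar> \<le> K * min 1 (y\<^sup>2)"
  shows "set_integrable lborel {0<..} (\<lambda>y. h y / y powr (1 + 2 * s))"
  unfolding set_integrable_def
proof (rule Bochner_Integration.integrable_bound)
  show "integrable lborel (\<lambda>y. (K / C_const s) * (min 1 (y\<^sup>2) * \<nu> y))"
    using levy_integrable by simp
  show "AE y in lborel. norm (indicator {0<..} y *\<^sub>R (h y / y powr (1 + 2 * s))) \<le> norm ((K / C_const s) * (min 1 (y\<^sup>2) * \<nu> y))"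
  proof (rule AE_I2)
    fix y :: real
    show "norm (indicator {0<..} y *\<^sub>R (h y / y powr (1 + 2 * s))) \<le> norm ((K / C_const s) * (min 1 (y\<^sup>2) * \<nu> y))"
    proof (cases "0 < y")
      case True
      have "\<bar>h y\<bar> / y powr (1 + 2 * s) \<le> (K * min 1 (y\<^sup>2)) / y powr (1 + 2 * s)"
        by (intro divide_right_mono K True) simp
      also have "\<dots> = (K / C_const s) * (min 1 (y\<^sup>2) * \<nu> y)"
      proof -
        have "\<nu> y = C_const s * inverse (y powr (1 + 2 * s))" using True unfolding \<nu>_def powr_minus by simp
        then show ?thesis using C_pos by (simp add: divide_inverse)
      qed
      also have "\<dots> \<le> \<bar>(K / C_const s) * (min 1 (y\<^sup>2) * \<nu> y)\<bar>" by (rule abs_ge_self)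
      finally show ?thesis using True unfolding real_norm_def by (simp only: indicator_simps greaterThan_iff scaleR_one abs_divide abs_of_nonneg[OF powr_ge_zero])
    qed simp
  qed
qed measurable

lemma infty_frac_laplacian_radial:
  fixes x :: "'a::euclidean_space"
  assumes g: "g \<in> Cb_infty UNIV" and mono: "radially_nonincreasing g"
  shows "infty_frac_laplacian s (\<lambda>x. g (norm x)) x = lap g (norm x)"
proof -
  define r where "r = norm x"
  define \<phi> where "\<phi> x = g (norm x)" for x :: 'a
  note d = Cb_infty_derivD(1)[OF g] and d' = Cb_infty_derivD(1)[OF Cb_infty_derivD(2)[OF g]]
  note [measurable] = Cb_infty_borel[OF g]
  have even: "g (- r) = g r" for r by (rule radially_nonincreasing_even[OF mono])
  have gabs: "g \<bar>r\<bar> = g r" for r using even[of r] by (simp add: abs_if)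
  have gle: "g b \<le> g a" if "\<bar>a\<bar> \<le> \<bar>b\<bar>" for a b
    using mono that unfolding radially_nonincreasing_def by simp
  have "deriv g (- 0) = - deriv g 0"
    by (rule DERIV_even_imp_odd[of g]) (rule even, rule d)
  then have d0: "deriv g 0 = 0" by simp
  have grad: "gradient \<phi> x = (deriv g r / r) *\<^sub>R x"
    unfolding \<phi>_def r_def by (rule gradient_radial[OF d d0])
  have \<phi>x: "\<phi> x = g r" by (simp add: \<phi>_def r_def)
  have r0: "0 \<le> r" by (simp add: r_def)
  have "infty_frac_laplacian s \<phi> x = lap g r"
  proof (cases "gradient \<phi> x = 0")
    case False
    then have nz: "x \<noteq> 0" "deriv g r \<noteq> 0" by (auto simp: grad)
    then have r: "0 < r" by (simp add: r_def)
    \<comment> \<open>The gradient points along \<open>x\<close> or \<open>- x\<close>. The second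
      difference is symmetric in \<open>\<eta>\<close>, so either sign gives the same
      integral.\<close>
    define \<epsilon> where "\<epsilon> = sgn (deriv g r)"
    have \<epsilon>: "\<epsilon> = 1 \<or> \<epsilon> = -1" using nz by (auto simp: \<epsilon>_def sgn_if)
    have ng: "norm (gradient \<phi> x) = \<bar>deriv g r\<bar>"
      using r by (simp add: grad r_def[symmetric])
    have \<zeta>: "gradient \<phi> x /\<^sub>R norm (gradient \<phi> x) = (\<epsilon> / r) *\<^sub>R x"
      unfolding ng by (simp add: grad \<epsilon>_def sgn_real_def divide_inverse abs_if)
    have \<phi>\<zeta>: "\<phi> (x + \<eta> *\<^sub>R ((\<epsilon> / r) *\<^sub>R x)) = g (r + \<epsilon> * \<eta>)" for \<eta>
    proof -
      have "x + \<eta> *\<^sub>R ((\<epsilon> / r) *\<^sub>R x) = (1 + \<eta> * \<epsilon> / r) *\<^sub>R x" by (simp add: scaleR_add_left)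
      then have "norm (x + \<eta> *\<^sub>R ((\<epsilon> / r) *\<^sub>R x)) = \<bar>1 + \<eta> * \<epsilon> / r\<bar> * r" by (simp add: r_def)
      also have "\<dots> = \<bar>(1 + \<eta> * \<epsilon> / r) * r\<bar>" using r by (simp add: abs_mult)
      also have "(1 + \<eta> * \<epsilon> / r) * r = r + \<epsilon> * \<eta>" using r by (simp add: field_simps)
      finally show ?thesis by (simp add: \<phi>_def gabs)
    qed
    have \<phi>\<zeta>': "\<phi> (x - \<eta> *\<^sub>R ((\<epsilon> / r) *\<^sub>R x)) = g (r - \<epsilon> * \<eta>)" for \<eta>
      using \<phi>\<zeta>[of "- \<eta>"] by simp
    have "g (r + \<epsilon> * \<eta>) + g (r - \<epsilon> * \<eta>) = g (r + \<eta>) + g (r - \<eta>)" for \<eta>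
      using \<epsilon> by auto
    then have "infty_frac_laplacian s \<phi> x = C_const s * (LBINT \<eta>:{0<..}. (g (r + \<eta>) + g (r - \<eta>) - 2 * g r) / \<eta> powr (1 + 2 * s))"
      using False unfolding infty_frac_laplacian_def Let_def \<zeta> \<phi>\<zeta> \<phi>\<zeta>' \<phi>x by simp
    then show ?thesis using lap_half_line(2)[OF g, of r] by simp
  next
    case True
    then have dr: "deriv g r = 0" using d0 by (cases "x = 0") (auto simp: grad r_def)
    \<comment> \<open>The unit vector pointing from \<open>x\<close> to the origin; at the origin
      itself any unit vector will do.\<close>
    obtain y0 :: 'a where y0: "norm y0 = 1" "x = - r *\<^sub>R y0"
    proof (cases "x = 0")
      case True
      then show ?thesis using that[of "SOME b. b \<in> Basis"] by (simp add: r_def norm_Basis some_in_eq)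
    next
      case False
      then show ?thesis using that[of "(- 1 / r) *\<^sub>R x"] by (simp add: r_def)
    qed
    obtain B where B: "\<And>x. \<bar>g x\<bar> \<le> B" "\<And>x. \<bar>deriv (deriv g) x\<bar> \<le> B"
      using Cb_infty_deriv2_bound[OF g] by blast
    \<comment> \<open>Since \<open>deriv g r = 0\<close>, the first difference is already quadratic.
      This makes the one-sided integrals converge, both at the origin and at critical radii away
      from it.\<close>
    have est: "\<bar>g (r + h) - g r\<bar> \<le> 2 * B * min 1 (h\<^sup>2)" for h
    proof -
      have "\<bar>g (r + h) - g r\<bar> \<le> B * h\<^sup>2"
        using first_order_remainder[OF d d' B(2), of r h] dr by simp
      moreover have "\<bar>g (r + h) - g r\<bar> \<le> 2 * B" using B(1)[of "r + h"] B(1)[of r] by linarith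
      moreover have "0 \<le> B" using B(1)[of 0] by linarith
      moreover from this have "0 \<le> B * h\<^sup>2" by simp
      ultimately have "\<bar>g (r + h) - g r\<bar> \<le> 2 * (B * h\<^sup>2)" "\<bar>g (r + h) - g r\<bar> \<le> 2 * B" by linarith+
      then show ?thesis by (simp add: min_def)
    qed
    \<comment> \<open>By the triangle inequality the norm of \<open>x + \<eta> *\<^sub>R y\<close>
      lies between \<open>\<bar>r - \<eta>\<bar>\<close> and \<open>r + \<eta>\<close>; monotonicity
      turns these into an upper and a lower bound, attained at \<open>y0\<close> and
      \<open>- y0\<close>.\<close>
    have lower: "g (r + \<eta>) \<le> \<phi> (x + \<eta> *\<^sub>R y)" and upper: "\<phi> (x + \<eta> *\<^sub>R y) \<le> g (r - \<eta>)"
      if "norm y = 1" "0 < \<eta>" for y \<eta>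
    proof -
      have "norm (x + \<eta> *\<^sub>R y) \<le> r + \<eta>"
        using norm_triangle_ineq[of x "\<eta> *\<^sub>R y"] that by (simp add: r_def)
      then show "g (r + \<eta>) \<le> \<phi> (x + \<eta> *\<^sub>R y)"
        unfolding \<phi>_def by (intro gle) (use that r0 in simp)
      have "\<bar>r - \<eta>\<bar> \<le> norm (x + \<eta> *\<^sub>R y)"
        using norm_triangle_ineq3[of x "- (\<eta> *\<^sub>R y)"] that by (simp add: r_def)
      then show "\<phi> (x + \<eta> *\<^sub>R y) \<le> g (r - \<eta>)"
        unfolding \<phi>_def by (intro gle) simp
    qed
    have at_y0: "\<phi> (x + \<eta> *\<^sub>R y0) = g (r - \<eta>)" "\<phi> (x - \<eta> *\<^sub>R y0) = g (r + \<eta>)" for \<eta>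
    proof -
      have "x + \<eta> *\<^sub>R y0 = (\<eta> - r) *\<^sub>R y0" "x - \<eta> *\<^sub>R y0 = (- (r + \<eta>)) *\<^sub>R y0"
        unfolding y0(2) by (simp_all only: scaleR_left_diff_distrib scaleR_minus_left scaleR_left_distrib) simp_all
      then have "norm (x + \<eta> *\<^sub>R y0) = \<bar>r - \<eta>\<bar>" "norm (x - \<eta> *\<^sub>R y0) = \<bar>r + \<eta>\<bar>"
        using y0(1) by (simp_all add: abs_minus_commute)
      then show "\<phi> (x + \<eta> *\<^sub>R y0) = g (r - \<eta>)" "\<phi> (x - \<eta> *\<^sub>R y0) = g (r + \<eta>)"
        by (simp_all only: \<phi>_def gabs)
    qed
    define I where "I y = (LBINT \<eta>:{0<..}. (\<phi> (x + \<eta> *\<^sub>R y) - \<phi> x) / \<eta> powr (1 + 2 * s))" for y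
    have int: "set_integrable lborel {0<..} (\<lambda>\<eta>. (\<phi> (x + \<eta> *\<^sub>R y) - \<phi> x) / \<eta> powr (1 + 2 * s))" if "norm y = 1" for y
    proof (rule set_integrable_over_powr[where K = "2 * B"])
      show "(\<lambda>\<eta>. \<phi> (x + \<eta> *\<^sub>R y) - \<phi> x) \<in> borel_measurable borel" unfolding \<phi>_def by measurable
      fix \<eta> :: real assume \<eta>: "0 < \<eta>"
      have "\<bar>g (r - \<eta>) - g r\<bar> \<le> 2 * B * min 1 (\<eta>\<^sup>2)" using est[of "- \<eta>"] by simp
      with est[of \<eta>] lower[OF that \<eta>] upper[OF that \<eta>]
      show "\<bar>\<phi> (x + \<eta> *\<^sub>R y) - \<phi> x\<bar> \<le> 2 * B * min 1 (\<eta>\<^sup>2)" unfolding \<phi>x abs_le_iff by linarith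
    qed
    have I_mono: "I y \<le> I y'" if "norm y = 1" "norm y' = 1"
      "\<And>\<eta>. 0 < \<eta> \<Longrightarrow> \<phi> (x + \<eta> *\<^sub>R y) \<le> \<phi> (x + \<eta> *\<^sub>R y')" for y y'
      unfolding I_def by (rule set_integral_mono[OF int[OF that(1)] int[OF that(2)]])
        (use that(3) in \<open>auto intro!: divide_right_mono\<close>)
    have "(SUP y\<in>sphere 0 1. I y) = I y0"
    proof (rule cSup_eq_maximum)
      show "I y0 \<in> I ` sphere 0 1" using y0(1) by simp
      fix z assume "z \<in> I ` sphere 0 1"
      then obtain y where "norm y = 1" "z = I y" by auto
      then show "z \<le> I y0" using y0(1) upper at_y0(1) by (auto intro!: I_mono)
    qed
    \<comment> \<open>The infimum is taken over reversed directions, so it is attained at the same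
      \<open>y0\<close> as the supremum, and the two one-sided integrals add up to a second
      difference along one line.\<close>
    moreover have "(INF y\<in>sphere 0 1. I (- y)) = I (- y0)"
    proof (rule cInf_eq_minimum)
      show "I (- y0) \<in> (\<lambda>y. I (- y)) ` sphere 0 1" using y0(1) by simp
      fix z assume "z \<in> (\<lambda>y. I (- y)) ` sphere 0 1"
      then obtain y where y: "norm y = 1" "z = I (- y)" by auto
      then show "I (- y0) \<le> z" using y0(1) lower[of "- y"] at_y0(2) by (auto intro!: I_mono)
    qed
    moreover have "I y0 + I (- y0) = (LBINT \<eta>:{0<..}. (\<phi> (x + \<eta> *\<^sub>R y0) - \<phi> x) / \<eta> powr (1 + 2 * s) + (\<phi> (x + \<eta> *\<^sub>R (- y0)) - \<phi> x) / \<eta> powr (1 + 2 * s))"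
      unfolding I_def by (rule set_integral_add(2)[symmetric]; rule int) (use y0 in simp_all)
    moreover have "\<dots> = (LBINT \<eta>:{0<..}. (g (r + \<eta>) + g (r - \<eta>) - 2 * g r) / \<eta> powr (1 + 2 * s))"
      using at_y0 by (simp add: \<phi>x add_divide_distrib[symmetric] algebra_simps)
    moreover have "infty_frac_laplacian s \<phi> x = C_const s * (SUP y\<in>sphere 0 1. I y) + C_const s * (INF y\<in>sphere 0 1. I (- y))"
      using True by (simp add: infty_frac_laplacian_def I_def)
    ultimately show ?thesis using lap_half_line(2)[OF g, of r] by (simp add: distrib_left[symmetric])
  qed
  then show ?thesis by (simp add: \<phi>_def[abs_def] r_def)
qed

end

section \<open>The Fourier symbol\<close>

text \<open>This is the real part of the characteristic function of the standard normal
  distribution.\<close>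

lemma std_normal_cos: "(LBINT x. std_normal_density x * cos (t * x)) = exp (- t\<^sup>2 / 2)"
proof -
  interpret N: prob_space std_normal_distribution by (rule prob_space_normal_density) simp
  have int: "integrable std_normal_distribution (\<lambda>x. iexp (t * x))"
    by (rule N.integrable_iexp) auto
  have "exp (- t\<^sup>2 / 2) = Re (char std_normal_distribution t)"
    by (simp only: char_std_normal_distribution Re_complex_of_real)
  also have "\<dots> = (LINT x|std_normal_distribution. Re (iexp (t * x)))"
    unfolding char_def by (rule integral_bounded_linear[OF bounded_linear_Re int, symmetric])
  also have "\<dots> = (LINT x|std_normal_distribution. cos (t * x))"
    by (simp add: Re_exp)
  also have "\<dots> = (LBINT x. std_normal_density x * cos (t * x))"
    by (rule integral_real_density) (auto intro!: AE_I2)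
  finally show ?thesis ..
qed

lemma
  fixes a z :: real
  assumes z: "0 < z"
  shows gauss_cos_integrable: "integrable lborel (\<lambda>y. exp (- (z * y\<^sup>2)) * cos (a * y))"
    and gauss_cos: "(LBINT y. exp (- (z * y\<^sup>2)) * cos (a * y)) = sqrt (pi / z) * exp (- (a\<^sup>2 / (4 * z)))"
proof -
  define c where "c = sqrt (2 * z)"
  have c: "c > 0" "c\<^sup>2 = 2 * z" using z by (auto simp: c_def)
  have eq: "exp (- (z * y\<^sup>2)) * cos (a * y) = sqrt (2 * pi) * (std_normal_density (0 + c * y) * cos (a / c * (0 + c * y)))" for y
    using c by (simp add: std_normal_density_def power_mult_distrib)
  have i: "integrable lborel (\<lambda>x. std_normal_density x * cos (a / c * x))"
    by (subst mult.commute, rule integrable_mult_bounded[OF integrable_normal_density, where M = 1]) simp_all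
  show "integrable lborel (\<lambda>y. exp (- (z * y\<^sup>2)) * cos (a * y))"
    unfolding eq by (rule integrable_mult_right, rule lborel_integrable_real_affine[OF i]) (use c in simp)
  have "(LBINT x. std_normal_density x * cos (a / c * x)) = \<bar>c\<bar> *\<^sub>R (LBINT y. std_normal_density (0 + c * y) * cos (a / c * (0 + c * y)))"
    by (rule lborel_integral_real_affine) (use c in simp)
  then have e: "exp (- (a / c)\<^sup>2 / 2) = c * (LBINT y. std_normal_density (0 + c * y) * cos (a / c * (0 + c * y)))"
    unfolding std_normal_cos using c by simp
  have "(LBINT y. exp (- (z * y\<^sup>2)) * cos (a * y)) = sqrt (2 * pi) * (LBINT y. std_normal_density (0 + c * y) * cos (a / c * (0 + c * y)))"
    unfolding eq by (rule integral_mult_right_zero)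
  also have "\<dots> = sqrt (2 * pi) / c * exp (- (a / c)\<^sup>2 / 2)"
    unfolding e using c by simp
  also have "sqrt (2 * pi) / c = sqrt (pi / z)"
    unfolding c_def real_sqrt_divide[symmetric] by simp
  also have "- (a / c)\<^sup>2 / 2 = - (a\<^sup>2 / (4 * z))"
    by (simp add: power_divide c(2))
  finally show "(LBINT y. exp (- (z * y\<^sup>2)) * cos (a * y)) = sqrt (pi / z) * exp (- (a\<^sup>2 / (4 * z)))" .
qed

text \<open>The substitution t = c z in the Gamma integral. With c = y^2 it represents a negative
  power of |y| as a mixture of Gaussians; as a nonnegative integral it is ready for Tonelli.\<close>

lemma nn_integral_Gamma_scaled:
  fixes a c :: real
  assumes a: "0 < a" and c: "0 < c"
  shows "(\<integral>\<^sup>+z. ennreal (indicator {0<..} z * (z powr (a - 1) * exp (- (c * z)))) \<partial>lborel) = ennreal (Gamma a * c powr - a)"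
proof -
  let ?h = "\<lambda>z::real. indicator {0<..} z * (z powr (a - 1) * exp (- (c * z)))"
  have "ennreal (Gamma a) = (\<integral>\<^sup>+t. ennreal (indicator {0..} t * t powr (a - 1) / exp t) \<partial>lborel)"
    by (rule Gamma_conv_nn_integral_real[OF a])
  also have "\<dots> = ennreal \<bar>c\<bar> * (\<integral>\<^sup>+z. ennreal (indicator {0..} (0 + c * z) * (0 + c * z) powr (a - 1) / exp (0 + c * z)) \<partial>lborel)"
    by (rule nn_integral_real_affine) (use c in auto)
  also have "(\<lambda>z. ennreal (indicator {0..} (0 + c * z) * (0 + c * z) powr (a - 1) / exp (0 + c * z)))
      = (\<lambda>z. ennreal (c powr (a - 1)) * ennreal (?h z))"
  proof
    fix z :: real
    have "indicator {0..} (0 + c * z) * (0 + c * z) powr (a - 1) / exp (0 + c * z) = c powr (a - 1) * ?h z"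
    proof (cases "0 < z")
      case True
      then show ?thesis using c by (simp add: powr_mult exp_minus divide_inverse)
    next
      case False
      then have "z = 0 \<or> c * z < 0" using c by (auto simp: mult_less_0_iff)
      then show ?thesis using False by (auto simp: indicator_def)
    qed
    then show "ennreal (indicator {0..} (0 + c * z) * (0 + c * z) powr (a - 1) / exp (0 + c * z)) = ennreal (c powr (a - 1)) * ennreal (?h z)"
      by (simp only: ennreal_mult'[symmetric] powr_ge_zero)
  qed
  also have "(\<integral>\<^sup>+z. ennreal (c powr (a - 1)) * ennreal (?h z) \<partial>lborel) = ennreal (c powr (a - 1)) * (\<integral>\<^sup>+z. ennreal (?h z) \<partial>lborel)"
    by (rule nn_integral_cmult) measurable
  finally have "ennreal (c powr - a) * ennreal (Gamma a) = ennreal (c powr - a) * (ennreal \<bar>c\<bar> * (ennreal (c powr (a - 1)) * (\<integral>\<^sup>+z. ennreal (?h z) \<partial>lborel)))"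
    by (simp only:)
  also have "\<dots> = ennreal (c powr - a * (c * c powr (a - 1))) * (\<integral>\<^sup>+z. ennreal (?h z) \<partial>lborel)"
    using c by (simp add: ennreal_mult mult.assoc)
  also have "c * c powr (a - 1) = c powr a"
    using c by (simp add: powr_mult_base)
  also have "c powr - a * c powr a = 1"
    using c by (simp add: powr_add[symmetric])
  finally show ?thesis
    using Gamma_real_pos[OF a] by (simp add: ennreal_mult[symmetric] mult.commute)
qed

lemma nn_integral_powr_from_0:
  fixes s b :: real
  assumes "0 < s" "0 \<le> b"
  shows "(\<integral>\<^sup>+z. ennreal (indicator {0<..b} z * z powr (s - 1)) \<partial>lborel) = ennreal (b powr s / s)"
proof -
  have "((\<lambda>z. z powr (s - 1)) has_integral (b powr (s - 1 + 1) / (s - 1 + 1))) {0..b}"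
    by (rule has_integral_powr_from_0) (use assms in auto)
  then have "(\<integral>\<^sup>+z. ennreal (indicator {0..b} z * z powr (s - 1)) \<partial>lborel) = ennreal (b powr s / s)"
    by (subst nn_integral_has_integral_lebesgue) auto
  moreover have "indicator {0..b} z * z powr (s - 1) = indicator {0<..b} z * z powr (s - 1)" for z :: real
    by (cases "z = 0") (auto simp: indicator_def)
  ultimately show ?thesis by simp
qed

lemma nn_integral_exp_minus:
  fixes b :: real
  assumes "0 \<le> b"
  shows "(\<integral>\<^sup>+v. ennreal (indicator {0..b} v * exp (- v)) \<partial>lborel) = ennreal (1 - exp (- b))"
proof -
  have "(\<integral>\<^sup>+v. ennreal (exp (- v)) * indicator {0..b} v \<partial>lborel) = ennreal ((- exp (- b)) - (- exp (- 0)))"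
    by (rule nn_integral_FTC_Icc) (use assms in \<open>auto intro!: derivative_eq_intros\<close>)
  moreover have "ennreal (exp (- v)) * indicator {0..b} v = ennreal (indicator {0..b} v * exp (- v))" for v
    by (auto simp: indicator_def)
  ultimately show ?thesis by simp
qed

text \<open>The value of the normalising constant: \<open>\<bar>y\<bar>\<close> to the power \<open>-1-2s\<close> is a mixture of Gaussians, for which
  the integral against \<open>1 - cos y\<close> is explicit.\<close>

lemma nn_integral_one_minus_cos:
  fixes s :: real
  assumes s: "0 < s" "s < 1"
  shows "(\<integral>\<^sup>+y. ennreal ((1 - cos y) * \<bar>y\<bar> powr - (1 + 2 * s)) \<partial>lborel)
    = ennreal (sqrt pi * Gamma (1 - s) / (4 powr s * s * Gamma (1/2 + s)))"
proof -
  \<comment> \<open>The exponent for which \<open>(y\<^sup>2) powr - a\<close> is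
    \<open>\<bar>y\<bar> powr - (1 + 2 * s)\<close>.\<close>
  define a where "a = 1/2 + s"
  have a: "0 < a" using s by (simp add: a_def)
  define H where "H y z = indicator {0<..} z * (z powr (a - 1) * ((1 - cos y) * exp (- (z * y\<^sup>2))))" for y z :: real
  \<comment> \<open>After the Gaussian integral in \<open>y\<close>, the factor 1 - exp(-1/(4z))
    appears; it is written as the integral of exp(-v) over [0, 1/(4z)]. A second exchange then
    yields a power integral in \<open>z\<close> and the integral of \<open>Gamma (1 - s)\<close> in
    \<open>v\<close>.\<close>
  define G where "G z v = indicator {0<..} z * (z powr (s - 1) * (indicator {0..1 / (4 * z)} v * exp (- v)))" for z v :: real
  have Hm[measurable]: "(\<lambda>(y, z). ennreal (H y z)) \<in> borel_measurable (lborel \<Otimes>\<^sub>M lborel)"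
    unfolding H_def by measurable
  \<comment> \<open>With the variable interval spelled out as inequalities, joint measurability is
    automatic.\<close>
  have G_alt: "G z v = (if 0 < z \<and> 0 \<le> v \<and> v \<le> 1 / (4 * z) then z powr (s - 1) * exp (- v) else 0)" for z v
    by (auto simp: G_def indicator_def)
  have Gm[measurable]: "(\<lambda>(z, v). ennreal (G z v)) \<in> borel_measurable (lborel \<Otimes>\<^sub>M lborel)"
    unfolding G_alt by measurable
  have "ennreal (Gamma a) * (\<integral>\<^sup>+y. ennreal ((1 - cos y) * \<bar>y\<bar> powr - (1 + 2 * s)) \<partial>lborel)
      = (\<integral>\<^sup>+y. ennreal (Gamma a) * ennreal ((1 - cos y) * \<bar>y\<bar> powr - (1 + 2 * s)) \<partial>lborel)"
    by (rule nn_integral_cmult[symmetric]) measurable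
  also have "\<dots> = (\<integral>\<^sup>+y. (\<integral>\<^sup>+z. ennreal (H y z) \<partial>lborel) \<partial>lborel)"
  proof (rule nn_integral_cong_AE)
    show "AE y in lborel. ennreal (Gamma a) * ennreal ((1 - cos y) * \<bar>y\<bar> powr - (1 + 2 * s)) = (\<integral>\<^sup>+z. ennreal (H y z) \<partial>lborel)"
      using AE_lborel_singleton[of 0]
    proof eventually_elim
      case (elim y)
      then have y2: "0 < y\<^sup>2" by simp
      have "y\<^sup>2 = \<bar>y\<bar> powr 2" using elim by simp
      then have "(y\<^sup>2) powr - a = \<bar>y\<bar> powr (2 * - a)" by (simp only: powr_powr)
      also have "2 * - a = - (1 + 2 * s)" by (simp add: a_def)
      finally have pw: "(y\<^sup>2) powr - a = \<bar>y\<bar> powr - (1 + 2 * s)" .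
      have "(\<integral>\<^sup>+z. ennreal (H y z) \<partial>lborel) = (\<integral>\<^sup>+z. ennreal (1 - cos y) * ennreal (indicator {0<..} z * (z powr (a - 1) * exp (- (y\<^sup>2 * z)))) \<partial>lborel)"
        by (intro nn_integral_cong) (simp add: H_def ennreal_mult'[symmetric] mult_ac)
      also have "\<dots> = ennreal (1 - cos y) * ennreal (Gamma a * (y\<^sup>2) powr - a)"
        by (subst nn_integral_cmult) (simp_all add: nn_integral_Gamma_scaled[OF a y2])
      also have "\<dots> = ennreal (Gamma a) * ennreal ((1 - cos y) * \<bar>y\<bar> powr - (1 + 2 * s))"
        unfolding pw using Gamma_real_pos[OF a] by (simp add: ennreal_mult'[symmetric] mult_ac)
      finally show ?case ..
    qed
  qed
  also have "\<dots> = (\<integral>\<^sup>+z. (\<integral>\<^sup>+y. ennreal (H y z) \<partial>lborel) \<partial>lborel)"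
    by (rule lborel_pair.Fubini'[OF Hm, symmetric])
  also have "\<dots> = (\<integral>\<^sup>+z. ennreal (sqrt pi) * (\<integral>\<^sup>+v. ennreal (G z v) \<partial>lborel) \<partial>lborel)"
  proof (rule nn_integral_cong)
    fix z :: real
    show "(\<integral>\<^sup>+y. ennreal (H y z) \<partial>lborel) = ennreal (sqrt pi) * (\<integral>\<^sup>+v. ennreal (G z v) \<partial>lborel)"
    proof (cases "0 < z")
      case True
      have i0: "integrable lborel (\<lambda>y. exp (- (z * y\<^sup>2)))" and v0: "(LBINT y. exp (- (z * y\<^sup>2))) = sqrt (pi / z)"
        using gauss_cos_integrable[OF True, of 0] gauss_cos[OF True, of 0] by simp_all
      note i1 = gauss_cos_integrable[OF True, of 1] and v1 = gauss_cos[OF True, of 1]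
      have i: "integrable lborel (\<lambda>y. (1 - cos y) * exp (- (z * y\<^sup>2)))"
        using Bochner_Integration.integrable_diff[OF i0 i1] by (simp add: algebra_simps)
      have v: "(LBINT y. (1 - cos y) * exp (- (z * y\<^sup>2))) = sqrt (pi / z) * (1 - exp (- (1 / (4 * z))))"
        using Bochner_Integration.integral_diff[OF i0 i1] v0 v1 by (simp add: algebra_simps)
      have "(\<integral>\<^sup>+y. ennreal (H y z) \<partial>lborel) = (\<integral>\<^sup>+y. ennreal (z powr (a - 1)) * ennreal ((1 - cos y) * exp (- (z * y\<^sup>2))) \<partial>lborel)"
        using True by (simp add: H_def ennreal_mult')
      also have "\<dots> = ennreal (z powr (a - 1)) * (\<integral>\<^sup>+y. ennreal ((1 - cos y) * exp (- (z * y\<^sup>2))) \<partial>lborel)"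
        by (rule nn_integral_cmult) measurable
      also have "(\<integral>\<^sup>+y. ennreal ((1 - cos y) * exp (- (z * y\<^sup>2))) \<partial>lborel) = ennreal (sqrt (pi / z) * (1 - exp (- (1 / (4 * z)))))"
        using nn_integral_eq_integral[OF i] v by simp
      also have "ennreal (z powr (a - 1)) * ennreal (sqrt (pi / z) * (1 - exp (- (1 / (4 * z)))))
          = ennreal (sqrt pi) * (ennreal (z powr (s - 1)) * ennreal (1 - exp (- (1 / (4 * z)))))"
      proof -
        have "z powr (a - 1) * sqrt (pi / z) = sqrt pi * z powr (s - 1)"
        proof -
          have "z powr (a - 1) = z powr (s - 1) * z powr (1/2)" unfolding powr_add[symmetric] a_def by simp
          then show ?thesis using True by (simp add: powr_half_sqrt real_sqrt_divide)
        qed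
        then have "z powr (a - 1) * (sqrt (pi / z) * q) = sqrt pi * (z powr (s - 1) * q)" for q
          unfolding mult.assoc[symmetric] by (rule arg_cong)
        moreover have "ennreal (sqrt pi) * (ennreal p * ennreal q) = ennreal (sqrt pi * (p * q))" if "0 \<le> p" for p q :: real
          using that by (simp add: ennreal_mult'[symmetric])
        ultimately show ?thesis by (simp only: ennreal_mult'[symmetric] powr_ge_zero)
      qed
      also have "ennreal (1 - exp (- (1 / (4 * z)))) = (\<integral>\<^sup>+v. ennreal (indicator {0..1 / (4 * z)} v * exp (- v)) \<partial>lborel)"
        by (rule nn_integral_exp_minus[symmetric]) (use True in simp)
      also have "ennreal (z powr (s - 1)) * \<dots> = (\<integral>\<^sup>+v. ennreal (z powr (s - 1)) * ennreal (indicator {0..1 / (4 * z)} v * exp (- v)) \<partial>lborel)"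
        by (rule nn_integral_cmult[symmetric]) measurable
      also have "\<dots> = (\<integral>\<^sup>+v. ennreal (G z v) \<partial>lborel)"
        using True by (simp add: G_def ennreal_mult')
      finally show ?thesis .
    qed (simp add: H_def G_def)
  qed
  also have "\<dots> = ennreal (sqrt pi) * (\<integral>\<^sup>+z. (\<integral>\<^sup>+v. ennreal (G z v) \<partial>lborel) \<partial>lborel)"
    by (rule nn_integral_cmult) measurable
  also have "(\<integral>\<^sup>+z. (\<integral>\<^sup>+v. ennreal (G z v) \<partial>lborel) \<partial>lborel) = (\<integral>\<^sup>+v. (\<integral>\<^sup>+z. ennreal (G z v) \<partial>lborel) \<partial>lborel)"
    by (rule lborel_pair.Fubini'[OF Gm, symmetric])
  also have "\<dots> = (\<integral>\<^sup>+v. ennreal (1 / (4 powr s * s)) * ennreal (indicator {0<..} v * (v powr ((1 - s) - 1) * exp (- (1 * v)))) \<partial>lborel)"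
  proof (rule nn_integral_cong_AE)
    show "AE v in lborel. (\<integral>\<^sup>+z. ennreal (G z v) \<partial>lborel) = ennreal (1 / (4 powr s * s)) * ennreal (indicator {0<..} v * (v powr ((1 - s) - 1) * exp (- (1 * v))))"
      using AE_lborel_singleton[of 0]
    proof eventually_elim
      case (elim v)
      show ?case
      proof (cases "0 < v")
        case True
        have "G z v = exp (- v) * (indicator {0<..1 / (4 * v)} z * z powr (s - 1))" for z
        proof (cases "0 < z")
          case z: True
          \<comment> \<open>The constraint is solved for \<open>z\<close>, which turns the inner
            integral into that of a power over a fixed interval.\<close>
          have "v \<le> 1 / (4 * z) \<longleftrightarrow> z \<le> 1 / (4 * v)" using True z by (simp add: field_simps)
          then show ?thesis using True z by (simp add: G_alt indicator_def)
        qed (simp add: G_def)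
        then have "(\<integral>\<^sup>+z. ennreal (G z v) \<partial>lborel) = (\<integral>\<^sup>+z. ennreal (exp (- v)) * ennreal (indicator {0<..1 / (4 * v)} z * z powr (s - 1)) \<partial>lborel)"
          by (simp only: ennreal_mult'[OF exp_ge_zero])
        also have "\<dots> = ennreal (exp (- v)) * ennreal ((1 / (4 * v)) powr s / s)"
          using nn_integral_powr_from_0[OF s(1), of "1 / (4 * v)"] True by (subst nn_integral_cmult) simp_all
        also have "\<dots> = ennreal (1 / (4 powr s * s) * (v powr - s * exp (- v)))"
        proof -
          have "(1 / (4 * v)) powr s / s = 1 / (4 powr s * s) * v powr - s"
            using True by (simp add: powr_divide powr_mult powr_minus_divide)
          then have "exp (- v) * ((1 / (4 * v)) powr s / s) = 1 / (4 powr s * s) * (v powr - s * exp (- v))"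
            by (simp only: mult.commute[of "exp (- v)"] mult.assoc)
          then show ?thesis by (simp only: ennreal_mult'[OF exp_ge_zero, symmetric])
        qed
        also have "\<dots> = ennreal (1 / (4 powr s * s)) * ennreal (indicator {0<..} v * (v powr ((1 - s) - 1) * exp (- (1 * v))))"
          using True s by (simp add: ennreal_mult'[symmetric])
        finally show ?thesis .
      next
        case False
        then have "v < 0" using elim by simp
        then show ?thesis by (simp add: G_alt)
      qed
    qed
  qed
  also have "\<dots> = ennreal (1 / (4 powr s * s)) * ennreal (Gamma (1 - s) * 1 powr - (1 - s))"
    using nn_integral_Gamma_scaled[of "1 - s" 1] s by (subst nn_integral_cmult) simp_all
  also have "ennreal (sqrt pi) * \<dots> = ennreal (sqrt pi * Gamma (1 - s) / (4 powr s * s))"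
    using s by (simp add: ennreal_mult'[symmetric])
  finally have "ennreal (1 / Gamma a) * (ennreal (Gamma a) * (\<integral>\<^sup>+y. ennreal ((1 - cos y) * \<bar>y\<bar> powr - (1 + 2 * s)) \<partial>lborel))
    = ennreal (1 / Gamma a) * ennreal (sqrt pi * Gamma (1 - s) / (4 powr s * s))" by (simp only:)
  also have "\<dots> = ennreal (sqrt pi * Gamma (1 - s) / (4 powr s * s * Gamma (1/2 + s)))"
    using Gamma_real_pos[OF a] by (simp add: ennreal_mult'[symmetric] a_def mult.commute)
  also have "ennreal (1 / Gamma a) * (ennreal (Gamma a) * (\<integral>\<^sup>+y. ennreal ((1 - cos y) * \<bar>y\<bar> powr - (1 + 2 * s)) \<partial>lborel))
    = ennreal (1 / Gamma a * Gamma a) * (\<integral>\<^sup>+y. ennreal ((1 - cos y) * \<bar>y\<bar> powr - (1 + 2 * s)) \<partial>lborel)"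
    using Gamma_real_pos[OF a] by (subst ennreal_mult') (simp_all add: mult.assoc)
  also have "1 / Gamma a * Gamma a = 1" using Gamma_real_pos[OF a] by simp
  finally show ?thesis by simp
qed

context fractional
begin

text \<open>\<open>C_const s\<close> is exactly the reciprocal of the integral just computed, which
  explains its Gamma factors.\<close>

lemma \<nu>_one_minus_cos: "(LBINT y. \<nu> y * (1 - cos y)) = 1"
proof -
  have G: "0 < Gamma (1 - s)" "0 < Gamma (1/2 + s)" using s_pos s_less by (auto intro!: Gamma_real_pos)
  have "(\<integral>\<^sup>+y. ennreal (\<nu> y * (1 - cos y)) \<partial>lborel) = (\<integral>\<^sup>+y. ennreal (C_const s) * ennreal ((1 - cos y) * \<bar>y\<bar> powr - (1 + 2 * s)) \<partial>lborel)"
    by (simp only: \<nu>_def ennreal_mult'[OF less_imp_le[OF C_pos], symmetric] mult.assoc mult.commute[of "1 - cos _"])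
  also have "\<dots> = ennreal (C_const s) * ennreal (sqrt pi * Gamma (1 - s) / (4 powr s * s * Gamma (1/2 + s)))"
    by (subst nn_integral_cmult) (measurable, simp only: nn_integral_one_minus_cos[OF s_pos s_less])
  also have "\<dots> = ennreal (C_const s * (sqrt pi * Gamma (1 - s) / (4 powr s * s * Gamma (1/2 + s))))"
    by (rule ennreal_mult'[OF less_imp_le[OF C_pos], symmetric])
  also have "C_const s * (sqrt pi * Gamma (1 - s) / (4 powr s * s * Gamma (1/2 + s))) = 1"
  proof -
    have "x / y * (y / x) = 1" if "0 < x" "0 < y" for x y :: real using that by simp
    then show ?thesis unfolding C_const_def by this (intro mult_pos_pos G s_pos, simp, intro mult_pos_pos G, simp)
  qed
  finally have n: "(\<integral>\<^sup>+y. ennreal (\<nu> y * (1 - cos y)) \<partial>lborel) = ennreal 1" .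
  have "(LBINT y. \<nu> y * (1 - cos y)) = enn2real (\<integral>\<^sup>+y. ennreal (\<nu> y * (1 - cos y)) \<partial>lborel)"
  proof (rule integral_eq_nn_integral)
    show "AE y in lborel. 0 \<le> \<nu> y * (1 - cos y)"
      by (intro AE_I2 mult_nonneg_nonneg \<nu>_nonneg) simp
  qed measurable
  then show ?thesis unfolding n by simp
qed

text \<open>Rescaling by \<open>\<xi>\<close> and the homogeneity of \<open>\<nu>\<close> of degree
  \<open>- (1 + 2 * s)\<close> reduce the claim to \<open>\<xi> = 1\<close>. At
  \<open>\<xi> = 0\<close> both sides are zero.\<close>

lemma \<nu>_symbol: "(LBINT y. \<nu> y * (1 - cos (\<xi> * y))) = \<bar>\<xi>\<bar> powr (2 * s)"
proof (cases "\<xi> = 0")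
  case False
  have eq: "\<nu> (0 + \<xi> * y) * (1 - cos (0 + \<xi> * y)) = \<bar>\<xi>\<bar> powr - (1 + 2 * s) * (\<nu> y * (1 - cos (\<xi> * y)))" for y
    by (simp add: \<nu>_def abs_mult powr_mult mult_ac)
  have "1 = \<bar>\<xi>\<bar> *\<^sub>R (LBINT y. \<nu> (0 + \<xi> * y) * (1 - cos (0 + \<xi> * y)))"
    using lborel_integral_real_affine[OF False, of "\<lambda>y. \<nu> y * (1 - cos y)" 0] unfolding \<nu>_one_minus_cos .
  also have "\<dots> = \<bar>\<xi>\<bar> * (\<bar>\<xi>\<bar> powr - (1 + 2 * s) * (LBINT y. \<nu> y * (1 - cos (\<xi> * y))))"
    unfolding eq integral_mult_right_zero real_scaleR_def ..
  finally have "1 = (\<bar>\<xi>\<bar> * \<bar>\<xi>\<bar> powr - (1 + 2 * s)) * (LBINT y. \<nu> y * (1 - cos (\<xi> * y)))" by (simp only: mult.assoc)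
  also have "\<bar>\<xi>\<bar> * \<bar>\<xi>\<bar> powr - (1 + 2 * s) = \<bar>\<xi>\<bar> powr - (2 * s)"
    using powr_mult_base[of "\<bar>\<xi>\<bar>" "- (1 + 2 * s)"] by simp
  finally have one: "\<bar>\<xi>\<bar> powr - (2 * s) * (LBINT y. \<nu> y * (1 - cos (\<xi> * y))) = 1" by (rule sym)
  have "\<bar>\<xi>\<bar> powr (2 * s) * \<bar>\<xi>\<bar> powr - (2 * s) = 1"
    using False by (simp add: powr_add[symmetric])
  then have "(LBINT y. \<nu> y * (1 - cos (\<xi> * y)))
      = \<bar>\<xi>\<bar> powr (2 * s) * (\<bar>\<xi>\<bar> powr - (2 * s) * (LBINT y. \<nu> y * (1 - cos (\<xi> * y))))"
    by (simp only: mult.assoc[symmetric] mult_1_left)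
  then show ?thesis unfolding one by simp
qed simp

end

section \<open>Cosines as eigenfunctions and Gaussians as test functions\<close>

context jump_kernel
begin

text \<open>The Levy-Khintchine exponent of the kernel, that is, the Fourier symbol of
  \<open>- gen\<close>.\<close>

definition symbol :: "real \<Rightarrow> real" where
  "symbol \<xi> = (LBINT y. k y * (1 - cos (\<xi> * y)))"

lemma symbol_nonneg: "0 \<le> symbol \<xi>"
  unfolding symbol_def
  by (rule Bochner_Integration.integral_nonneg) (intro mult_nonneg_nonneg k_nonneg, simp)

lemma symbol_measurable [measurable]: "symbol \<in> borel_measurable borel"
  unfolding symbol_def by measurable

text \<open>Evenness of \<open>k\<close> removes the sine part of the addition formula, so cosines
  are eigenfunctions and no complex exponentials are needed.\<close>

lemma jump_cos: "jump (\<lambda>x. cos (\<xi> * x)) x = (mass - symbol \<xi>) * cos (\<xi> * x)"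
proof -
  have ic: "integrable lborel (\<lambda>y. cos (\<xi> * y) * k y)" and si: "integrable lborel (\<lambda>y. sin (\<xi> * y) * k y)"
    by (rule integrable_mult_bounded[OF k_integrable, where M = 1]; simp)+
  have "(LBINT y. sin (\<xi> * y) * k y) = \<bar>- 1\<bar> *\<^sub>R (LBINT y. sin (\<xi> * (0 + - 1 * y)) * k (0 + - 1 * y))"
    by (rule lborel_integral_real_affine) simp
  also have "\<dots> = - (LBINT y. sin (\<xi> * y) * k y)"
    by (simp add: k_even)
  finally have s0: "(LBINT y. sin (\<xi> * y) * k y) = 0" by simp
  have "symbol \<xi> = (LBINT y. k y - cos (\<xi> * y) * k y)"
    unfolding symbol_def by (simp add: right_diff_distrib mult.commute)
  also have "\<dots> = mass - (LBINT y. cos (\<xi> * y) * k y)"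
    unfolding mass_def by (rule Bochner_Integration.integral_diff[OF k_integrable ic])
  finally have c: "(LBINT y. cos (\<xi> * y) * k y) = mass - symbol \<xi>" by simp
  have "k y * cos (\<xi> * (x + y)) = cos (\<xi> * x) * (cos (\<xi> * y) * k y) - sin (\<xi> * x) * (sin (\<xi> * y) * k y)" for y
    unfolding distrib_left cos_add by (simp add: right_diff_distrib)
  then have "jump (\<lambda>x. cos (\<xi> * x)) x
      = (LBINT y. cos (\<xi> * x) * (cos (\<xi> * y) * k y) - sin (\<xi> * x) * (sin (\<xi> * y) * k y))"
    unfolding jump_def by (simp only:)
  also have "\<dots> = cos (\<xi> * x) * (LBINT y. cos (\<xi> * y) * k y) - sin (\<xi> * x) * (LBINT y. sin (\<xi> * y) * k y)"
    by (simp only: Bochner_Integration.integral_diff[OF integrable_mult_right[OF ic] integrable_mult_right[OF si]] integral_mult_right_zero)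
  finally show ?thesis unfolding c s0 by (simp add: mult.commute)
qed

lemma jump_pow_cos: "(jump ^^ n) (\<lambda>x. cos (\<xi> * x)) x = (mass - symbol \<xi>) ^ n * cos (\<xi> * x)"
proof (induction n arbitrary: x)
  case (Suc n)
  have "jump ((jump ^^ n) (\<lambda>x. cos (\<xi> * x))) x = jump (\<lambda>x. (mass - symbol \<xi>) ^ n * cos (\<xi> * x)) x"
    using Suc by presburger
  also have "\<dots> = (mass - symbol \<xi>) ^ n * jump (\<lambda>x. cos (\<xi> * x)) x"
    unfolding jump_def by (simp only: mult.left_commute[of "k _"] integral_mult_right_zero)
  finally show ?case by (simp add: jump_cos)
qed simp

lemma semi_cos: "semi t (\<lambda>x. cos (\<xi> * x)) x = exp (- (symbol \<xi> * t)) * cos (\<xi> * x)"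
proof -
  define c where "c = mass - symbol \<xi>"
  have "(\<Sum>n. (jump ^^ n) (\<lambda>x. cos (\<xi> * x)) x / fact n * t ^ n) = (\<Sum>n. cos (\<xi> * x) * ((c * t) ^ n /\<^sub>R fact n))"
    by (intro suminf_cong) (simp add: jump_pow_cos c_def power_mult_distrib divide_inverse)
  also have "\<dots> = cos (\<xi> * x) * exp (c * t)"
    by (subst suminf_mult[OF summable_exp_generic]) (simp add: exp_def)
  finally have "semi t (\<lambda>x. cos (\<xi> * x)) x = (exp (- (mass * t)) * exp (c * t)) * cos (\<xi> * x)"
    by (simp add: semi_def)
  also have "exp (- (mass * t)) * exp (c * t) = exp (- (symbol \<xi> * t))"
    unfolding exp_add[symmetric] c_def by (simp add: left_diff_distrib)
  finally show ?thesis .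
qed

end

definition gauss :: "real \<Rightarrow> real \<Rightarrow> real" where
  "gauss \<tau> x = exp (- (\<tau> * x)\<^sup>2 / 2)"

lemma gauss_measurable [measurable]: "gauss \<tau> \<in> borel_measurable borel"
  unfolding gauss_def[abs_def] by measurable

lemma gauss_nonneg: "0 \<le> gauss \<tau> x" and gauss_le_1: "gauss \<tau> x \<le> 1" and gauss_abs: "\<bar>gauss \<tau> x\<bar> \<le> 1"
  by (simp_all add: gauss_def)

text \<open>The self-duality of the Gaussian under the Fourier transform exhibits it as a
  superposition of cosines with an integrable weight, the form on which the semigroup is
  explicit.\<close>

lemma gauss_eq: "gauss \<tau> x = (LBINT \<xi>. std_normal_density \<xi> * cos (\<tau> * \<xi> * x))"
  using std_normal_cos[of "\<tau> * x"] by (simp add: gauss_def mult_ac)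

lemma gauss_eq_density: "gauss \<tau> x = sqrt (2 * pi) * std_normal_density (\<tau> * x)"
  by (simp add: gauss_def std_normal_density_def)

lemma gauss_integrable:
  assumes "\<tau> \<noteq> 0"
  shows "integrable lborel (gauss \<tau>)"
  unfolding gauss_eq_density[abs_def]
  using lborel_integrable_real_affine[OF integrable_normal_density[OF zero_less_one, of 0] assms, of 0]
  by (intro integrable_mult_right) (simp only: add_0)

lemma gauss_lipschitz:
  assumes "0 \<le> \<tau>"
  shows "\<bar>gauss \<tau> x - gauss \<tau> y\<bar> \<le> \<tau> * \<bar>x - y\<bar>"
proof (rule has_real_derivative_bound)
  fix x
  show "(gauss \<tau> has_real_derivative - (\<tau> * ((\<tau> * x) * gauss \<tau> x))) (at x)"
    unfolding gauss_def[abs_def] by (auto intro!: derivative_eq_intros simp: power2_eq_square)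
  \<comment> \<open>The inequality \<open>(z - 1)\<^sup>2 \<ge> 0\<close> gives z <= 1 + z^2/2 <=
    exp(z^2/2), which bounds the derivative of \<open>gauss \<tau>\<close> by
    \<open>\<tau>\<close>.\<close>
  define z where "z = \<bar>\<tau> * x\<bar>"
  have "0 \<le> (z - 1)\<^sup>2" by simp
  then have "z \<le> 1 + z\<^sup>2 / 2" by (simp add: power2_diff)
  also have "\<dots> \<le> exp (z\<^sup>2 / 2)" by (rule exp_ge_add_one_self)
  finally have "z * exp (- z\<^sup>2 / 2) \<le> 1"
    by (simp add: exp_minus field_simps)
  then have "\<bar>(\<tau> * x) * gauss \<tau> x\<bar> \<le> 1"
    by (simp add: z_def gauss_def abs_mult[of "\<tau> * x"])
  then have "\<tau> * \<bar>(\<tau> * x) * gauss \<tau> x\<bar> \<le> \<tau> * 1" using assms by (rule mult_left_mono)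
  then show "\<bar>- (\<tau> * ((\<tau> * x) * gauss \<tau> x))\<bar> \<le> \<tau>"
    using assms by (simp add: abs_mult)
qed

context fractional
begin

text \<open>Dominated convergence; in the factor \<open>2 + \<xi>\<^sup>2\<close> the
  \<open>2\<close> covers \<open>\<bar>y\<bar> \<ge> 1\<close> and \<open>\<xi>\<^sup>2\<close> the
  quadratic decay of \<open>1 - cos (\<xi> * y)\<close> near the origin.\<close>

lemma symbol_tendsto: "(\<lambda>n. K.symbol n \<xi>) \<longlonglongrightarrow> \<bar>\<xi>\<bar> powr (2 * s)"
  unfolding K.symbol_def \<nu>_symbol[symmetric]
proof (rule integral_dominated_convergence)
  show "integrable lborel (\<lambda>y. (2 + \<xi>\<^sup>2) * (min 1 (y\<^sup>2) * \<nu> y))"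
    by (rule integrable_mult_right) (rule levy_integrable)
  show "AE y in lborel. (\<lambda>n. \<kappa> n y * (1 - cos (\<xi> * y))) \<longlonglongrightarrow> \<nu> y * (1 - cos (\<xi> * y))"
    using AE_lborel_singleton[of 0] by eventually_elim (intro tendsto_mult \<kappa>_tendsto tendsto_const)
  show "AE y in lborel. norm (\<kappa> n y * (1 - cos (\<xi> * y))) \<le> (2 + \<xi>\<^sup>2) * (min 1 (y\<^sup>2) * \<nu> y)" for n
    using AE_lborel_singleton[of 0]
  proof eventually_elim
    case (elim y)
    have c0: "0 \<le> 1 - cos (\<xi> * y)" by simp
    have "1 - cos (\<xi> * y) = 2 * (sin (\<xi> * y / 2))\<^sup>2"
      using cos_double_sin[of "\<xi> * y / 2"] by simp
    also have "\<dots> \<le> 2 * (\<xi> * y / 2)\<^sup>2"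
      by (intro mult_left_mono abs_le_square_iff[THEN iffD1] abs_sin_x_le_abs_x) simp
    also have "\<dots> \<le> \<xi>\<^sup>2 * y\<^sup>2" by (simp add: power_mult_distrib power_divide)
    finally have c1: "1 - cos (\<xi> * y) \<le> \<xi>\<^sup>2 * y\<^sup>2" .
    have c2: "1 - cos (\<xi> * y) \<le> 2" using cos_ge_minus_one[of "\<xi> * y"] by linarith
    have "1 - cos (\<xi> * y) \<le> (2 + \<xi>\<^sup>2) * min 1 (y\<^sup>2)"
    proof (cases "1 \<le> y\<^sup>2")
      case True
      have "0 \<le> \<xi>\<^sup>2" by simp
      then have "1 - cos (\<xi> * y) \<le> 2 + \<xi>\<^sup>2" using c2 by linarith
      then show ?thesis using True unfolding min_def by (simp only: if_True mult_1_right)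
    next
      case False
      have "(2 + \<xi>\<^sup>2) * y\<^sup>2 = 2 * y\<^sup>2 + \<xi>\<^sup>2 * y\<^sup>2" by (rule distrib_right)
      moreover have "0 \<le> 2 * y\<^sup>2" by simp
      ultimately have "1 - cos (\<xi> * y) \<le> (2 + \<xi>\<^sup>2) * y\<^sup>2" using c1 by linarith
      then show ?thesis using False by (simp add: min_def)
    qed
    then have "\<kappa> n y * (1 - cos (\<xi> * y)) \<le> \<nu> y * ((2 + \<xi>\<^sup>2) * min 1 (y\<^sup>2))"
      using c0 by (intro mult_mono \<kappa>_le_\<nu> elim \<nu>_nonneg)
    also have "\<dots> = (2 + \<xi>\<^sup>2) * (min 1 (y\<^sup>2) * \<nu> y)" by (simp only: mult_ac)
    finally show ?case
      using c0 \<kappa>_nonneg[of n y] unfolding real_norm_def abs_mult by simp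
  qed
qed measurable

end

section \<open>The heat kernel and its Gaussian regularisations\<close>

locale fractional_heat = fractional +
  fixes t :: real
  assumes s_gt: "1/2 < s" and t_pos: "0 < t"
begin

definition E :: "real \<Rightarrow> real" where
  "E \<xi> = exp (- (\<bar>\<xi>\<bar> powr (2 * s)) * t)"

definition P :: "real \<Rightarrow> real" where
  "P x = frac_heat_kernel s x t"

text \<open>The heat flow of \<open>gauss \<tau>\<close>, written on the Fourier side. Large \<tau>,
  after normalisation, gives an approximate identity and recovers \<open>P\<close>; small \<tau>
  gives wide Gaussians and measures the total mass.\<close>

definition G :: "real \<Rightarrow> real \<Rightarrow> real" where
  "G \<tau> x = (LBINT \<xi>. std_normal_density \<xi> * (E (\<tau> * \<xi>) * cos (\<tau> * \<xi> * x)))"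

lemma E_measurable [measurable]: "E \<in> borel_measurable borel"
  unfolding E_def[abs_def] by measurable

lemma E_pos: "0 < E \<xi>" and E_le_1: "E \<xi> \<le> 1"
  using t_pos by (simp_all add: E_def)

text \<open>Since \<open>2 * s > 1\<close>, the exponent
  \<open>\<bar>\<xi>\<bar> powr (2 * s)\<close> is at least \<open>\<bar>\<xi>\<bar> - 1\<close>,
  which leaves a two-sided exponential as majorant.\<close>

lemma E_integrable: "integrable lborel E"
proof -
  have "set_integrable lborel {0<..} (\<lambda>y. exp (- t * \<bar>y\<bar>))"
  proof (rule set_integrable_lborel_nonneg)
    have "(\<lambda>y. exp (- t * y)) integrable_on {0..}" by (rule integrable_on_exp_minus_to_infinity[OF t_pos])
    then have "(\<lambda>y. exp (- t * y)) integrable_on {0<..}"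
      by (rule integrable_spike_set) (rule negligible_subset[of "{0}"], simp, force)+
    then show "(\<lambda>y. exp (- t * \<bar>y\<bar>)) integrable_on {0<..}"
      by (rule integrable_eq) simp
  qed auto
  then have i: "integrable lborel (\<lambda>y. exp (- t * \<bar>y\<bar>))"
    by (intro integrable_even(1)) auto
  show ?thesis
  proof (rule Bochner_Integration.integrable_bound[OF integrable_mult_right[OF i, of "exp t"]])
    show "AE \<xi> in lborel. norm (E \<xi>) \<le> norm (exp t * exp (- t * \<bar>\<xi>\<bar>))"
    proof (rule AE_I2)
      fix \<xi> :: real
      have "\<bar>\<xi>\<bar> - 1 \<le> \<bar>\<xi>\<bar> powr (2 * s)"
      proof (cases "1 \<le> \<bar>\<xi>\<bar>")
        case True
        then have "\<bar>\<xi>\<bar> powr 1 \<le> \<bar>\<xi>\<bar> powr (2 * s)" using s_gt by (intro powr_mono) auto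
        then show ?thesis using True by simp
      next
        case False
        then show ?thesis using powr_ge_zero[of "\<bar>\<xi>\<bar>" "2 * s"] by linarith
      qed
      then have "(\<bar>\<xi>\<bar> - 1) * t \<le> \<bar>\<xi>\<bar> powr (2 * s) * t" using t_pos by (intro mult_right_mono) auto
      then have "- (\<bar>\<xi>\<bar> powr (2 * s)) * t \<le> t + - t * \<bar>\<xi>\<bar>"
        using mult.commute[of t "\<bar>\<xi>\<bar>"] unfolding left_diff_distrib minus_mult_left[symmetric] by linarith
      then show "norm (E \<xi>) \<le> norm (exp t * exp (- t * \<bar>\<xi>\<bar>))"
        unfolding E_def exp_add[symmetric] by simp
    qed
  qed measurable
qed

lemma P_eq: "P x = (1 / (2 * pi)) * (LBINT \<xi>. E \<xi> * cos (\<xi> * x))"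
proof -
  have i: "integrable lborel (\<lambda>\<xi>. cis (x * \<xi>) * complex_of_real (E \<xi>))"
  proof (rule Bochner_Integration.integrable_bound[OF E_integrable])
    have "(\<lambda>\<xi>. complex_of_real (cos (x * \<xi>)) + \<i> * complex_of_real (sin (x * \<xi>))) \<in> borel_measurable lborel"
      by measurable
    moreover have "cis (x * \<xi>) = complex_of_real (cos (x * \<xi>)) + \<i> * complex_of_real (sin (x * \<xi>))" for \<xi>
      by (simp add: complex_eq_iff)
    ultimately have [measurable]: "(\<lambda>\<xi>. cis (x * \<xi>)) \<in> borel_measurable lborel" by (simp only:)
    show "(\<lambda>\<xi>. cis (x * \<xi>) * complex_of_real (E \<xi>)) \<in> borel_measurable lborel" by measurable
    show "AE \<xi> in lborel. norm (cis (x * \<xi>) * complex_of_real (E \<xi>)) \<le> norm (E \<xi>)"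
      by (intro AE_I2) (simp add: norm_mult)
  qed
  have "P x = Re (complex_of_real (1 / (2 * pi)) * (LBINT \<xi>. cis (x * \<xi>) * complex_of_real (E \<xi>)))"
    by (simp add: P_def frac_heat_kernel_def inverse_fourier_def E_def)
  also have "\<dots> = (1 / (2 * pi)) * Re (LBINT \<xi>. cis (x * \<xi>) * complex_of_real (E \<xi>))"
    by simp
  also have "Re (LBINT \<xi>. cis (x * \<xi>) * complex_of_real (E \<xi>)) = (LBINT \<xi>. Re (cis (x * \<xi>) * complex_of_real (E \<xi>)))"
    by (rule integral_bounded_linear[OF bounded_linear_Re i, symmetric])
  also have "\<dots> = (LBINT \<xi>. E \<xi> * cos (\<xi> * x))"
    by (simp add: mult.commute)
  finally show ?thesis .
qed

lemma P_measurable [measurable]: "P \<in> borel_measurable borel"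
  unfolding P_eq[abs_def] by measurable

lemma P_even: "P (- x) = P x"
  by (simp add: P_eq)

text \<open>Rescaling the frequency shows that the normalised \<open>G \<tau>\<close> is the inverse
  transform of \<open>E\<close> with a Gaussian cutoff of width \<tau>, which disappears as \<tau>
  grows.\<close>

lemma scaled_G_eq:
  assumes "0 < \<tau>"
  shows "\<tau> / sqrt (2 * pi) * G \<tau> x = (1 / (2 * pi)) * (LBINT \<xi>. gauss (1 / \<tau>) \<xi> * (E \<xi> * cos (\<xi> * x)))"
proof -
  have eq: "gauss (1 / \<tau>) (0 + \<tau> * \<xi>) * (E (0 + \<tau> * \<xi>) * cos ((0 + \<tau> * \<xi>) * x))
     = sqrt (2 * pi) * (std_normal_density \<xi> * (E (\<tau> * \<xi>) * cos (\<tau> * \<xi> * x)))" for \<xi>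
    using assms by (simp add: gauss_eq_density)
  have "(LBINT \<xi>. gauss (1 / \<tau>) \<xi> * (E \<xi> * cos (\<xi> * x)))
     = \<bar>\<tau>\<bar> *\<^sub>R (LBINT \<xi>. gauss (1 / \<tau>) (0 + \<tau> * \<xi>) * (E (0 + \<tau> * \<xi>) * cos ((0 + \<tau> * \<xi>) * x)))"
    by (rule lborel_integral_real_affine) (use assms in simp)
  also have "\<dots> = \<tau> * (sqrt (2 * pi) * G \<tau> x)"
    using assms by (simp only: eq G_def integral_mult_right_zero real_scaleR_def abs_of_pos)
  finally have *: "(LBINT \<xi>. gauss (1 / \<tau>) \<xi> * (E \<xi> * cos (\<xi> * x))) = \<tau> * (sqrt (2 * pi) * G \<tau> x)" .
  define q where "q = sqrt (2 * pi)"
  have q: "0 < q" "2 * pi = q * q" by (simp_all add: q_def)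
  show ?thesis unfolding * q_def[symmetric] q(2) using q(1) by simp
qed

lemma scaled_G_bound:
  assumes "0 < \<tau>"
  shows "\<bar>\<tau> / sqrt (2 * pi) * G \<tau> x\<bar> \<le> (1 / (2 * pi)) * (LBINT \<xi>. E \<xi>)"
proof -
  have "\<bar>LBINT \<xi>. gauss (1 / \<tau>) \<xi> * cos (\<xi> * x) * E \<xi>\<bar> \<le> 1 * (LBINT \<xi>. E \<xi>)"
  proof (rule abs_integral_mult_le[OF E_integrable])
    show "\<bar>gauss (1 / \<tau>) \<xi> * cos (\<xi> * x)\<bar> \<le> 1" for \<xi>
      unfolding abs_mult using mult_mono[OF gauss_abs[of "1 / \<tau>" \<xi>] abs_cos_le_one[of "\<xi> * x"]] by simp
  qed (measurable, simp add: E_pos[THEN less_imp_le])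
  then have "(1 / (2 * pi)) * \<bar>LBINT \<xi>. gauss (1 / \<tau>) \<xi> * (E \<xi> * cos (\<xi> * x))\<bar> \<le> (1 / (2 * pi)) * (LBINT \<xi>. E \<xi>)"
    by (intro mult_left_mono) (simp_all add: mult_ac)
  then show ?thesis unfolding scaled_G_eq[OF assms] by (simp add: abs_mult)
qed

lemma scaled_G_tendsto: "(\<lambda>m. real (Suc m) / sqrt (2 * pi) * G (real (Suc m)) x) \<longlonglongrightarrow> P x"
proof -
  have "(\<lambda>m. LBINT \<xi>. gauss (1 / real (Suc m)) \<xi> * (E \<xi> * cos (\<xi> * x))) \<longlonglongrightarrow> (LBINT \<xi>. E \<xi> * cos (\<xi> * x))"
  proof (rule integral_dominated_convergence)
    show "AE \<xi> in lborel. (\<lambda>m. gauss (1 / real (Suc m)) \<xi> * (E \<xi> * cos (\<xi> * x))) \<longlonglongrightarrow> E \<xi> * cos (\<xi> * x)"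
    proof (rule AE_I2)
      fix \<xi>
      have "(\<lambda>m. exp (- (1 / real (Suc m) * \<xi>)\<^sup>2 / 2)) \<longlonglongrightarrow> exp (- (0 * \<xi>)\<^sup>2 / 2)"
        by (intro tendsto_intros LIMSEQ_Suc[OF lim_1_over_n]) simp
      then have "(\<lambda>m. gauss (1 / real (Suc m)) \<xi>) \<longlonglongrightarrow> 1" by (simp add: gauss_def)
      from tendsto_mult_right[OF this, of "E \<xi> * cos (\<xi> * x)"]
      show "(\<lambda>m. gauss (1 / real (Suc m)) \<xi> * (E \<xi> * cos (\<xi> * x))) \<longlonglongrightarrow> E \<xi> * cos (\<xi> * x)" by simp
    qed
    show "AE \<xi> in lborel. norm (gauss (1 / real (Suc m)) \<xi> * (E \<xi> * cos (\<xi> * x))) \<le> E \<xi>" for m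
    proof (rule AE_I2)
      fix \<xi>
      have "\<bar>gauss (1 / real (Suc m)) \<xi>\<bar> * (\<bar>E \<xi>\<bar> * \<bar>cos (\<xi> * x)\<bar>) \<le> 1 * (E \<xi> * 1)"
        by (intro mult_mono gauss_abs abs_cos_le_one) (use E_pos[of \<xi>] in auto)
      then show "norm (gauss (1 / real (Suc m)) \<xi> * (E \<xi> * cos (\<xi> * x))) \<le> E \<xi>"
        by (simp add: abs_mult)
    qed
  qed (measurable, rule E_integrable)
  from tendsto_mult_left[OF this, of "1 / (2 * pi)"] show ?thesis
    by (simp only: P_eq scaled_G_eq of_nat_0_less_iff zero_less_Suc)
qed

lemma semi_gauss: "K.semi n t (gauss \<tau>) x = (LBINT \<xi>. std_normal_density \<xi> * (exp (- (K.symbol n (\<tau> * \<xi>) * t)) * cos (\<tau> * \<xi> * x)))"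
proof -
  have "K.semi n t (\<lambda>x. LBINT \<xi>. std_normal_density \<xi> * cos (\<tau> * \<xi> * x)) x
      = (LBINT \<xi>. std_normal_density \<xi> * K.semi n t (\<lambda>x. cos (\<tau> * \<xi> * x)) x)"
  proof (rule K.semi_parametric[where M = 1])
    show "integrable lborel std_normal_density" by (rule integrable_normal_density) simp
    show "(\<lambda>(x, \<xi>). cos (\<tau> * \<xi> * x)) \<in> borel_measurable (borel \<Otimes>\<^sub>M borel)" by measurable
    show "\<bar>cos (\<tau> * \<xi> * x)\<bar> \<le> 1" for x \<xi> by (rule abs_cos_le_one)
  qed
  then show ?thesis unfolding K.semi_cos gauss_eq[abs_def] .
qed

lemma semi_gauss_tendsto: "(\<lambda>n. K.semi n t (gauss \<tau>) x) \<longlonglongrightarrow> G \<tau> x"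
  unfolding semi_gauss G_def
proof (rule integral_dominated_convergence)
  show "AE \<xi> in lborel. (\<lambda>n. std_normal_density \<xi> * (exp (- (K.symbol n (\<tau> * \<xi>) * t)) * cos (\<tau> * \<xi> * x)))
      \<longlonglongrightarrow> std_normal_density \<xi> * (E (\<tau> * \<xi>) * cos (\<tau> * \<xi> * x))"
    unfolding E_def minus_mult_left[symmetric]
    by (intro AE_I2 tendsto_intros symbol_tendsto)
  show "AE \<xi> in lborel. norm (std_normal_density \<xi> * (exp (- (K.symbol n (\<tau> * \<xi>) * t)) * cos (\<tau> * \<xi> * x))) \<le> std_normal_density \<xi>" for n
  proof (rule AE_I2)
    fix \<xi>
    have "exp (- (K.symbol n (\<tau> * \<xi>) * t)) \<le> 1" using K.symbol_nonneg[of n "\<tau> * \<xi>"] t_pos by simp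
    then have "\<bar>std_normal_density \<xi>\<bar> * (\<bar>exp (- (K.symbol n (\<tau> * \<xi>) * t))\<bar> * \<bar>cos (\<tau> * \<xi> * x)\<bar>) \<le> std_normal_density \<xi> * (1 * 1)"
      by (intro mult_mono abs_cos_le_one) auto
    then show "norm (std_normal_density \<xi> * (exp (- (K.symbol n (\<tau> * \<xi>) * t)) * cos (\<tau> * \<xi> * x))) \<le> std_normal_density \<xi>"
      by (simp add: abs_mult)
  qed
  note [measurable] = K.symbol_measurable
  show "(\<lambda>\<xi>. std_normal_density \<xi> * (exp (- (K.symbol n (\<tau> * \<xi>) * t)) * cos (\<tau> * \<xi> * x))) \<in> borel_measurable lborel" for n
    by measurable
  show "integrable lborel std_normal_density" by (rule integrable_normal_density) simp
qed measurable

lemma G_nonneg: "0 \<le> G \<tau> x"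
  by (rule LIMSEQ_le_const[OF semi_gauss_tendsto])
    (use K.semi_nonneg[OF gauss_measurable gauss_abs gauss_nonneg] t_pos in auto)

text \<open>Positivity of the jump semigroups survives two limits, first in the truncation and then
  in the Gaussian width.\<close>

lemma P_nonneg: "0 \<le> P x"
  by (rule LIMSEQ_le_const[OF scaled_G_tendsto]) (intro exI[of _ 0] allI impI mult_nonneg_nonneg G_nonneg, simp)

text \<open>After the substitution z = \<tau> (x - y) the convolution is an average of
  \<open>U (x - z / \<tau>)\<close> over the normal distribution, so the Lipschitz constant meets
  the first absolute moment divided by \<tau>.\<close>

lemma mollifier_close:
  assumes U[measurable]: "U \<in> borel_measurable borel" and M: "\<And>x. \<bar>U x\<bar> \<le> M"
    and L: "\<And>x y. \<bar>U x - U y\<bar> \<le> L * \<bar>x - y\<bar>" and \<tau>: "0 < \<tau>"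
  shows "\<bar>(LBINT y. (\<tau> / sqrt (2 * pi) * U y) * gauss \<tau> (x + - y)) - U x\<bar>
    \<le> L * (LBINT z. std_normal_density z * \<bar>z\<bar>) / \<tau>"
proof -
  have n: "integrable lborel std_normal_density" by (rule integrable_normal_density) simp
  have n1: "integrable lborel (\<lambda>z. std_normal_density z * \<bar>z\<bar>)"
    using integrable_std_normal_moment_abs[of 1] by (simp only: power_one_right)
  define q where "q = sqrt (2 * pi)"
  have q: "0 < q" by (simp add: q_def)
  have eq: "(\<tau> / sqrt (2 * pi) * U (x + - (1 / \<tau>) * z)) * gauss \<tau> (x + - (x + - (1 / \<tau>) * z)) = \<tau> * (U (x - z / \<tau>) * std_normal_density z)" for z
    using \<tau> q by (simp add: gauss_eq_density q_def[symmetric])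
  have i1: "integrable lborel (\<lambda>z. U (x - z / \<tau>) * std_normal_density z)"
    by (rule integrable_mult_bounded[OF n _ M]) measurable
  have i2: "integrable lborel (\<lambda>z. U x * std_normal_density z)"
    by (rule integrable_mult_right[OF n])
  have "(LBINT y. (\<tau> / sqrt (2 * pi) * U y) * gauss \<tau> (x + - y))
     = \<bar>- (1 / \<tau>)\<bar> *\<^sub>R (LBINT z. (\<tau> / sqrt (2 * pi) * U (x + - (1 / \<tau>) * z)) * gauss \<tau> (x + - (x + - (1 / \<tau>) * z)))"
    by (rule lborel_integral_real_affine) (use \<tau> in simp)
  also have "\<dots> = (LBINT z. U (x - z / \<tau>) * std_normal_density z)"
    unfolding eq using \<tau> by simp
  finally have e1: "(LBINT y. (\<tau> / sqrt (2 * pi) * U y) * gauss \<tau> (x + - y)) = (LBINT z. U (x - z / \<tau>) * std_normal_density z)" .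
  have e2: "U x = (LBINT z. U x * std_normal_density z)"
    by (simp add: integral_normal_density)
  have "\<bar>(LBINT z. U (x - z / \<tau>) * std_normal_density z) - (LBINT z. U x * std_normal_density z)\<bar>
     = \<bar>LBINT z. U (x - z / \<tau>) * std_normal_density z - U x * std_normal_density z\<bar>"
    by (simp only: Bochner_Integration.integral_diff[OF i1 i2])
  also have "\<dots> \<le> (LBINT z. (L / \<tau>) * (std_normal_density z * \<bar>z\<bar>))"
  proof (rule integral_abs_bound_integral[OF Bochner_Integration.integrable_diff[OF i1 i2] integrable_mult_right[OF n1]])
    fix z
    have "\<bar>U (x - z / \<tau>) - U x\<bar> \<le> L * \<bar>z\<bar> / \<tau>"
      using L[of "x - z / \<tau>" x] \<tau> by (simp add: abs_divide)
    then have "\<bar>U (x - z / \<tau>) - U x\<bar> * std_normal_density z \<le> L * \<bar>z\<bar> / \<tau> * std_normal_density z"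
      by (rule mult_right_mono) simp
    then show "\<bar>U (x - z / \<tau>) * std_normal_density z - U x * std_normal_density z\<bar> \<le> (L / \<tau>) * (std_normal_density z * \<bar>z\<bar>)"
      unfolding left_diff_distrib[symmetric] abs_mult by (simp add: mult_ac)
  qed
  also have "\<dots> = L * (LBINT z. std_normal_density z * \<bar>z\<bar>) / \<tau>" by simp
  finally show ?thesis unfolding e1 using e2 by simp
qed

text \<open>\<open>U\<close> is replaced by its mollification, a superposition of translated
  Gaussians on which the limit of the semigroups is known. The contraction property makes the
  replacement error uniform in \<open>n\<close>, so the limits in \<open>n\<close> and in \<tau> may
  be taken one after the other; integrability of \<open>U\<close> supplies the majorants.\<close>

lemma semi_tendsto_kernel:
  assumes U[measurable]: "U \<in> borel_measurable borel" and M: "\<And>x. \<bar>U x\<bar> \<le> M"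
    and L: "\<And>x y. \<bar>U x - U y\<bar> \<le> L * \<bar>x - y\<bar>" and int: "integrable lborel U"
  shows "(\<lambda>n. K.semi n t U 0) \<longlonglongrightarrow> (LBINT y. U y * P y)"
proof -
  define c where "c = L * (LBINT z. std_normal_density z * \<bar>z\<bar>)"
  define f where "f \<tau> x = (LBINT y. (\<tau> / sqrt (2 * pi) * U y) * gauss \<tau> (x + - y))" for \<tau> x
  define A where "A \<tau> = (LBINT y. U y * (\<tau> / sqrt (2 * pi) * G \<tau> (- y)))" for \<tau>
  have [measurable]: "G \<tau> \<in> borel_measurable borel" for \<tau>
    unfolding G_def by measurable
  have close: "\<bar>f \<tau> x - U x\<bar> \<le> c / \<tau>" if "0 < \<tau>" for \<tau> x
    unfolding f_def c_def by (rule mollifier_close[OF U M L that])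
  have [measurable]: "f \<tau> \<in> borel_measurable borel" for \<tau> unfolding f_def by measurable
  have semi_close: "\<bar>K.semi n t (f \<tau>) 0 - K.semi n t U 0\<bar> \<le> c / \<tau>" if \<tau>: "0 < \<tau>" for n \<tau>
  proof -
    have fb: "\<bar>f \<tau> x\<bar> \<le> M + c / \<tau>" for x using close[OF \<tau>, of x] M[of x] by linarith
    have "\<bar>K.semi n t (\<lambda>x. 1 * f \<tau> x + (-1) * U x) 0\<bar> \<le> c / \<tau>"
    proof (rule K.semi_bound)
      show "\<bar>1 * f \<tau> x + (-1) * U x\<bar> \<le> c / \<tau>" for x using close[OF \<tau>, of x] by simp
    qed (use t_pos in auto)
    also have "K.semi n t (\<lambda>x. 1 * f \<tau> x + (-1) * U x) 0 = 1 * K.semi n t (f \<tau>) 0 + (-1) * K.semi n t U 0"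
      by (rule K.semi_linear[OF _ fb U M]) measurable
    finally show ?thesis by simp
  qed
  have semi_f: "K.semi n t (f \<tau>) 0 = (LBINT y. (\<tau> / sqrt (2 * pi) * U y) * K.semi n t (gauss \<tau>) (- y))" for n \<tau>
  proof -
    have "K.semi n t (\<lambda>x. LBINT y. (\<tau> / sqrt (2 * pi) * U y) * gauss \<tau> (x + - y)) 0
       = (LBINT y. (\<tau> / sqrt (2 * pi) * U y) * K.semi n t (\<lambda>x. gauss \<tau> (x + - y)) 0)"
    proof (rule K.semi_parametric[where M = 1])
      show "integrable lborel (\<lambda>y. \<tau> / sqrt (2 * pi) * U y)" by (rule integrable_mult_right[OF int])
      show "(\<lambda>(x, y). gauss \<tau> (x + - y)) \<in> borel_measurable (borel \<Otimes>\<^sub>M borel)" by measurable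
      show "\<bar>gauss \<tau> (x + - y)\<bar> \<le> 1" for x y by (rule gauss_abs)
    qed
    then show ?thesis unfolding K.semi_translate f_def[abs_def] add_0 .
  qed
  have lim_n: "(\<lambda>n. K.semi n t (f \<tau>) 0) \<longlonglongrightarrow> A \<tau>" for \<tau>
  proof -
    have "(\<lambda>n. LBINT y. (\<tau> / sqrt (2 * pi) * U y) * K.semi n t (gauss \<tau>) (- y)) \<longlonglongrightarrow> (LBINT y. (\<tau> / sqrt (2 * pi) * U y) * G \<tau> (- y))"
    proof (rule integral_dominated_convergence)
      show "integrable lborel (\<lambda>y. \<bar>\<tau> / sqrt (2 * pi) * U y\<bar>)"
        by (rule integrable_abs) (rule integrable_mult_right[OF int])
      show "AE y in lborel. (\<lambda>n. (\<tau> / sqrt (2 * pi) * U y) * K.semi n t (gauss \<tau>) (- y)) \<longlonglongrightarrow> (\<tau> / sqrt (2 * pi) * U y) * G \<tau> (- y)"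
        by (intro AE_I2 tendsto_mult_left semi_gauss_tendsto)
      show "AE y in lborel. norm ((\<tau> / sqrt (2 * pi) * U y) * K.semi n t (gauss \<tau>) (- y)) \<le> \<bar>\<tau> / sqrt (2 * pi) * U y\<bar>" for n
      proof (rule AE_I2)
        fix y
        have "\<bar>K.semi n t (gauss \<tau>) (- y)\<bar> \<le> 1"
          by (rule K.semi_bound[OF gauss_measurable gauss_abs]) (use t_pos in simp)
        then have "\<bar>\<tau> / sqrt (2 * pi) * U y\<bar> * \<bar>K.semi n t (gauss \<tau>) (- y)\<bar> \<le> \<bar>\<tau> / sqrt (2 * pi) * U y\<bar> * 1"
          by (rule mult_left_mono) simp
        then show "norm ((\<tau> / sqrt (2 * pi) * U y) * K.semi n t (gauss \<tau>) (- y)) \<le> \<bar>\<tau> / sqrt (2 * pi) * U y\<bar>"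
          unfolding real_norm_def abs_mult[of "\<tau> / sqrt (2 * pi) * U y"] by (simp only: mult_1_right)
      qed
    qed measurable
    then show ?thesis unfolding semi_f A_def by (simp only: mult.commute[of _ "U _"] mult.assoc)
  qed
  have lim_m: "(\<lambda>m. A (real (Suc m))) \<longlonglongrightarrow> (LBINT y. U y * P y)"
    unfolding A_def
  proof (rule integral_dominated_convergence)
    show "integrable lborel (\<lambda>y. \<bar>U y\<bar> * ((1 / (2 * pi)) * (LBINT \<xi>. E \<xi>)))"
      by (rule integrable_mult_left) (rule integrable_abs[OF int])
    show "AE y in lborel. (\<lambda>m. U y * (real (Suc m) / sqrt (2 * pi) * G (real (Suc m)) (- y))) \<longlonglongrightarrow> U y * P y"
    proof (rule AE_I2)
      fix y
      show "(\<lambda>m. U y * (real (Suc m) / sqrt (2 * pi) * G (real (Suc m)) (- y))) \<longlonglongrightarrow> U y * P y"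
        using tendsto_mult_left[OF scaled_G_tendsto[of "- y"], of "U y"] unfolding P_even .
    qed
    show "AE y in lborel. norm (U y * (real (Suc m) / sqrt (2 * pi) * G (real (Suc m)) (- y))) \<le> \<bar>U y\<bar> * ((1 / (2 * pi)) * (LBINT \<xi>. E \<xi>))" for m
      unfolding real_norm_def abs_mult[of "U _"]
      by (intro AE_I2 mult_left_mono scaled_G_bound) simp_all
  qed measurable
  show ?thesis
  proof (rule LIMSEQ_I)
    fix e :: real assume e: "0 < e"
    have "(\<lambda>m. c * (1 / real (Suc m))) \<longlonglongrightarrow> c * 0"
      by (rule tendsto_mult_left) (rule LIMSEQ_Suc[OF lim_1_over_n])
    then have "\<forall>\<^sub>F m in sequentially. c * (1 / real (Suc m)) < e / 3"
      using e by (intro order_tendstoD(2)) auto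
    moreover have "\<forall>\<^sub>F m in sequentially. \<bar>A (real (Suc m)) - (LBINT y. U y * P y)\<bar> < e / 3"
      using tendstoD[OF lim_m, of "e / 3"] e by (simp add: dist_real_def)
    ultimately have "\<forall>\<^sub>F m in sequentially. c * (1 / real (Suc m)) < e / 3 \<and> \<bar>A (real (Suc m)) - (LBINT y. U y * P y)\<bar> < e / 3"
      by (rule eventually_conj)
    then obtain m where m: "c * (1 / real (Suc m)) < e / 3" "\<bar>A (real (Suc m)) - (LBINT y. U y * P y)\<bar> < e / 3"
      unfolding eventually_sequentially by blast
    define \<tau> where "\<tau> = real (Suc m)"
    have \<tau>: "0 < \<tau>" "c / \<tau> < e / 3" "\<bar>A \<tau> - (LBINT y. U y * P y)\<bar> < e / 3"
      using m by (simp_all add: \<tau>_def)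
    obtain N where N: "\<And>n. n \<ge> N \<Longrightarrow> \<bar>K.semi n t (f \<tau>) 0 - A \<tau>\<bar> < e / 3"
      using LIMSEQ_D[OF lim_n[of \<tau>], of "e / 3"] e by auto
    have "norm (K.semi n t U 0 - (LBINT y. U y * P y)) < e" if "n \<ge> N" for n
      using N[OF that] semi_close[OF \<tau>(1), of n] \<tau>(2,3) unfolding real_norm_def by linarith
    then show "\<exists>N. \<forall>n\<ge>N. norm (K.semi n t U 0 - (LBINT y. U y * P y)) < e" by blast
  qed
qed

end

section \<open>Representation by the heat kernel\<close>

lemma (in jump_kernel) semi_mono:
  assumes f: "f \<in> borel_measurable borel" "\<And>x. \<bar>f x\<bar> \<le> M" and g: "g \<in> borel_measurable borel" "\<And>x. \<bar>g x\<bar> \<le> N"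
    and le: "\<And>x. f x \<le> g x" and t: "0 \<le> t"
  shows "semi t f x \<le> semi t g x"
proof -
  have "0 \<le> semi t (\<lambda>x. 1 * g x + (-1) * f x) x"
  proof (rule semi_nonneg)
    show "(\<lambda>x. 1 * g x + (-1) * f x) \<in> borel_measurable borel" using f(1) g(1) by measurable
    show "\<bar>1 * g x + (-1) * f x\<bar> \<le> N + M" for x using f(2)[of x] g(2)[of x] by linarith
    show "0 \<le> 1 * g x + (-1) * f x" for x using le[of x] by linarith
  qed (rule t)
  also have "semi t (\<lambda>x. 1 * g x + (-1) * f x) x = 1 * semi t g x + (-1) * semi t f x"
    by (rule semi_linear[OF g f])
  finally show ?thesis by simp
qed

context fractional_heat
begin

lemma P_bound: "\<bar>P x\<bar> \<le> (1 / (2 * pi)) * (LBINT \<xi>. E \<xi>)"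
proof (rule LIMSEQ_le_const2)
  show "(\<lambda>m. \<bar>real (Suc m) / sqrt (2 * pi) * G (real (Suc m)) x\<bar>) \<longlonglongrightarrow> \<bar>P x\<bar>"
    by (rule tendsto_rabs) (rule scaled_G_tendsto)
  have "\<bar>real (Suc m) / sqrt (2 * pi) * G (real (Suc m)) x\<bar> \<le> (1 / (2 * pi)) * (LBINT \<xi>. E \<xi>)" for m
    by (rule scaled_G_bound) simp
  then show "\<exists>N. \<forall>m\<ge>N. \<bar>real (Suc m) / sqrt (2 * pi) * G (real (Suc m)) x\<bar> \<le> (1 / (2 * pi)) * (LBINT \<xi>. E \<xi>)"
    by blast
qed

lemma gauss_P_integrable: "0 < \<tau> \<Longrightarrow> integrable lborel (\<lambda>y. gauss \<tau> y * P y)"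
  by (subst mult.commute, rule integrable_mult_bounded[OF gauss_integrable P_measurable P_bound]) simp

text \<open>The same sequence of semigroup values has both sides as limits, once through the kernel
  and once through the Fourier formula.\<close>

lemma gauss_P_integral:
  assumes "0 < \<tau>"
  shows "(LBINT y. gauss \<tau> y * P y) = G \<tau> 0"
proof (rule LIMSEQ_unique[OF _ semi_gauss_tendsto])
  show "(\<lambda>n. K.semi n t (gauss \<tau>) 0) \<longlonglongrightarrow> (LBINT y. gauss \<tau> y * P y)"
  proof (rule semi_tendsto_kernel[OF gauss_measurable gauss_abs])
    show "\<bar>gauss \<tau> x - gauss \<tau> y\<bar> \<le> \<tau> * \<bar>x - y\<bar>" for x y
      by (rule gauss_lipschitz) (use assms in simp)
    show "integrable lborel (gauss \<tau>)" by (rule gauss_integrable) (use assms in simp)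
  qed
qed

text \<open>Continuity of \<open>E\<close> at the origin with \<open>E 0 = 1\<close>: this is where
  the total mass of the kernel is determined.\<close>

lemma G_0_tendsto: "(\<lambda>m. G (1 / real (Suc m)) 0) \<longlonglongrightarrow> 1"
proof -
  have "(\<lambda>m. LBINT \<xi>. std_normal_density \<xi> * (E (1 / real (Suc m) * \<xi>) * cos (1 / real (Suc m) * \<xi> * 0)))
      \<longlonglongrightarrow> (LBINT \<xi>. std_normal_density \<xi>)"
  proof (rule integral_dominated_convergence)
    show "integrable lborel std_normal_density" by (rule integrable_normal_density) simp
    show "AE \<xi> in lborel. (\<lambda>m. std_normal_density \<xi> * (E (1 / real (Suc m) * \<xi>) * cos (1 / real (Suc m) * \<xi> * 0))) \<longlonglongrightarrow> std_normal_density \<xi>"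
    proof (rule AE_I2)
      fix \<xi> :: real
      have "(\<lambda>m. \<bar>1 / real (Suc m) * \<xi>\<bar>) \<longlonglongrightarrow> \<bar>0 * \<xi>\<bar>"
        by (intro tendsto_intros LIMSEQ_Suc[OF lim_1_over_n])
      then have "(\<lambda>m. \<bar>1 / real (Suc m) * \<xi>\<bar> powr (2 * s)) \<longlonglongrightarrow> \<bar>0 * \<xi>\<bar> powr (2 * s)"
        by (rule tendsto_powr'[OF _ tendsto_const]) (use s_pos in simp)
      then have "(\<lambda>m. std_normal_density \<xi> * (exp (- (\<bar>1 / real (Suc m) * \<xi>\<bar> powr (2 * s)) * t) * 1))
          \<longlonglongrightarrow> std_normal_density \<xi> * (exp (- (\<bar>0 * \<xi>\<bar> powr (2 * s)) * t) * 1)"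
        by (intro tendsto_mult tendsto_const tendsto_exp tendsto_minus)
      then show "(\<lambda>m. std_normal_density \<xi> * (E (1 / real (Suc m) * \<xi>) * cos (1 / real (Suc m) * \<xi> * 0))) \<longlonglongrightarrow> std_normal_density \<xi>"
        unfolding E_def by simp
    qed
    show "AE \<xi> in lborel. norm (std_normal_density \<xi> * (E (1 / real (Suc m) * \<xi>) * cos (1 / real (Suc m) * \<xi> * 0))) \<le> std_normal_density \<xi>" for m
    proof (rule AE_I2)
      fix \<xi> :: real
      have "std_normal_density \<xi> * E (1 / real (Suc m) * \<xi>) \<le> std_normal_density \<xi> * 1"
        by (intro mult_left_mono E_le_1) simp
      then show "norm (std_normal_density \<xi> * (E (1 / real (Suc m) * \<xi>) * cos (1 / real (Suc m) * \<xi> * 0))) \<le> std_normal_density \<xi>"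
        using E_pos[of "1 / real (Suc m) * \<xi>"] by (simp add: abs_mult)
    qed
  qed measurable
  then show ?thesis unfolding G_def by (simp add: integral_normal_density)
qed

lemma gauss_tendsto_1: "(\<lambda>m. gauss (1 / real (Suc m)) y) \<longlonglongrightarrow> 1"
proof -
  have "(\<lambda>m. exp (- (1 / real (Suc m) * y)\<^sup>2 / 2)) \<longlonglongrightarrow> exp (- (0 * y)\<^sup>2 / 2)"
    by (intro tendsto_intros LIMSEQ_Suc[OF lim_1_over_n]) simp
  then show ?thesis by (simp add: gauss_def)
qed

text \<open>Wide Gaussians increase to \<open>1\<close> and \<open>P\<close> is nonnegative, so
  monotone convergence applies; the integrals \<open>G (1 / real (Suc m)) 0\<close> have a finite
  limit.\<close>

lemma P_integrable: "integrable lborel P"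
proof (rule integrable_monotone_convergence)
  show "integrable lborel (\<lambda>y. gauss (1 / real (Suc m)) y * P y)" for m
    by (rule gauss_P_integrable) simp
  show "AE y in lborel. mono (\<lambda>m. gauss (1 / real (Suc m)) y * P y)"
  proof (intro AE_I2 monoI mult_right_mono P_nonneg)
    fix y :: real and m m' :: nat assume "m \<le> m'"
    then have "1 / real (Suc m') * \<bar>y\<bar> \<le> 1 / real (Suc m) * \<bar>y\<bar>"
      by (intro mult_right_mono divide_left_mono) auto
    then have "\<bar>1 / real (Suc m') * y\<bar> \<le> \<bar>1 / real (Suc m) * y\<bar>"
      by (simp only: abs_mult abs_divide abs_one abs_of_nat)
    then have "(1 / real (Suc m') * y)\<^sup>2 \<le> (1 / real (Suc m) * y)\<^sup>2"
      by (rule abs_le_square_iff[THEN iffD1])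
    then show "gauss (1 / real (Suc m)) y \<le> gauss (1 / real (Suc m')) y"
      unfolding gauss_def by simp
  qed
  show "AE y in lborel. (\<lambda>m. gauss (1 / real (Suc m)) y * P y) \<longlonglongrightarrow> P y"
  proof (rule AE_I2)
    fix y
    show "(\<lambda>m. gauss (1 / real (Suc m)) y * P y) \<longlonglongrightarrow> P y"
      using tendsto_mult[OF gauss_tendsto_1 tendsto_const, of y "P y"] by (simp only: mult_1)
  qed
  have "(LBINT y. gauss (1 / real (Suc m)) y * P y) = G (1 / real (Suc m)) 0" for m
    by (rule gauss_P_integral) simp
  then show "(\<lambda>m. LBINT y. gauss (1 / real (Suc m)) y * P y) \<longlonglongrightarrow> 1"
    using G_0_tendsto by simp
qed measurable

text \<open>Multiplying by a wide Gaussian makes \<open>U\<close> integrable; the error is controlled by the mass that the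
  semigroup moves to infinity, which vanishes because the symbol is continuous at the origin.\<close>

lemma heat_eq_kernel_0:
  assumes U: "U \<in> Cb_infty UNIV"
  shows "heat t U 0 = (LBINT y. U y * P y)"
proof -
  note [measurable] = Cb_infty_borel[OF U]
  have t: "0 \<le> t" using t_pos by simp
  obtain M where M: "\<And>x. \<bar>U x\<bar> \<le> M" using Cb_infty_bound[OF U] by blast
  obtain L where "\<And>x. \<bar>deriv U x\<bar> \<le> L" using Cb_infty_bound[OF Cb_infty_derivD(2)[OF U]] by blast
  then have L: "\<bar>U x - U y\<bar> \<le> L * \<bar>x - y\<bar>" for x y
    by (rule has_real_derivative_bound[OF Cb_infty_derivD(1)[OF U]])
  have M0: "0 \<le> M" using M[of 0] by linarith
  define g where "g m = gauss (1 / real (Suc m))" for m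
  have g: "g m \<in> borel_measurable borel" "\<bar>g m x\<bar> \<le> 1" "0 \<le> g m x" "g m x \<le> 1" for m x
    unfolding g_def by (rule gauss_measurable gauss_abs gauss_nonneg gauss_le_1)+
  note [measurable] = g(1)
  define V where "V m x = U x * g m x" for m x
  have [measurable]: "V m \<in> borel_measurable borel" for m unfolding V_def by measurable
  have VM: "\<bar>V m x\<bar> \<le> M" for m x
    using mult_mono[OF M g(2)[of m x] M0] by (simp add: V_def abs_mult)
  have V_lim: "(\<lambda>n. K.semi n t (V m) 0) \<longlonglongrightarrow> (LBINT y. V m y * P y)" for m
  proof (rule semi_tendsto_kernel[OF _ VM])
    show "\<bar>V m x - V m y\<bar> \<le> (M * (1 / real (Suc m)) + L) * \<bar>x - y\<bar>" for x y
    proof -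
      have "\<bar>U x * (g m x - g m y)\<bar> \<le> M * (1 / real (Suc m) * \<bar>x - y\<bar>)"
        unfolding abs_mult g_def by (intro mult_mono M gauss_lipschitz) (use M0 in simp_all)
      moreover have "\<bar>(U x - U y) * g m y\<bar> \<le> (L * \<bar>x - y\<bar>) * 1"
        unfolding abs_mult by (intro mult_mono L g(2)) (use order_trans[OF abs_ge_zero L] in simp_all)
      moreover have "V m x - V m y = U x * (g m x - g m y) + (U x - U y) * g m y"
        unfolding V_def by (simp add: algebra_simps)
      moreover have "(M * (1 / real (Suc m)) + L) * \<bar>x - y\<bar> = M * (1 / real (Suc m) * \<bar>x - y\<bar>) + (L * \<bar>x - y\<bar>) * 1"
        by (simp only: distrib_right mult.assoc mult_1_right)
      ultimately show ?thesis by linarith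
    qed
    show "integrable lborel (V m)"
      unfolding V_def[abs_def] g_def by (rule integrable_mult_bounded[OF gauss_integrable _ M]) simp_all
  qed measurable
  \<comment> \<open>The loss \<open>U x - V m x = U x * (1 - g m x)\<close> is at most
    \<open>M * (1 - g m x)\<close> in absolute value; positivity and exactness on constants transfer
    this bound to the semigroups.\<close>
  have step: "\<bar>K.semi n t U 0 - K.semi n t (V m) 0\<bar> \<le> M - M * K.semi n t (g m) 0" for n m
  proof -
    have lin: "K.semi n t (\<lambda>x. a * U x + b * V m x) 0 = a * K.semi n t U 0 + b * K.semi n t (V m) 0" for a b
      by (rule K.semi_linear[OF _ M _ VM]) measurable
    have "K.semi n t (\<lambda>x. M * 1 + (- M) * g m x) 0 = M * K.semi n t (\<lambda>x. 1) 0 + (- M) * K.semi n t (g m) 0"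
      by (rule K.semi_linear[where M = 1 and N = 1]) (use g in simp_all)
    then have lin2: "K.semi n t (\<lambda>x. M * 1 + (- M) * g m x) 0 = M - M * K.semi n t (g m) 0"
      by (simp add: K.semi_const)
    have le: "a * U x + (- a) * V m x \<le> M * 1 + (- M) * g m x" if "\<bar>a\<bar> = 1" for a x
    proof -
      have "(a * U x) * (1 - g m x) \<le> M * (1 - g m x)"
        using M[of x] that g(4)[of m x] by (intro mult_right_mono) (auto simp: abs_le_iff abs_if split: if_splits)
      then show ?thesis unfolding V_def by (simp add: algebra_simps)
    qed
    have b1: "\<bar>a * U x + (- a) * V m x\<bar> \<le> 2 * M" if "\<bar>a\<bar> = 1" for a x
      using M[of x] VM[of m x] that by (auto simp: abs_if split: if_splits)
    have b2: "\<bar>M * 1 + (- M) * g m x\<bar> \<le> 2 * M" for x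
    proof -
      have "0 \<le> M * g m x" by (rule mult_nonneg_nonneg[OF M0 g(3)])
      moreover have "M * g m x \<le> M * 1" by (rule mult_left_mono[OF g(4) M0])
      ultimately show ?thesis by (simp add: abs_if)
    qed
    have "K.semi n t (\<lambda>x. a * U x + (- a) * V m x) 0 \<le> K.semi n t (\<lambda>x. M * 1 + (- M) * g m x) 0" if "\<bar>a\<bar> = 1" for a
      by (rule K.semi_mono[OF _ b1[OF that] _ b2 le[OF that] t]) measurable
    from this[of 1] this[of "-1"] show ?thesis unfolding lin lin2 by (simp add: abs_le_iff)
  qed
  have est: "\<bar>heat t U 0 - (LBINT y. V m y * P y)\<bar> \<le> M - M * G (1 / real (Suc m)) 0" for m
  proof (rule LIMSEQ_le)
    show "(\<lambda>n. \<bar>K.semi n t U 0 - K.semi n t (V m) 0\<bar>) \<longlonglongrightarrow> \<bar>heat t U 0 - (LBINT y. V m y * P y)\<bar>"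
      by (intro tendsto_rabs tendsto_diff heat_tendsto[OF U t] V_lim)
    show "(\<lambda>n. M - M * K.semi n t (g m) 0) \<longlonglongrightarrow> M - M * G (1 / real (Suc m)) 0"
      unfolding g_def by (intro tendsto_diff tendsto_mult tendsto_const semi_gauss_tendsto)
    show "\<exists>N. \<forall>n\<ge>N. \<bar>K.semi n t U 0 - K.semi n t (V m) 0\<bar> \<le> M - M * K.semi n t (g m) 0"
      using step by blast
  qed
  have lim: "(\<lambda>m. LBINT y. V m y * P y) \<longlonglongrightarrow> (LBINT y. U y * P y)"
  proof (rule integral_dominated_convergence)
    show "integrable lborel (\<lambda>y. M * P y)" by (rule integrable_mult_right[OF P_integrable])
    show "AE y in lborel. (\<lambda>m. V m y * P y) \<longlonglongrightarrow> U y * P y"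
    proof (rule AE_I2)
      fix y
      have "(\<lambda>m. U y * gauss (1 / real (Suc m)) y * P y) \<longlonglongrightarrow> U y * 1 * P y"
        by (intro tendsto_mult tendsto_const gauss_tendsto_1)
      then show "(\<lambda>m. V m y * P y) \<longlonglongrightarrow> U y * P y" unfolding V_def g_def by simp
    qed
    show "AE y in lborel. norm (V m y * P y) \<le> M * P y" for m
      using mult_right_mono[OF VM P_nonneg] by (intro AE_I2) (simp add: abs_mult P_nonneg)
  qed measurable
  \<comment> \<open>The limit \<open>1\<close> of \<open>G (1 / real (Suc m)) 0\<close> says that no
    mass escapes, so the error bound closes to zero.\<close>
  have "\<bar>heat t U 0 - (LBINT y. U y * P y)\<bar> \<le> M - M * 1"
  proof (rule LIMSEQ_le)
    show "(\<lambda>m. \<bar>heat t U 0 - (LBINT y. V m y * P y)\<bar>) \<longlonglongrightarrow> \<bar>heat t U 0 - (LBINT y. U y * P y)\<bar>"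
      by (intro tendsto_rabs tendsto_diff tendsto_const lim)
    show "(\<lambda>m. M - M * G (1 / real (Suc m)) 0) \<longlonglongrightarrow> M - M * 1"
      by (intro tendsto_diff tendsto_mult tendsto_const G_0_tendsto)
    show "\<exists>N. \<forall>m\<ge>N. \<bar>heat t U 0 - (LBINT y. V m y * P y)\<bar> \<le> M - M * G (1 / real (Suc m)) 0"
      using est by blast
  qed
  then show ?thesis by simp
qed

text \<open>Translation moves the evaluation point to the origin, and evenness of \<open>P\<close>
  produces the argument \<open>r - \<sigma>\<close>.\<close>

lemma heat_eq_kernel:
  assumes U: "U \<in> Cb_infty UNIV"
  shows "heat t U r = (LBINT \<sigma>. frac_heat_kernel s (r - \<sigma>) t * U \<sigma>)"
proof -
  have "heat t U r = heat t (\<lambda>x. U (x + r)) 0" using heat_translate[of t U r 0] by simp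
  also have "\<dots> = (LBINT y. U (y + r) * P y)"
    by (rule heat_eq_kernel_0[OF Cb_infty_translate[OF U]])
  also have "\<dots> = \<bar>1\<bar> *\<^sub>R (LBINT \<sigma>. U (- r + 1 * \<sigma> + r) * P (- r + 1 * \<sigma>))"
    by (rule lborel_integral_real_affine) simp
  also have "\<dots> = (LBINT \<sigma>. P (r - \<sigma>) * U \<sigma>)"
  proof -
    have "U (- r + 1 * \<sigma> + r) * P (- r + 1 * \<sigma>) = P (r - \<sigma>) * U \<sigma>" for \<sigma>
      using P_even[of "r - \<sigma>"] by simp
    then show ?thesis by (simp only: abs_one scaleR_one)
  qed
  finally show ?thesis unfolding P_def .
qed

end

theorem theorem2p10:
  fixes s :: real and u\<^sub>0 :: "real ^ 'n \<Rightarrow> real"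
  assumes "CARD('n) \<ge> 2"
    and "1/2 < s" and "s < 1"
    and "u\<^sub>0 \<in> Cb_infty UNIV"
    and "radial u\<^sub>0" and "radially_nonincreasing u\<^sub>0"
  shows "\<exists>u :: real ^ 'n \<Rightarrow> real \<Rightarrow> real.
      (\<lambda>(x, t). u x t) \<in> Cb_infty (UNIV \<times> {0..}) \<and>
      (\<forall>t\<ge>0. radial (\<lambda>x. u x t)) \<and>
      classical_solution s u\<^sub>0 u \<and>
      (\<forall>U\<^sub>0 :: real \<Rightarrow> real.
         (\<forall>x. U\<^sub>0 (norm x) = u\<^sub>0 x) \<and> (\<forall>r\<ge>0. U\<^sub>0 (- r) = U\<^sub>0 r) \<longrightarrow>
         (\<forall>t>0. \<forall>x r. norm x = r \<longrightarrow>
            u x t = (LBINT \<sigma>. frac_heat_kernel s (r - \<sigma>) t * U\<^sub>0 \<sigma>)))"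
proof -
  interpret fractional s by unfold_locales (use assms(2,3) in auto)
  obtain e :: "real ^ 'n" where e: "norm e = 1" using vector_choose_size[of 1] by auto
  \<comment> \<open>The profile is read off along a full line through the origin, which makes it
    smooth and even without gluing two half lines.\<close>
  define U where "U r = u\<^sub>0 (r *\<^sub>R e)" for r
  have U: "U \<in> Cb_infty UNIV"
    using assms(4) Cb_upto_along_line[of _ u\<^sub>0 e] by (simp add: Cb_infty_def U_def[abs_def])
  have U_norm: "U (norm x) = u\<^sub>0 x" for x
  proof -
    have "norm (norm x *\<^sub>R e) = norm x" using e by simp
    then show ?thesis using assms(5) unfolding radial_def U_def by blast
  qed
  have U_mono: "radially_nonincreasing U"
    unfolding radially_nonincreasing_def
  proof (intro allI impI)
    fix r r' :: real assume "norm r \<le> norm r'"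
    then have "norm (r *\<^sub>R e) \<le> norm (r' *\<^sub>R e)" using e by simp
    then show "U r' \<le> U r" using assms(6) unfolding radially_nonincreasing_def U_def by blast
  qed
  define u where "u x t = heat t U (norm x)" for x :: "real ^ 'n" and t
  have even: "heat t U (- r) = heat t U r" if "0 \<le> t" for t r
    by (rule radially_nonincreasing_even[OF heat_radially_nonincreasing[OF U that U_mono]])
  have smooth: "(\<lambda>(x, t). u x t) \<in> Cb_infty (UNIV \<times> {0..})"
    unfolding Cb_infty_def u_def mem_Collect_eq
  proof
    fix k
    show "Cb_upto k half_space (\<lambda>(x :: real ^ 'n, t). heat t U (norm x))"
      by (rule Cb_upto_radial_extension[where f = "\<lambda>r t. heat t U r", OF Cb_upto_heat[OF U] even])
  qed
  have solution: "classical_solution s u\<^sub>0 u"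
    unfolding classical_solution_def
  proof (intro conjI allI impI)
    fix x :: "real ^ 'n" and t :: real
    show "u x 0 = u\<^sub>0 x" by (simp add: u_def heat_0 U_norm)
    assume t: "0 < t"
    have "((\<lambda>\<tau>. heat \<tau> U (norm x)) has_real_derivative heat t (lap U) (norm x)) (at t within {0..})"
      by (rule heat_time_deriv[OF U]) (use t in simp)
    \<comment> \<open>Positive times are interior to the half line, so the one-sided time derivative
      is two-sided.\<close>
    moreover have "at t within {0..} = at t"
      by (rule at_within_interior) (use t in simp)
    moreover have "infty_frac_laplacian s (\<lambda>y :: real ^ 'n. heat t U (norm y)) x = heat t (lap U) (norm x)"
    proof -
      have t0: "0 \<le> t" using t by simp
      have "infty_frac_laplacian s (\<lambda>y :: real ^ 'n. heat t U (norm y)) x = lap (heat t U) (norm x)"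
        by (rule infty_frac_laplacian_radial[OF heat_Cb_infty[OF U t0] heat_radially_nonincreasing[OF U t0 U_mono]])
      then show ?thesis using lap_heat_commute[OF U t0] by simp
    qed
    ultimately show "((\<lambda>\<tau>. u x \<tau>) has_real_derivative infty_frac_laplacian s (\<lambda>y. u y t) x) (at t)"
      by (simp add: u_def)
  qed
  have kernel: "u x t = (LBINT \<sigma>. frac_heat_kernel s (r - \<sigma>) t * U\<^sub>0 \<sigma>)"
    if U0: "\<forall>x. U\<^sub>0 (norm x) = u\<^sub>0 x" "\<forall>r\<ge>0. U\<^sub>0 (- r) = U\<^sub>0 r" and t: "0 < t" and r: "norm x = r" for U\<^sub>0 t x r
  proof -
    interpret fractional_heat s t by unfold_locales (use assms(2) t in auto)
    \<comment> \<open>The two conditions determine \<open>U\<^sub>0\<close> completely, on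
      nonnegative arguments by \<open>u\<^sub>0\<close> and on negative ones by reflection, so it
      must be the line profile \<open>U\<close>.\<close>
    have pos: "U\<^sub>0 r = U r" if "0 \<le> r" for r
      using U0(1)[rule_format, of "r *\<^sub>R e"] e that by (simp add: U_def)
    have "U\<^sub>0 r = U r" for r
    proof (cases "0 \<le> r")
      case False
      then have "U\<^sub>0 (- (- r)) = U (- r)"
        using U0(2)[rule_format, of "- r"] pos[of "- r"] by simp
      then show ?thesis using radially_nonincreasing_even[OF U_mono, of r] by simp
    qed (rule pos)
    then have "U\<^sub>0 = U" by (rule ext)
    then show ?thesis using heat_eq_kernel[OF U, of r] r by (simp add: u_def)
  qed
  show ?thesis
  proof (intro exI[of _ u] conjI allI impI)
    show "radial (\<lambda>x. u x t)" for t by (simp add: radial_def u_def)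
    show "u x t = (LBINT \<sigma>. frac_heat_kernel s (r - \<sigma>) t * U\<^sub>0 \<sigma>)"
      if "(\<forall>x. U\<^sub>0 (norm x) = u\<^sub>0 x) \<and> (\<forall>r\<ge>0. U\<^sub>0 (- r) = U\<^sub>0 r)" "0 < t" "norm x = r" for U\<^sub>0 t x r
      using kernel that by blast
  qed (rule smooth, rule solution)
qed

end
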